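(* Let $X$ be a normal (irreducible) affine variety over $\mathbb{K}$ with an effective regular action of the one-dimensional torus $\mathbb{G}_m$. Then there exists a compatible $\mathbb{G}_a$-action on $X$ if and only if the variety $X$ contains a prime divisor $D$ that is fixed by $\mathbb{G}_m$ pointwise.
   Context: $\mathbb{K}$ is an algebraically closed field of characteristic zero; all varieties are over $\mathbb{K}$ and are irreducible. $\mathbb{G}_m$ is the one-dimensional algebraic torus and $\mathbb{G}_a=(\mathbb{K},+)$ is the additive group. $\mathrm{Aut}(X)$ is the group of automorphisms of the algebraic variety $X$. A prime divisor is an irreducible closed subvariety of codimension one. Definition (compatible action). Let $X$ be an irreducible affine variety with an effective action of $\mathbb{G}_m$. A regular action $\mathbb{G}_a\times X\to X$ is called compatible if the subgroup $\mathbb{G}_m$ normalizes the subgroup $\mathbb{G}_a$ in $\mathrm{Aut}(X)$ (that is, the image of $\mathbb{G}_m$ in $\mathrm{Aut}(X)$ normalizes the image of $\mathbb{G}_a$), and generic $\mathbb{G}_a$-orbits on $X$ coincide with closures of generic $\mathbb{G}_m$-orbits, i.e. $\mathbb{G}_a\cdot x=\overline{\mathbb{G}_m\cdot x}$ for all $x$ in some non-empty open subset of $X$. *)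

theory Defs
  imports
    "HOL-Algebra.Group_Action"
    "HOL-Analysis.Abstract_Topology"
    "HOL-Computational_Algebra.Polynomial"
    "HOL-Library.Extended_Nat"
begin

section \<open>Algebras of functions and the Zariski topology\<close>

text \<open>The algebra of \<^typ>\<open>'k\<close>-valued functions generated by \<^term>\<open>B\<close>.\<close>

inductive_set fun_algebra :: "('a \<Rightarrow> 'k::field) set \<Rightarrow> ('a \<Rightarrow> 'k) set"
  for B :: "('a \<Rightarrow> 'k) set" where
  gen: "f \<in> B \<Longrightarrow> f \<in> fun_algebra B"
| const: "(\<lambda>_. c) \<in> fun_algebra B"
| add: "f \<in> fun_algebra B \<Longrightarrow> g \<in> fun_algebra B \<Longrightarrow> (\<lambda>x. f x + g x) \<in> fun_algebra B"
| mult: "f \<in> fun_algebra B \<Longrightarrow> g \<in> fun_algebra B \<Longrightarrow> (\<lambda>x. f x * g x) \<in> fun_algebra B"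

text \<open>Affine \<open>n\<close>-space is the type \<^typ>\<open>'n \<Rightarrow> 'k\<close> with \<^typ>\<open>'n\<close> finite of cardinality \<open>n\<close>.\<close>

definition polynomial_funs :: "(('n::finite \<Rightarrow> 'k::field) \<Rightarrow> 'k) set" where
  "polynomial_funs = fun_algebra (range (\<lambda>i x. x i))"

definition zariski :: "('n::finite \<Rightarrow> 'k::field) topology" where
  "zariski = topology (\<lambda>U. \<exists>S \<subseteq> polynomial_funs. U = {x. \<exists>p\<in>S. p x \<noteq> 0})"

lemma openin_zariski:
  fixes U :: "('n::finite \<Rightarrow> 'k::field) set"
  shows "openin zariski U \<longleftrightarrow> (\<exists>S \<subseteq> polynomial_funs. U = {x. \<exists>p\<in>S. p x \<noteq> 0})"
proof -
  let ?P = "\<lambda>U::('n \<Rightarrow> 'k) set. \<exists>S \<subseteq> polynomial_funs. U = {x. \<exists>p\<in>S. p x \<noteq> 0}"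
  have "?P (U \<inter> V)" if U: "?P U" and V: "?P V" for U V
  proof -
    obtain S T where S: "S \<subseteq> polynomial_funs" "U = {x. \<exists>p\<in>S. p x \<noteq> 0}"
      and T: "T \<subseteq> polynomial_funs" "V = {x. \<exists>p\<in>T. p x \<noteq> 0}"
      using U V by blast
    let ?W = "{\<lambda>x. p x * q x | p q. p \<in> S \<and> q \<in> T}"
    have "?W \<subseteq> polynomial_funs"
      using S(1) T(1) by (auto simp: polynomial_funs_def intro!: fun_algebra.mult)
    moreover have "U \<inter> V = {x. \<exists>p\<in>?W. p x \<noteq> 0}"
      unfolding S(2) T(2) by fastforce
    ultimately show ?thesis by blast
  qed
  moreover have "?P (\<Union>\<U>)" if \<U>: "\<forall>U\<in>\<U>. ?P U" for \<U>
  proof -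
    let ?S = "{p \<in> polynomial_funs. {x. p x \<noteq> 0} \<subseteq> \<Union>\<U>}"
    have "\<Union>\<U> \<subseteq> {x. \<exists>p\<in>?S. p x \<noteq> 0}"
    proof
      fix x assume "x \<in> \<Union>\<U>"
      then obtain U where U: "U \<in> \<U>" "x \<in> U" by blast
      then obtain S where S: "S \<subseteq> polynomial_funs" "U = {x. \<exists>p\<in>S. p x \<noteq> 0}"
        using \<U> by blast
      then obtain p where p: "p \<in> S" "p x \<noteq> 0" using U(2) by blast
      have "{y. p y \<noteq> 0} \<subseteq> U" unfolding S(2) using p(1) by blast
      then have "p \<in> ?S" using p(1) S(1) U(1) by blast
      then show "x \<in> {x. \<exists>p\<in>?S. p x \<noteq> 0}" using p(2) by blast
    qed
    then have "\<Union>\<U> = {x. \<exists>p\<in>?S. p x \<noteq> 0}" by blast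
    then show ?thesis by (intro exI[of _ ?S] conjI) blast
  qed
  ultimately have "istopology ?P"
    unfolding istopology_def by blast
  then show ?thesis
    by (simp add: zariski_def)
qed

lemma topspace_zariski [simp]: "topspace (zariski :: ('n::finite \<Rightarrow> 'k::field) topology) = UNIV"
proof -
  have "openin zariski (UNIV :: ('n \<Rightarrow> 'k) set)"
    unfolding openin_zariski
    by (rule exI[of _ "{\<lambda>_. 1}"]) (auto simp: polynomial_funs_def intro: fun_algebra.const)
  then show ?thesis
    using openin_subset by blast
qed


section \<open>Affine varieties\<close>

definition affine_variety :: "('n::finite \<Rightarrow> 'k::field) set \<Rightarrow> bool" where
  "affine_variety X \<longleftrightarrow> closedin zariski X \<and> X \<noteq> {} \<and>
     (\<forall>Y Z. closedin zariski Y \<and> closedin zariski Z \<and> X = Y \<union> Z \<longrightarrow> X = Y \<or> X = Z)"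

definition regular_fun :: "('n::finite \<Rightarrow> 'k::field) set \<Rightarrow> (('n \<Rightarrow> 'k) \<Rightarrow> 'k) \<Rightarrow> bool" where
  "regular_fun X f \<longleftrightarrow> (\<exists>p\<in>polynomial_funs. \<forall>x\<in>X. f x = p x)"

definition codimension :: "('n::finite \<Rightarrow> 'k::field) set \<Rightarrow> ('n \<Rightarrow> 'k) set \<Rightarrow> enat" where
  "codimension X D = Sup {enat m | m. \<exists>Z. Z 0 = D \<and> Z m = X \<and>
     (\<forall>i\<le>m. affine_variety (Z i)) \<and> (\<forall>i<m. Z i \<subset> Z (Suc i))}"

definition prime_divisor :: "('n::finite \<Rightarrow> 'k::field) set \<Rightarrow> ('n \<Rightarrow> 'k) set \<Rightarrow> bool" where
  "prime_divisor X D \<longleftrightarrow> affine_variety D \<and> D \<subseteq> X \<and> codimension X D = 1"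

text \<open>A rational function on a variety \<open>X\<close> is represented by any total function that
  equals a quotient of regular functions on some non-empty open subset of \<open>X\<close>; two
  representatives are equal in the function field of \<open>X\<close> iff they are generically equal.\<close>

definition generically_eq ::
  "('n::finite \<Rightarrow> 'k::field) set \<Rightarrow> (('n \<Rightarrow> 'k) \<Rightarrow> 'k) \<Rightarrow> (('n \<Rightarrow> 'k) \<Rightarrow> 'k) \<Rightarrow> bool" where
  "generically_eq X f g \<longleftrightarrow>
     (\<exists>U. openin (subtopology zariski X) U \<and> U \<noteq> {} \<and> (\<forall>x\<in>U. f x = g x))"

definition rational_fun :: "('n::finite \<Rightarrow> 'k::field) set \<Rightarrow> (('n \<Rightarrow> 'k) \<Rightarrow> 'k) \<Rightarrow> bool" where
  "rational_fun X h \<longleftrightarrow> (\<exists>f g. regular_fun X f \<and> regular_fun X g \<and> (\<exists>x\<in>X. g x \<noteq> 0) \<and>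
     generically_eq X h (\<lambda>x. f x / g x))"

definition integral_fun :: "('n::finite \<Rightarrow> 'k::field) set \<Rightarrow> (('n \<Rightarrow> 'k) \<Rightarrow> 'k) \<Rightarrow> bool" where
  "integral_fun X h \<longleftrightarrow> (\<exists>(d::nat) a. (\<forall>i<d. regular_fun X (a i)) \<and>
     generically_eq X (\<lambda>x. h x ^ d + (\<Sum>i<d. a i x * h x ^ i)) (\<lambda>_. 0))"

text \<open>The coordinate ring is integrally closed in the function field.\<close>

definition normal_affine_variety :: "('n::finite \<Rightarrow> 'k::field) set \<Rightarrow> bool" where
  "normal_affine_variety X \<longleftrightarrow> affine_variety X \<and>
     (\<forall>h. rational_fun X h \<and> integral_fun X h \<longrightarrow> (\<exists>r. regular_fun X r \<and> generically_eq X h r))"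


section \<open>Automorphisms and regular actions\<close>

definition morphism ::
  "('n::finite \<Rightarrow> 'k::field) set \<Rightarrow> ('m::finite \<Rightarrow> 'k) set \<Rightarrow> (('n \<Rightarrow> 'k) \<Rightarrow> ('m \<Rightarrow> 'k)) \<Rightarrow> bool" where
  "morphism X Y f \<longleftrightarrow> f \<in> X \<rightarrow> Y \<and> (\<forall>i. regular_fun X (\<lambda>x. f x i))"

definition Aut :: "('n::finite \<Rightarrow> 'k::field) set \<Rightarrow> (('n \<Rightarrow> 'k) \<Rightarrow> ('n \<Rightarrow> 'k)) monoid" where
  "Aut X = (BijGroup X) \<lparr>carrier := {f \<in> Bij X. morphism X X f \<and> morphism X X (inv_into X f)}\<rparr>"

text \<open>\<open>A\<close> is the coordinate ring of the affine algebraic group \<open>G\<close>. The coordinate ring of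
  \<open>G \<times> \<close> affine space is generated by the pullbacks of the coordinate rings of the two factors.\<close>

definition product_funs ::
  "('g \<Rightarrow> 'k::field) set \<Rightarrow> ('g \<times> ('n::finite \<Rightarrow> 'k) \<Rightarrow> 'k) set" where
  "product_funs A = fun_algebra ((\<lambda>u. u \<circ> fst) ` A \<union> (\<lambda>p. p \<circ> snd) ` polynomial_funs)"

definition regular_action ::
  "('g, 'r) monoid_scheme \<Rightarrow> ('g \<Rightarrow> 'k::field) set \<Rightarrow> ('n::finite \<Rightarrow> 'k) set
    \<Rightarrow> ('g \<Rightarrow> ('n \<Rightarrow> 'k) \<Rightarrow> ('n \<Rightarrow> 'k)) \<Rightarrow> bool" where
  "regular_action G A X \<phi> \<longleftrightarrow> group_action G X \<phi> \<and>
     (\<forall>i. \<exists>p\<in>product_funs A. \<forall>g\<in>carrier G. \<forall>x\<in>X. \<phi> g x i = p (g, x))"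

definition Gm :: "'k::field monoid" where
  "Gm = \<lparr>carrier = UNIV - {0}, monoid.mult = (*), one = 1\<rparr>"

definition Gm_funs :: "('k::field \<Rightarrow> 'k) set" where
  "Gm_funs = fun_algebra {\<lambda>t. t, \<lambda>t. inverse t}"

definition Ga :: "'k::field monoid" where
  "Ga = \<lparr>carrier = UNIV, monoid.mult = (+), one = 0\<rparr>"

definition Ga_funs :: "('k::field \<Rightarrow> 'k) set" where
  "Ga_funs = fun_algebra {\<lambda>t. t}"

lemma group_Gm: "group (Gm :: 'k::field monoid)"
proof (rule groupI)
  fix x :: 'k assume "x \<in> carrier Gm"
  then show "\<exists>y\<in>carrier Gm. y \<otimes>\<^bsub>Gm\<^esub> x = \<one>\<^bsub>Gm\<^esub>"
    by (intro bexI[of _ "inverse x"]) (auto simp: Gm_def)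
qed (auto simp: Gm_def)

lemma group_Ga: "group (Ga :: 'k::field monoid)"
proof (rule groupI)
  fix x :: 'k
  show "\<exists>y\<in>carrier Ga. y \<otimes>\<^bsub>Ga\<^esub> x = \<one>\<^bsub>Ga\<^esub>"
    by (intro bexI[of _ "- x"]) (auto simp: Ga_def)
qed (auto simp: Ga_def)

abbreviation regular_Gm_action ::
  "('n::finite \<Rightarrow> 'k::field) set \<Rightarrow> ('k \<Rightarrow> ('n \<Rightarrow> 'k) \<Rightarrow> ('n \<Rightarrow> 'k)) \<Rightarrow> bool" where
  "regular_Gm_action \<equiv> regular_action Gm Gm_funs"

abbreviation regular_Ga_action ::
  "('n::finite \<Rightarrow> 'k::field) set \<Rightarrow> ('k \<Rightarrow> ('n \<Rightarrow> 'k) \<Rightarrow> ('n \<Rightarrow> 'k)) \<Rightarrow> bool" where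
  "regular_Ga_action \<equiv> regular_action Ga Ga_funs"

definition compatible_action ::
  "('n::finite \<Rightarrow> 'k::field) set \<Rightarrow> ('k \<Rightarrow> ('n \<Rightarrow> 'k) \<Rightarrow> ('n \<Rightarrow> 'k))
    \<Rightarrow> ('k \<Rightarrow> ('n \<Rightarrow> 'k) \<Rightarrow> ('n \<Rightarrow> 'k)) \<Rightarrow> bool" where
  "compatible_action X \<phi> \<psi> \<longleftrightarrow> regular_Ga_action X \<psi> \<and>
     \<phi> ` carrier Gm \<subseteq> normalizer (Aut X) (\<psi> ` carrier Ga) \<and>
     (\<exists>U. openin (subtopology zariski X) U \<and> U \<noteq> {} \<and>
       (\<forall>x\<in>U. orbit Ga \<psi> x = Abstract_Topology.closure_of (subtopology zariski X) (orbit Gm \<phi> x)))"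


section \<open>The automorphism group\<close>

lemma polynomial_funs_compose:
  assumes "p \<in> polynomial_funs" and "\<And>i. (\<lambda>x. f x i) \<in> polynomial_funs"
  shows "(\<lambda>x. p (f x)) \<in> polynomial_funs"
  using assms(1) unfolding polynomial_funs_def
proof (induction rule: fun_algebra.induct)
  case (gen h)
  then show ?case using assms(2) by (auto simp: polynomial_funs_def)
qed (auto intro: fun_algebra.intros)

lemma morphism_compose:
  assumes f: "morphism X Y f" and g: "morphism Y Z g"
  shows "morphism X Z (\<lambda>x. g (f x))"
proof -
  have "regular_fun X (\<lambda>x. g (f x) i)" for i
  proof -
    obtain p where p: "p \<in> polynomial_funs" "\<forall>y\<in>Y. g y i = p y"
      using g unfolding morphism_def regular_fun_def by blast
    have "regular_fun X (\<lambda>x. f x j)" for j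
      using f unfolding morphism_def by blast
    then have "\<exists>q. q \<in> polynomial_funs \<and> (\<forall>x\<in>X. f x j = q x)" for j
      unfolding regular_fun_def by blast
    then obtain q where q: "\<And>j. q j \<in> polynomial_funs \<and> (\<forall>x\<in>X. f x j = q j x)"
      using choice[of "\<lambda>j q. q \<in> polynomial_funs \<and> (\<forall>x\<in>X. f x j = q x)"] by blast
    have "(\<lambda>x. p (\<lambda>j. q j x)) \<in> polynomial_funs"
      by (rule polynomial_funs_compose) (simp_all add: p(1) q)
    moreover have "g (f x) i = p (\<lambda>j. q j x)" if "x \<in> X" for x
    proof -
      have "f x = (\<lambda>j. q j x)" using q that by blast
      moreover have "f x \<in> Y" using f that by (auto simp: morphism_def)
      ultimately show ?thesis using p(2) by simp
    qed
    ultimately show ?thesis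
      unfolding regular_fun_def by (intro bexI[of _ "\<lambda>x. p (\<lambda>j. q j x)"]) simp_all
  qed
  moreover have "(\<lambda>x. g (f x)) \<in> X \<rightarrow> Z" using f g by (auto simp: morphism_def)
  ultimately show ?thesis by (simp add: morphism_def)
qed

lemma morphism_cong:
  assumes "morphism X Y f" "\<And>x. x \<in> X \<Longrightarrow> f x = g x"
  shows "morphism X Y g"
proof -
  have "g \<in> X \<rightarrow> Y"
    using assms by (auto simp: morphism_def Pi_iff)
  moreover have "regular_fun X (\<lambda>x. g x i)" for i
  proof -
    obtain p where "p \<in> polynomial_funs" "\<forall>x\<in>X. f x i = p x"
      using assms(1) unfolding morphism_def regular_fun_def by blast
    then show ?thesis
      unfolding regular_fun_def using assms(2) by (intro bexI[of _ p]) auto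
  qed
  ultimately show ?thesis by (simp add: morphism_def)
qed

lemma morphism_id:
  fixes X :: "('n::finite \<Rightarrow> 'k::field) set"
  shows "morphism X X (\<lambda>x. x)"
proof -
  have "(\<lambda>x. x i) \<in> polynomial_funs" for i :: 'n
    unfolding polynomial_funs_def by (rule fun_algebra.gen) blast
  then have "regular_fun X (\<lambda>x. x i)" for i
    unfolding regular_fun_def by (intro bexI[of _ "\<lambda>x. x i"]) auto
  then show ?thesis by (simp add: morphism_def)
qed

lemma subgroup_Aut: "subgroup (carrier (Aut X)) (BijGroup X)"
proof (rule group.subgroupI[OF group_BijGroup])
  show "carrier (Aut X) \<subseteq> carrier (BijGroup X)"
    by (auto simp: Aut_def BijGroup_def)
  have inv_id: "inv_into X (\<lambda>x\<in>X. x) x = x" if "x \<in> X" for x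
    using that by (intro inv_into_f_eq) (auto simp: inj_on_def)
  have "morphism X X (inv_into X (\<lambda>x\<in>X. x))"
    by (rule morphism_cong[OF morphism_id]) (simp only: inv_id)
  moreover have "morphism X X (\<lambda>x\<in>X. x)"
    by (rule morphism_cong[OF morphism_id]) simp
  ultimately have "(\<lambda>x\<in>X. x) \<in> carrier (Aut X)"
    by (simp add: Aut_def id_Bij)
  then show "carrier (Aut X) \<noteq> {}" by blast
next
  fix f assume "f \<in> carrier (Aut X)"
  then have f: "f \<in> Bij X" "morphism X X f" "morphism X X (inv_into X f)"
    by (auto simp: Aut_def)
  let ?g = "restrict (inv_into X f) X"
  have "?g \<in> Bij X" using f(1) by (rule restrict_inv_into_Bij)
  moreover have "morphism X X ?g" using f(3) by (rule morphism_cong) simp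
  moreover have "morphism X X (inv_into X ?g)"
  proof (rule morphism_cong[OF f(2)])
    fix x assume x: "x \<in> X"
    have "?g (f x) = x" "f x \<in> X"
      using f(1) x by (auto simp: Bij_def bij_betw_def)
    then show "f x = inv_into X ?g x"
      using \<open>?g \<in> Bij X\<close> by (metis Bij_def IntD2 bij_betw_def inv_into_f_f mem_Collect_eq)
  qed
  ultimately show "inv\<^bsub>BijGroup X\<^esub> f \<in> carrier (Aut X)"
    using f(1) by (simp add: Aut_def inv_BijGroup)
next
  fix f g assume "f \<in> carrier (Aut X)" "g \<in> carrier (Aut X)"
  then have f: "f \<in> Bij X" "morphism X X f" "morphism X X (inv_into X f)"
    and g: "g \<in> Bij X" "morphism X X g" "morphism X X (inv_into X g)"
    by (auto simp: Aut_def)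
  have B: "compose X f g \<in> Bij X" using f g by (simp add: compose_Bij)
  have "morphism X X (compose X f g)"
    by (rule morphism_cong[OF morphism_compose[OF g(2) f(2)]]) (simp add: compose_def)
  moreover have "morphism X X (inv_into X (compose X f g))"
  proof (rule morphism_cong[OF morphism_compose[OF f(3) g(3)]])
    fix x assume x: "x \<in> X"
    let ?y = "inv_into X g (inv_into X f x)"
    have "?y \<in> X" "compose X f g ?y = x"
      using f(1) g(1) x by (auto simp: Bij_def bij_betw_def compose_def inv_into_into f_inv_into_f)
    then show "?y = inv_into X (compose X f g) x"
      using B by (metis Bij_def IntD2 bij_betw_def inv_into_f_f mem_Collect_eq)
  qed
  ultimately show "f \<otimes>\<^bsub>BijGroup X\<^esub> g \<in> carrier (Aut X)"
    using f g B by (simp add: Aut_def BijGroup_def)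
qed

lemma group_Aut: "group (Aut X)"
proof -
  have "Aut X = (BijGroup X)\<lparr>carrier := carrier (Aut X)\<rparr>"
    by (simp add: Aut_def)
  then show ?thesis
    by (metis subgroup.subgroup_is_group[OF subgroup_Aut group_BijGroup])
qed

lemma regular_action_in_Aut:
  assumes \<phi>: "regular_action G A X \<phi>" and g: "g \<in> carrier G"
  shows "\<phi> g \<in> carrier (Aut X)"
proof -
  have act: "group_action G X \<phi>" using \<phi> by (simp add: regular_action_def)
  then have hom: "group_hom G (BijGroup X) \<phi>" by (simp add: group_action_def)
  then have G: "group G" by (simp add: group_hom_def)
  have B: "\<phi> h \<in> Bij X" if "h \<in> carrier G" for h
    using group_hom.hom_closed[OF hom that] by (simp add: BijGroup_def)
  have slice: "(\<lambda>x. p (h, x)) \<in> polynomial_funs" if "p \<in> product_funs A" for p h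
    using that unfolding product_funs_def
    by (induction rule: fun_algebra.induct)
       (auto simp: polynomial_funs_def intro: fun_algebra.intros)
  have M: "morphism X X (\<phi> h)" if h: "h \<in> carrier G" for h
  proof -
    have "regular_fun X (\<lambda>x. \<phi> h x i)" for i
    proof -
      obtain p where "p \<in> product_funs A" "\<forall>g\<in>carrier G. \<forall>x\<in>X. \<phi> g x i = p (g, x)"
        using \<phi> unfolding regular_action_def by blast
      then show ?thesis
        unfolding regular_fun_def using h slice by (intro bexI[of _ "\<lambda>x. p (h, x)"]) auto
    qed
    then show ?thesis using Bij_imp_funcset[OF B[OF h]] by (simp add: morphism_def)
  qed
  have "morphism X X (inv_into X (\<phi> g))"
  proof (rule morphism_cong[OF M])
    show "inv\<^bsub>G\<^esub> g \<in> carrier G" using G g by simp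
    have "\<phi> (inv\<^bsub>G\<^esub> g) = restrict (inv_into X (\<phi> g)) X"
      using group_hom.hom_inv[OF hom g] B[OF g] by (simp add: inv_BijGroup)
    then show "\<phi> (inv\<^bsub>G\<^esub> g) x = inv_into X (\<phi> g) x" if "x \<in> X" for x
      using that by simp
  qed
  then show ?thesis using B[OF g] M[OF g] by (simp add: Aut_def)
qed

end

theory Submission
  imports Defs
begin

text \<open>
  The action of the torus grades the coordinate ring of \<open>X\<close>, and both directions compare this grading
  with the order of vanishing along a divisor.

  Suppose that a compatible action \<open>\<psi>\<close> is given. A function is invariant under \<open>\<psi>\<close> iff it has weight
  zero, since the orbits of both groups through a general point have the same closure. Weights of both
  signs cannot occur: functions \<open>f\<close>, \<open>g\<close> of opposite weights would have no zeros on a general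
  \<open>\<psi>\<close>-orbit, because a product of their powers is invariant, and a polynomial without zeros on the
  affine line is constant (lemma \<open>weights_one_sided\<close>). So every torus orbit has a limit point, and
  sending \<open>x\<close> to its limit \<open>\<pi> x\<close> retracts \<open>X\<close> onto the fixed point set \<open>D\<close>, which is therefore
  irreducible (\<open>exists_retraction\<close>). That \<open>D\<close> has codimension one follows from a local slice of \<open>\<psi>\<close>: a
  function \<open>s\<close> with \<open>s (\<psi> v x) = s x + v c x\<close>. Up to powers of \<open>c\<close> every function is a polynomial in \<open>s\<close>
  over the functions of weight zero (\<open>slice_generates\<close>), and \<open>s\<close> can be normalized to vanish on
  \<open>D\<close>. Hence the ideal of a closed irreducible set \<open>Z\<close> with \<open>D \<subseteq> Z \<subset> X\<close> contains \<open>s\<close>, and with it all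
  functions that vanish on \<open>D\<close>.

  Conversely let \<open>D\<close> be a prime divisor of fixed points. Functions of nonzero weight vanish on \<open>D\<close>. As
  \<open>X\<close> is normal, the local ring of \<open>X\<close> along \<open>D\<close> is a discrete valuation ring, and a uniformizer \<open>\<tau>\<close> can
  be chosen homogeneous, of weight \<open>m\<close> say (\<open>exists_uniformizer\<close>). Units of the local ring have a nonzero
  component of weight zero; comparing weights in \<open>q f = \<tau> ^ n p\<close> shows that every homogeneous \<open>f\<close> has
  weight \<open>n m\<close> and that \<open>q\<close>, \<open>p\<close> can be taken of weight zero (\<open>fixed_divisor_uniformizer\<close>). So a common
  \<open>q\<close> of weight zero makes all \<open>q x\<^sub>j\<close> polynomials in \<open>\<tau>\<close> over the functions of weight zero, and
  replacing \<open>\<tau>\<close> by \<open>\<tau> + u q\<close> in them defines the required action. At a general point it moves along the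
  line that is swept out by letting \<open>\<tau>\<close> vary, and this line is the closure of the torus orbit.

  The statement about the local ring rests on two classical theorems for algebras of polynomial
  functions. Hilbert's basis theorem supplies the chain conditions, and the Nullstellensatz for prime
  ideals translates the codimension of \<open>D\<close>, which is about chains of closed sets, into the height of its
  ideal.
\<close>


section \<open>Algebras of functions\<close>

definition subalgebra :: "('a \<Rightarrow> 'k::field) set \<Rightarrow> bool" where
  "subalgebra R \<longleftrightarrow> (\<forall>c. (\<lambda>_. c) \<in> R) \<and> (\<forall>f\<in>R. \<forall>g\<in>R. (\<lambda>x. f x + g x) \<in> R) \<and>
     (\<forall>f\<in>R. \<forall>g\<in>R. (\<lambda>x. f x * g x) \<in> R)"

lemma subalgebra_fun_algebra: "subalgebra (fun_algebra B)"
  by (auto simp: subalgebra_def intro: fun_algebra.intros)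

lemma fun_algebra_least:
  assumes "f \<in> fun_algebra B" and "subalgebra R" and "B \<subseteq> R"
  shows "f \<in> R"
  using assms(1) by induction (use assms(2,3) in \<open>auto simp: subalgebra_def\<close>)

context
  fixes R :: "('a \<Rightarrow> 'k::field) set"
  assumes R: "subalgebra R"
begin

lemma subalgebra_const: "(\<lambda>_. c) \<in> R"
  using R by (simp add: subalgebra_def)

lemma subalgebra_add: "f \<in> R \<Longrightarrow> g \<in> R \<Longrightarrow> (\<lambda>x. f x + g x) \<in> R"
  using R by (simp add: subalgebra_def)

lemma subalgebra_mult: "f \<in> R \<Longrightarrow> g \<in> R \<Longrightarrow> (\<lambda>x. f x * g x) \<in> R"
  using R by (simp add: subalgebra_def)

lemma subalgebra_uminus: "f \<in> R \<Longrightarrow> (\<lambda>x. - f x) \<in> R"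
  using subalgebra_mult[OF subalgebra_const[of "-1"]] by simp

lemma subalgebra_diff: "f \<in> R \<Longrightarrow> g \<in> R \<Longrightarrow> (\<lambda>x. f x - g x) \<in> R"
  using subalgebra_add[of f "\<lambda>x. - g x"] subalgebra_uminus[of g] by simp

lemma subalgebra_sum: "(\<And>i. i \<in> I \<Longrightarrow> f i \<in> R) \<Longrightarrow> (\<lambda>x. \<Sum>i\<in>I. f i x) \<in> R"
  by (induction I rule: infinite_finite_induct) (auto intro: subalgebra_const subalgebra_add)

lemma subalgebra_power: "f \<in> R \<Longrightarrow> (\<lambda>x. f x ^ n) \<in> R"
  by (induction n) (auto intro: subalgebra_const subalgebra_mult)

lemmas subalgebra_closed = subalgebra_const subalgebra_add subalgebra_mult subalgebra_uminus
  subalgebra_diff subalgebra_sum subalgebra_power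

end

lemma subalgebra_polynomial_funs: "subalgebra polynomial_funs"
  by (simp add: polynomial_funs_def subalgebra_fun_algebra)

lemmas polynomial_closed = subalgebra_closed[OF subalgebra_polynomial_funs]

lemma polynomial_coord: "(\<lambda>x. x i) \<in> polynomial_funs"
  by (auto simp: polynomial_funs_def intro: fun_algebra.gen)

text \<open>The algebra \<open>R[v]\<close>. As \<open>v\<close> may be algebraic over \<open>R\<close>, an element does not determine its
  coefficients, and degrees always refer to a chosen expansion.\<close>

definition adjoin :: "('a \<Rightarrow> 'k::field) set \<Rightarrow> ('a \<Rightarrow> 'k) \<Rightarrow> ('a \<Rightarrow> 'k) set" where
  "adjoin R v = {f. \<exists>a (d::nat). (\<forall>i. a i \<in> R) \<and> (\<forall>i>d. a i = (\<lambda>_. 0)) \<and>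
     f = (\<lambda>x. \<Sum>i\<le>d. a i x * v x ^ i)}"

lemma adjoinI:
  assumes "subalgebra R" and "\<And>i. i \<le> d \<Longrightarrow> a i \<in> R"
  shows "(\<lambda>x. \<Sum>i\<le>d. a i x * v x ^ i) \<in> adjoin R v"
  unfolding adjoin_def mem_Collect_eq
  by (rule exI[of _ "\<lambda>i. if i \<le> d then a i else (\<lambda>_. 0)"], rule exI[of _ d])
     (use assms in \<open>auto intro: subalgebra_const\<close>)

lemma adjoinD:
  assumes "f \<in> adjoin R v"
  shows "\<exists>a d. (\<forall>i. a i \<in> R) \<and> (\<forall>i>d. a i = (\<lambda>_. 0)) \<and> (\<forall>x. f x = (\<Sum>i\<le>d. a i x * v x ^ i))"
  using assms unfolding adjoin_def mem_Collect_eq by (elim exE conjE) (intro exI conjI, auto)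

lemma sum_atMost_extend:
  fixes f :: "nat \<Rightarrow> 'b::comm_monoid_add"
  assumes "d \<le> e" "\<And>i. i > d \<Longrightarrow> f i = 0"
  shows "(\<Sum>i\<le>d. f i) = (\<Sum>i\<le>e. f i)"
  by (rule sum.mono_neutral_left) (use assms in auto)

lemma subalgebra_adjoin:
  assumes R: "subalgebra R"
  shows "subalgebra (adjoin R v)"
  unfolding subalgebra_def
proof (intro conjI allI ballI)
  fix c show "(\<lambda>_. c) \<in> adjoin R v"
    using adjoinI[OF R, of 0 "\<lambda>_ _. c" v] subalgebra_const[OF R] by simp
next
  fix f g assume f: "f \<in> adjoin R v" and g: "g \<in> adjoin R v"
  obtain a d where a: "\<forall>i. a i \<in> R" "\<forall>i>d. a i = (\<lambda>_. 0)"
    "\<forall>x. f x = (\<Sum>i\<le>d. a i x * v x ^ i)"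
    using adjoinD[OF f] by blast
  obtain b e where b: "\<forall>i. b i \<in> R" "\<forall>i>e. b i = (\<lambda>_. 0)"
    "\<forall>x. g x = (\<Sum>i\<le>e. b i x * v x ^ i)"
    using adjoinD[OF g] by blast
  note a = a[rule_format] and b = b[rule_format]
  have "f x = (\<Sum>i\<le>d+e. a i x * v x ^ i)" "g x = (\<Sum>i\<le>d+e. b i x * v x ^ i)" for x
    unfolding a(3) b(3) by (rule sum_atMost_extend; use a(2) b(2) in auto)+
  then have "(\<lambda>x. f x + g x) = (\<lambda>x. \<Sum>i\<le>d+e. (a i x + b i x) * v x ^ i)"
    by (simp add: distrib_right sum.distrib)
  also have "\<dots> \<in> adjoin R v"
    by (rule adjoinI[OF R, of "d+e" "\<lambda>i x. a i x + b i x"]) (intro subalgebra_add[OF R] a b)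
  finally show "(\<lambda>x. f x + g x) \<in> adjoin R v" .
  have "(\<lambda>x. f x * g x) = (\<lambda>x. \<Sum>r\<le>d+e. (\<Sum>k\<le>r. a k x * b (r - k) x) * v x ^ r)"
    unfolding a(3) b(3) by (rule ext, rule polynomial_product) (use a(2) b(2) in auto)
  also have "\<dots> \<in> adjoin R v"
    by (rule adjoinI[OF R, of "d+e" "\<lambda>r x. \<Sum>k\<le>r. a k x * b (r - k) x"])
       (intro subalgebra_sum[OF R] subalgebra_mult[OF R] a b)
  finally show "(\<lambda>x. f x * g x) \<in> adjoin R v" .
qed

lemma subset_adjoin:
  assumes R: "subalgebra R"
  shows "R \<subseteq> adjoin R v"
proof
  fix f assume "f \<in> R"
  then show "f \<in> adjoin R v"
    using adjoinI[OF R, of 0 "\<lambda>_. f" v] by simp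
qed

lemma adjoin_generator:
  assumes R: "subalgebra R"
  shows "v \<in> adjoin R v"
proof -
  have "v = (\<lambda>x. \<Sum>i\<le>1. (if i = 1 then 1 else 0) * v x ^ i)" by auto
  also have "\<dots> \<in> adjoin R v"
    by (rule adjoinI[OF R, of 1 "\<lambda>i _. if i = 1 then 1 else 0"]) (rule subalgebra_const[OF R])
  finally show ?thesis .
qed

lemma fun_algebra_insert: "fun_algebra (insert v B) = adjoin (fun_algebra B) v"
proof
  show "fun_algebra (insert v B) \<subseteq> adjoin (fun_algebra B) v"
  proof
    fix f assume "f \<in> fun_algebra (insert v B)"
    then show "f \<in> adjoin (fun_algebra B) v"
    proof (rule fun_algebra_least)
      show "subalgebra (adjoin (fun_algebra B) v)"
        by (intro subalgebra_adjoin subalgebra_fun_algebra)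
      show "insert v B \<subseteq> adjoin (fun_algebra B) v"
        using subset_adjoin[OF subalgebra_fun_algebra, of B v]
          adjoin_generator[OF subalgebra_fun_algebra, of v B] by (auto intro: fun_algebra.gen)
    qed
  qed
  show "adjoin (fun_algebra B) v \<subseteq> fun_algebra (insert v B)"
  proof
    fix f assume f: "f \<in> adjoin (fun_algebra B) v"
    obtain a d where a: "\<forall>i. a i \<in> fun_algebra B" "\<forall>x. f x = (\<Sum>i\<le>d. a i x * v x ^ i)"
      using adjoinD[OF f] by blast
    note a = a[rule_format]
    have "a i \<in> fun_algebra (insert v B)" for i
      by (rule fun_algebra_least[OF a(1) subalgebra_fun_algebra]) (auto intro: fun_algebra.gen)
    moreover have "f = (\<lambda>x. \<Sum>i\<le>d. a i x * v x ^ i)" using a(2) by blast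
    ultimately show "f \<in> fun_algebra (insert v B)"
      by (simp only:) (intro subalgebra_closed[OF subalgebra_fun_algebra]; auto intro: fun_algebra.gen)
  qed
qed

lemma fun_algebra_empty: "f \<in> fun_algebra {} \<Longrightarrow> \<exists>c. f = (\<lambda>_. c)"
  by (induction rule: fun_algebra.induct) auto


section \<open>Noetherian function algebras and the Hilbert basis theorem\<close>

definition fun_ideal :: "('a \<Rightarrow> 'k::field) set \<Rightarrow> ('a \<Rightarrow> 'k) set \<Rightarrow> bool" where
  "fun_ideal R J \<longleftrightarrow> J \<subseteq> R \<and> (\<lambda>_. 0) \<in> J \<and> (\<forall>f\<in>J. \<forall>g\<in>J. (\<lambda>x. f x + g x) \<in> J) \<and>
     (\<forall>f\<in>R. \<forall>g\<in>J. (\<lambda>x. f x * g x) \<in> J)"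

lemma fun_ideal_subset: "fun_ideal R J \<Longrightarrow> f \<in> J \<Longrightarrow> f \<in> R"
  and fun_ideal_zero: "fun_ideal R J \<Longrightarrow> (\<lambda>_. 0) \<in> J"
  and fun_ideal_add: "fun_ideal R J \<Longrightarrow> f \<in> J \<Longrightarrow> g \<in> J \<Longrightarrow> (\<lambda>x. f x + g x) \<in> J"
  and fun_ideal_mult: "fun_ideal R J \<Longrightarrow> f \<in> R \<Longrightarrow> g \<in> J \<Longrightarrow> (\<lambda>x. f x * g x) \<in> J"
  by (auto simp: fun_ideal_def)

lemma fun_ideal_mult_right: "fun_ideal R J \<Longrightarrow> f \<in> J \<Longrightarrow> g \<in> R \<Longrightarrow> (\<lambda>x. f x * g x) \<in> J"
  using fun_ideal_mult[of R J g f] by (simp add: mult.commute)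

lemma fun_ideal_sum:
  assumes "fun_ideal R J" "\<And>i. i \<in> I \<Longrightarrow> f i \<in> J"
  shows "(\<lambda>x. \<Sum>i\<in>I. f i x) \<in> J"
  using assms(2)
  by (induction I rule: infinite_finite_induct)
     (auto intro: fun_ideal_zero[OF assms(1)] fun_ideal_add[OF assms(1)])

lemma fun_ideal_uminus:
  assumes "subalgebra R" "fun_ideal R J" "f \<in> J"
  shows "(\<lambda>x. - f x) \<in> J"
  using fun_ideal_mult[OF assms(2) subalgebra_const[OF assms(1), of "-1"] assms(3)] by simp

lemma fun_ideal_diff:
  assumes "subalgebra R" "fun_ideal R J" "f \<in> J" "g \<in> J"
  shows "(\<lambda>x. f x - g x) \<in> J"
  using fun_ideal_add[OF assms(2) assms(3) fun_ideal_uminus[OF assms(1,2,4)]] by simp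

definition noetherian :: "('a \<Rightarrow> 'k::field) set \<Rightarrow> bool" where
  "noetherian R \<longleftrightarrow> (\<forall>J :: nat \<Rightarrow> _. (\<forall>n. fun_ideal R (J n)) \<and> (\<forall>n. J n \<subseteq> J (Suc n)) \<longrightarrow>
     (\<exists>n. \<forall>m\<ge>n. J m = J n))"

lemma noetherianD:
  assumes "noetherian R" "\<And>n::nat. fun_ideal R (J n)" "\<And>n. J n \<subseteq> J (Suc n)"
  shows "\<exists>n. \<forall>m\<ge>n. J m = J n"
  using assms unfolding noetherian_def by blast

lemma noetherian_maximal:
  assumes "noetherian R" "\<J> \<noteq> {}" "\<And>J. J \<in> \<J> \<Longrightarrow> fun_ideal R J"
  shows "\<exists>M\<in>\<J>. \<forall>J\<in>\<J>. M \<subseteq> J \<longrightarrow> J = M"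
proof -
  let ?r = "{(J', J). J \<in> \<J> \<and> J' \<in> \<J> \<and> J \<subset> J'}"
  have wf: "wf ?r"
    unfolding wf_iff_no_infinite_down_chain
  proof
    assume "\<exists>f. \<forall>i. (f (Suc i), f i) \<in> ?r"
    then obtain J where "\<forall>i. (J (Suc i), J i) \<in> ?r" ..
    then have J: "\<And>i. J i \<in> \<J>" "\<And>i. J i \<subset> J (Suc i)" by auto
    obtain n where "\<forall>m\<ge>n. J m = J n"
      using noetherianD[OF assms(1), of J] J assms(3) by blast
    then show False using J(2)[of n] by (metis le_Suc_eq order_refl psubset_eq)
  qed
  show ?thesis
  proof (rule wfE_min'[OF wf assms(2)])
    fix M assume M: "M \<in> \<J>" "\<And>J. (J, M) \<in> ?r \<Longrightarrow> J \<notin> \<J>"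
    show ?thesis
    proof (intro bexI[OF _ M(1)] ballI impI)
      fix J assume J: "J \<in> \<J>" "M \<subseteq> J"
      have "(J, M) \<notin> ?r" using M(2)[of J] J(1) by iprover
      then show "J = M" using M(1) J by (simp add: psubset_eq)
    qed
  qed
qed

text \<open>Hilbert's argument: the ideal of coefficients that occur in front of \<open>v ^ d\<close> in elements
  of \<open>J n\<close> of degree at most \<open>d\<close> grows with \<open>n\<close> and with \<open>d\<close>. Once all of these ideals are
  stationary, a leading coefficient of an element of a later \<open>J m\<close> can be cancelled within the
  earlier ideal.\<close>

lemma noetherian_adjoin:
  fixes R :: "('a \<Rightarrow> 'k::field) set"
  assumes R: "subalgebra R" and noeth: "noetherian R"
  shows "noetherian (adjoin R v)"
  unfolding noetherian_def
proof (intro allI impI, elim conjE)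
  fix J :: "nat \<Rightarrow> ('a \<Rightarrow> 'k) set"
  assume id: "\<forall>n. fun_ideal (adjoin R v) (J n)" and mono: "\<forall>n. J n \<subseteq> J (Suc n)"
  note id = id[rule_format]
  have RJ: "f \<in> adjoin R v" if "f \<in> R" for f using subset_adjoin[OF R] that by blast
  have mono: "J n \<subseteq> J m" if "n \<le> m" for n m
    using lift_Suc_mono_le[of J n m] mono that by blast
  define lt where "lt = (\<lambda>d a. \<lambda>x::'a. (\<Sum>i\<le>d. a i x * v x ^ i))"
  define L where "L = (\<lambda>n d. {f. \<exists>a. (\<forall>i. a i \<in> R) \<and> f = a d \<and> lt d a \<in> J n})"
  have L_id: "fun_ideal R (L n d)" for n d
    unfolding fun_ideal_def
  proof (intro conjI ballI)
    show "L n d \<subseteq> R" by (auto simp: L_def)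
    show "(\<lambda>_. 0) \<in> L n d"
      unfolding L_def mem_Collect_eq
      by (rule exI[of _ "\<lambda>_ _. 0"]) (auto simp: lt_def subalgebra_const[OF R] fun_ideal_zero[OF id])
    fix g assume g: "g \<in> L n d"
    then obtain b where b: "\<And>i. b i \<in> R" "g = b d" "lt d b \<in> J n" by (auto simp: L_def)
    show "(\<lambda>x. f x + g x) \<in> L n d" if f: "f \<in> L n d" for f
    proof -
      obtain a where a: "\<And>i. a i \<in> R" "f = a d" "lt d a \<in> J n" using f by (auto simp: L_def)
      have "lt d (\<lambda>i x. a i x + b i x) = (\<lambda>x. lt d a x + lt d b x)"
        by (simp add: lt_def distrib_right sum.distrib)
      then have "lt d (\<lambda>i x. a i x + b i x) \<in> J n" using fun_ideal_add[OF id a(3) b(3)] by simp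
      then show ?thesis unfolding L_def mem_Collect_eq
        by (intro exI[of _ "\<lambda>i x. a i x + b i x"]) (auto simp: a(1,2) b(1,2) subalgebra_add[OF R])
    qed
    show "(\<lambda>x. f x * g x) \<in> L n d" if f: "f \<in> R" for f
    proof -
      have "lt d (\<lambda>i x. f x * b i x) = (\<lambda>x. f x * lt d b x)"
        by (simp add: lt_def sum_distrib_left mult.assoc)
      then have "lt d (\<lambda>i x. f x * b i x) \<in> J n" using fun_ideal_mult[OF id RJ[OF f] b(3)] by simp
      then show ?thesis unfolding L_def mem_Collect_eq
        by (intro exI[of _ "\<lambda>i x. f x * b i x"]) (auto simp: f b(1,2) subalgebra_mult[OF R])
    qed
  qed
  have L_mono: "L n d \<subseteq> L m d" if "n \<le> m" for n m d
    using mono[OF that] by (auto simp: L_def)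
  have L_Suc: "L n d \<subseteq> L n (Suc d)" for n d
  proof
    fix f assume "f \<in> L n d"
    then obtain a where a: "\<And>i. a i \<in> R" "f = a d" "lt d a \<in> J n" by (auto simp: L_def)
    let ?b = "\<lambda>i. if i = 0 then (\<lambda>_. 0) else a (i - 1)"
    have "lt (Suc d) ?b = (\<lambda>x. v x * lt d a x)"
      by (auto simp: lt_def sum.atMost_Suc_shift sum_distrib_left mult_ac intro!: sum.cong simp del: sum.atMost_Suc)
    then have "lt (Suc d) ?b \<in> J n"
      using fun_ideal_mult[OF id adjoin_generator[OF R] a(3)] by simp
    then show "f \<in> L n (Suc d)" unfolding L_def mem_Collect_eq
      by (intro exI[of _ ?b]) (auto simp: a(1,2) subalgebra_const[OF R])
  qed
  have L_mono2: "L n d \<subseteq> L n e" if "d \<le> e" for n d e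
    using lift_Suc_mono_le[of "L n" d e] L_Suc that by blast
  have "\<exists>n. \<forall>m\<ge>n. L m m = L n n"
  proof (rule noetherianD[OF noeth, of "\<lambda>n. L n n"])
    show "L n n \<subseteq> L (Suc n) (Suc n)" for n
      using L_mono[of n "Suc n" n] L_Suc[of "Suc n" n] by auto
  qed (fact L_id)
  then obtain n0 where n0: "\<And>m. m \<ge> n0 \<Longrightarrow> L m m = L n0 n0" by blast
  have "\<exists>N. \<forall>m\<ge>N. L m d = L N d" for d
  proof (rule noetherianD[OF noeth, of "\<lambda>n. L n d"])
    show "L n d \<subseteq> L (Suc n) d" for n by (rule L_mono) simp
  qed (fact L_id)
  then obtain N where N: "\<And>d m. m \<ge> N d \<Longrightarrow> L m d = L (N d) d" by metis
  define M where "M = Max (insert n0 (N ` {..n0}))"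
  have M: "n0 \<le> M" "\<And>d. d \<le> n0 \<Longrightarrow> N d \<le> M"
    unfolding M_def by (rule Max_ge; simp)+
  have stat: "L m d = L M d" if m: "m \<ge> M" for m d
  proof (cases "d \<le> n0")
    case True
    then show ?thesis using N M(2) m by (metis order_trans)
  next
    case False
    have "L m d \<subseteq> L (max m d) (max m d)" using L_mono[of m "max m d" d] L_mono2[of d "max m d" "max m d"] by auto
    also have "\<dots> = L n0 n0" using False by (intro n0) auto
    also have "\<dots> \<subseteq> L M d" using False M(1) L_mono[of n0 M n0] L_mono2[of n0 d M] by auto
    finally show ?thesis using L_mono[OF m, of d] by blast
  qed
  have "lt d a \<in> J M" if m: "m \<ge> M" and "\<And>i. a i \<in> R" "lt d a \<in> J m" for m d a
    using that(2,3)
  proof (induction d arbitrary: a)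
    case 0
    have "a 0 \<in> L m 0" unfolding L_def mem_Collect_eq using 0 by blast
    then have "a 0 \<in> L M 0" using stat[OF m] by blast
    then show ?case by (auto simp: L_def lt_def)
  next
    case (Suc d)
    have "a (Suc d) \<in> L m (Suc d)" unfolding L_def mem_Collect_eq using Suc.prems by blast
    then have "a (Suc d) \<in> L M (Suc d)" using stat[OF m] by blast
    then obtain b where b: "\<And>i. b i \<in> R" "a (Suc d) = b (Suc d)" "lt (Suc d) b \<in> J M"
      by (auto simp: L_def)
    have eq: "lt (Suc d) a x = lt (Suc d) b x + lt d (\<lambda>i x. a i x - b i x) x" for x
      by (simp add: lt_def b(2) left_diff_distrib sum_subtractf)
    have "lt d (\<lambda>i x. a i x - b i x) = (\<lambda>x. lt (Suc d) a x - lt (Suc d) b x)"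
      by (rule ext) (simp only: eq add_diff_cancel_left')
    also have "\<dots> \<in> J m"
      using fun_ideal_diff[OF subalgebra_adjoin[OF R] id Suc.prems(2)] mono[OF m] b(3) by blast
    finally have "lt d (\<lambda>i x. a i x - b i x) \<in> J M"
      using Suc.IH[of "\<lambda>i x. a i x - b i x"] Suc.prems(1) b(1) by (simp add: subalgebra_diff[OF R])
    from fun_ideal_add[OF id b(3) this] show ?case by (simp add: eq[symmetric])
  qed
  then have key: "lt d a \<in> J M" if "m \<ge> M" "\<And>i. a i \<in> R" "lt d a \<in> J m" for m d a
    using that by blast
  have "J m \<subseteq> J M" if m: "m \<ge> M" for m
  proof
    fix f assume f: "f \<in> J m"
    obtain a d where a: "\<forall>i. a i \<in> R" "\<forall>x. f x = (\<Sum>i\<le>d. a i x * v x ^ i)"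
      using adjoinD[OF fun_ideal_subset[OF id f]] by blast
    have "f = lt d a" using a(2) by (auto simp: lt_def)
    then show "f \<in> J M" using key[OF m a(1)[rule_format]] f by simp
  qed
  then show "\<exists>n. \<forall>m\<ge>n. J m = J n" using mono by blast
qed

lemma noetherian_fun_algebra:
  assumes "finite B"
  shows "noetherian (fun_algebra B)"
  using assms
proof induction
  case empty
  show ?case
    unfolding noetherian_def
  proof (intro allI impI, elim conjE)
    fix J :: "nat \<Rightarrow> ('a \<Rightarrow> 'b) set"
    assume id: "\<forall>n. fun_ideal (fun_algebra {}) (J n)" and mono: "\<forall>n. J n \<subseteq> J (Suc n)"
    have mono: "J n \<subseteq> J m" if "n \<le> m" for n m
      using lift_Suc_mono_le[of J n m] mono that by blast
    show "\<exists>n. \<forall>m\<ge>n. J m = J n"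
    proof (cases "\<exists>n f. f \<in> J n \<and> f \<noteq> (\<lambda>_. 0)")
      case True
      then obtain n f where f: "f \<in> J n" "f \<noteq> (\<lambda>_. 0)" by blast
      then obtain c where c: "f = (\<lambda>_. c)" "c \<noteq> 0"
        using id fun_algebra_empty unfolding fun_ideal_def by blast
      have "J m \<subseteq> J n" for m
      proof
        fix g assume "g \<in> J m"
        then have "g \<in> fun_algebra {}" using id unfolding fun_ideal_def by blast
        then have "(\<lambda>x. (g x * inverse c) * f x) \<in> J n"
          using fun_ideal_mult[OF id[rule_format] _ f(1)]
          by (intro fun_ideal_mult[OF id[rule_format] _ f(1)] fun_algebra.mult fun_algebra.const)
        then show "g \<in> J n" using c by (simp add: mult.assoc)
      qed
      then show ?thesis using mono by blast
    next
      case False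
      then have "J n = {\<lambda>_. 0}" for n using id fun_ideal_zero[of _ "J n"] by blast
      then show ?thesis by auto
    qed
  qed
next
  case (insert v B)
  then show ?case
    by (simp add: fun_algebra_insert noetherian_adjoin subalgebra_fun_algebra)
qed

lemma noetherian_polynomial_funs: "noetherian polynomial_funs"
  unfolding polynomial_funs_def by (rule noetherian_fun_algebra) simp

section \<open>The Nullstellensatz for prime ideals\<close>

definition prime_fun_ideal :: "('a \<Rightarrow> 'k::field) set \<Rightarrow> ('a \<Rightarrow> 'k) set \<Rightarrow> bool" where
  "prime_fun_ideal R Q \<longleftrightarrow> fun_ideal R Q \<and> (\<lambda>_. 1) \<notin> Q \<and>
     (\<forall>f\<in>R. \<forall>g\<in>R. (\<lambda>x. f x * g x) \<in> Q \<longrightarrow> f \<in> Q \<or> g \<in> Q)"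

lemma prime_fun_ideal_fun_ideal: "prime_fun_ideal R Q \<Longrightarrow> fun_ideal R Q"
  and prime_fun_ideal_one: "prime_fun_ideal R Q \<Longrightarrow> (\<lambda>_. 1) \<notin> Q"
  and prime_fun_idealD:
    "prime_fun_ideal R Q \<Longrightarrow> (\<lambda>x. f x * g x) \<in> Q \<Longrightarrow> f \<in> R \<Longrightarrow> g \<in> R \<Longrightarrow> f \<in> Q \<or> g \<in> Q"
  by (auto simp: prime_fun_ideal_def)

lemma prime_fun_ideal_power:
  assumes "subalgebra R" "prime_fun_ideal R Q" "f \<in> R" "f \<notin> Q"
  shows "(\<lambda>x. f x ^ n) \<notin> Q"
proof (induction n)
  case 0
  then show ?case using prime_fun_ideal_one[OF assms(2)] by simp
next
  case (Suc n)
  then show ?case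
    using prime_fun_idealD[OF assms(2), of f "\<lambda>x. f x ^ n"] assms(3,4) subalgebra_power[OF assms(1)]
    by auto
qed

text \<open>Summing over exponents below \<open>n\<close> lets \<open>n = 0\<close> stand for the remainder of a division by a
  polynomial of degree zero.\<close>

definition expansion :: "('a \<Rightarrow> 'k::field) \<Rightarrow> nat \<Rightarrow> (nat \<Rightarrow> 'a \<Rightarrow> 'k) \<Rightarrow> 'a \<Rightarrow> 'k" where
  "expansion v n a = (\<lambda>x. \<Sum>i<n. a i x * v x ^ i)"

lemma expansion_in_adjoin:
  assumes R: "subalgebra R" and "\<And>i. i < n \<Longrightarrow> a i \<in> R"
  shows "expansion v n a \<in> adjoin R v"
proof (cases n)
  case 0
  then show ?thesis
    using subalgebra_const[OF subalgebra_adjoin[OF R]] by (simp add: expansion_def)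
next
  case (Suc d)
  then show ?thesis
    using adjoinI[OF R, of d a v] assms(2) by (simp add: expansion_def lessThan_Suc_atMost)
qed

lemma adjoin_expansion:
  assumes "f \<in> adjoin R v"
  shows "\<exists>n a. (\<forall>i. a i \<in> R) \<and> f = expansion v n a"
proof -
  obtain a d where "\<forall>i. a i \<in> R" "\<forall>x. f x = (\<Sum>i\<le>d. a i x * v x ^ i)"
    using adjoinD[OF assms] by blast
  then show ?thesis
    by (intro exI[of _ "Suc d"] exI[of _ a]) (auto simp: expansion_def lessThan_Suc_atMost)
qed

lemma sum_lessThan_shift:
  fixes f :: "nat \<Rightarrow> 'b::comm_monoid_add"
  shows "(\<Sum>i<s + e. if s \<le> i then f (i - s) else 0) = (\<Sum>j<e. f j)"
  by (induction e) auto

text \<open>The divisor need not be monic, so the dividend is first multiplied by a power of the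
  leading coefficient. The leading coefficient of the quotient is what bounds its degree modulo a
  prime ideal from below.\<close>

lemma expansion_pseudo_division:
  assumes R: "subalgebra R" and m: "\<forall>i. m i \<in> R" and "\<forall>i. a i \<in> R"
  shows "\<exists>k u r. (\<forall>i. u i \<in> R) \<and> (\<forall>i. r i \<in> R) \<and>
    (\<forall>x. m e x ^ k * expansion v n a x =
      expansion v (n - e) u x * expansion v (Suc e) m x + expansion v e r x) \<and>
    (n > e \<longrightarrow> (\<exists>j. u (n - e - 1) = (\<lambda>x. m e x ^ j * a (n - 1) x)))"
  using assms(3)
proof (induction n arbitrary: a)
  case 0
  show ?case
    by (rule exI[of _ 0], rule exI[of _ "\<lambda>_ _. 0"], rule exI[of _ "\<lambda>_ _. 0"])
       (auto simp: expansion_def subalgebra_const[OF R])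
next
  case (Suc n)
  show ?case
  proof (cases "Suc n \<le> e")
    case True
    let ?r = "\<lambda>i. if i < Suc n then a i else (\<lambda>_. 0)"
    have "expansion v e ?r x = expansion v (Suc n) a x" for x
      unfolding expansion_def
      by (rule sum.mono_neutral_cong_right) (use True in auto)
    then show ?thesis
      by (intro exI[of _ 0] exI[of _ "\<lambda>_ _. 0"] exI[of _ ?r])
         (use True Suc.prems in \<open>auto simp: expansion_def subalgebra_const[OF R]\<close>)
  next
    case False
    define s where "s = n - e"
    then have n: "n = s + e" using False by simp
    define a' where "a' = (\<lambda>i x. m e x * a i x - a n x * (if s \<le> i then m (i - s) x else 0))"
    have "\<forall>i. a' i \<in> R"
    proof
      fix i
      have "(\<lambda>x. if s \<le> i then m (i - s) x else 0) \<in> R"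
        using m subalgebra_const[OF R] by (cases "s \<le> i") auto
      then show "a' i \<in> R"
        unfolding a'_def by (intro subalgebra_closed[OF R] m[rule_format] Suc.prems[rule_format])
    qed
    from Suc.IH[of a', OF this] obtain k u r where
      u: "\<forall>i. u i \<in> R" and r: "\<forall>i. r i \<in> R" and
      eq: "\<forall>x. m e x ^ k * expansion v n a' x =
        expansion v (n - e) u x * expansion v (Suc e) m x + expansion v e r x"
      by blast
    have cancel: "expansion v n a' x =
        m e x * expansion v (Suc n) a x - a n x * v x ^ s * expansion v (Suc e) m x" for x
    proof -
      have "(\<Sum>i<n. (if s \<le> i then m (i - s) x else 0) * v x ^ i) =
          (\<Sum>i<s + e. if s \<le> i then m (i - s) x * v x ^ ((i - s) + s) else 0)"
        unfolding n by (rule sum.cong) auto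
      also have "\<dots> = (\<Sum>j<e. m j x * v x ^ (j + s))" by (rule sum_lessThan_shift)
      finally have shift: "(\<Sum>i<n. (if s \<le> i then m (i - s) x else 0) * v x ^ i) =
          v x ^ s * (\<Sum>j<e. m j x * v x ^ j)"
        by (simp add: sum_distrib_left power_add mult_ac)
      have "expansion v n a' x = m e x * (\<Sum>i<n. a i x * v x ^ i) -
          a n x * (\<Sum>i<n. (if s \<le> i then m (i - s) x else 0) * v x ^ i)"
        unfolding expansion_def a'_def sum_distrib_left sum_subtractf[symmetric]
        by (rule sum.cong) (simp_all add: algebra_simps)
      then show ?thesis
        unfolding shift by (simp add: expansion_def n algebra_simps power_add)
    qed
    define u' where "u' = (\<lambda>i. if i < s then u i else (\<lambda>x. m e x ^ k * a n x))"
    have u'R: "u' i \<in> R" for i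
      using u m Suc.prems subalgebra_closed[OF R] by (auto simp: u'_def)
    have u'_exp: "expansion v (Suc s) u' x = expansion v s u x + m e x ^ k * a n x * v x ^ s" for x
      by (simp add: expansion_def u'_def)
    have "m e x ^ Suc k * expansion v (Suc n) a x =
        expansion v (Suc n - e) u' x * expansion v (Suc e) m x + expansion v e r x" for x
    proof -
      have ns: "Suc n - e = Suc s" "n - e = s" using n by auto
      have "m e x ^ Suc k * expansion v (Suc n) a x =
          m e x ^ k * (expansion v n a' x + a n x * v x ^ s * expansion v (Suc e) m x)"
        by (simp add: cancel mult_ac)
      also have "\<dots> = expansion v s u x * expansion v (Suc e) m x + expansion v e r x +
          m e x ^ k * a n x * v x ^ s * expansion v (Suc e) m x"
        using eq ns by (simp add: distrib_left mult_ac)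
      also have "\<dots> = expansion v (Suc s) u' x * expansion v (Suc e) m x + expansion v e r x"
        unfolding u'_exp by (simp add: algebra_simps)
      finally show ?thesis unfolding ns .
    qed
    moreover have "u' (Suc n - e - 1) = (\<lambda>x. m e x ^ k * a (Suc n - 1) x)"
      using n by (auto simp: u'_def)
    ultimately show ?thesis
      using u'R r by (intro exI[of _ "Suc k"] exI[of _ u'] exI[of _ r]) blast
  qed
qed

text \<open>The form of the Nullstellensatz that passes from \<open>R\<close> to \<open>R[v]\<close>: a point of the zero set of \<open>Q\<close> is
  asked for at which a prescribed function outside \<open>Q\<close> survives. This makes room for the leading
  coefficients that have to stay invertible when a point is extended.\<close>

definition has_enough_points :: "('a \<Rightarrow> 'k::field) set \<Rightarrow> bool" where
  "has_enough_points R \<longleftrightarrow> (\<forall>Q b. prime_fun_ideal R Q \<and> b \<in> R \<and> b \<notin> Q \<longrightarrow>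
     (\<exists>x. (\<forall>p\<in>Q. p x = 0) \<and> b x \<noteq> 0))"

text \<open>Leading terms with coefficient in \<open>Q\<close> can be dropped without leaving \<open>J\<close>, so that the degree
  becomes the one seen modulo \<open>Q\<close>.\<close>

lemma expansion_trim:
  assumes R: "subalgebra R" and J: "fun_ideal (adjoin R v) J" and "Q \<subseteq> J"
    and a: "\<And>i. a i \<in> R"
  shows "expansion v n a \<in> J \<Longrightarrow> i < n \<Longrightarrow> a i \<notin> Q \<Longrightarrow>
    \<exists>e<n. expansion v (Suc e) a \<in> J \<and> a e \<notin> Q"
proof (induction n)
  case (Suc n)
  show ?case
  proof (cases "a n \<in> Q")
    case True
    have "(\<lambda>x. v x ^ n) \<in> adjoin R v"
      by (rule subalgebra_power[OF subalgebra_adjoin[OF R] adjoin_generator[OF R]])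
    then have "(\<lambda>x. a n x * v x ^ n) \<in> J"
      by (rule fun_ideal_mult_right[OF J subsetD[OF assms(3) True]])
    from fun_ideal_diff[OF subalgebra_adjoin[OF R] J Suc.prems(1) this]
    have "expansion v n a \<in> J" by (simp add: expansion_def)
    moreover have "i < n" using Suc.prems True by (metis less_SucE)
    ultimately show ?thesis using Suc.IH Suc.prems(3) by (meson less_SucI)
  next
    case False
    then show ?thesis using Suc.prems by blast
  qed
qed simp

lemma exists_nonroot:
  fixes a :: "nat \<Rightarrow> 'k::field_char_0"
  assumes "i < n" "a i \<noteq> 0"
  shows "\<exists>\<xi>. (\<Sum>j<n. a j * \<xi> ^ j) \<noteq> 0"
proof (rule ccontr)
  assume "\<not> ?thesis"
  then have 0: "(\<Sum>j<n. a j * \<xi> ^ j) = 0" for \<xi> by blast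
  let ?p = "\<Sum>j<n. monom (a j) j"
  have "poly ?p = poly 0" by (rule ext) (simp add: poly_sum poly_monom 0)
  then have "?p = 0" by (simp only: poly_eq_poly_eq_iff)
  moreover have "coeff ?p i = a i" using assms(1) by (simp add: coeff_sum)
  ultimately show False using assms(2) by simp
qed

text \<open>A point of \<open>R\<close> is extended by choosing a value \<open>\<xi>\<close> for the new coordinate. If that
  coordinate is transcendental modulo \<open>Q\<close>, then any \<open>\<xi>\<close> outside the roots of \<open>b\<close> will do.
  Otherwise \<open>\<xi>\<close> has to be a root of the relation \<open>m\<close> of least degree; division by \<open>m\<close> shows that
  all of \<open>Q\<close> then vanishes wherever the leading coefficient of \<open>m\<close> does not. That \<open>b\<close> does not
  vanish is ensured beforehand: Euclid's algorithm for \<open>b\<close> and \<open>m\<close> ends, by minimality of \<open>m\<close>, in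
  an element \<open>r0\<close> of \<open>R\<close> outside \<open>Q\<close> that is a multiple of \<open>b\<close> modulo \<open>Q\<close>.\<close>

lemma has_enough_points_adjoin:
  fixes R :: "(('n \<Rightarrow> 'k) \<Rightarrow> 'k::{alg_closed_field, field_char_0}) set"
  assumes R: "subalgebra R" and points: "has_enough_points R"
    and indep: "\<And>f x \<xi>. f \<in> R \<Longrightarrow> f (x(w := \<xi>)) = f x"
  shows "has_enough_points (adjoin R (\<lambda>x. x w))"
  unfolding has_enough_points_def
proof (intro allI impI, elim conjE)
  fix Q :: "(('n \<Rightarrow> 'k) \<Rightarrow> 'k) set" and b
  define v where "v = (\<lambda>x::'n \<Rightarrow> 'k. x w)"
  define A where "A = adjoin R v"
  assume "prime_fun_ideal (adjoin R (\<lambda>x. x w)) Q" "b \<in> adjoin R (\<lambda>x. x w)" and bQ: "b \<notin> Q"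
  then have Q: "prime_fun_ideal A Q" and bA: "b \<in> A" by (simp_all add: A_def v_def)
  note Qid = prime_fun_ideal_fun_ideal[OF Q]
  have A: "subalgebra A" unfolding A_def by (rule subalgebra_adjoin[OF R])
  have RA: "f \<in> A" if "f \<in> R" for f using subset_adjoin[OF R] that unfolding A_def by blast
  have EA: "expansion v n a \<in> A" if "\<And>i. a i \<in> R" for n a
    unfolding A_def using that by (intro expansion_in_adjoin R) auto
  have Eval: "expansion v n a (x(w := \<xi>)) = (\<Sum>i<n. a i x * \<xi> ^ i)" if "\<And>i. a i \<in> R" for n a x \<xi>
    by (simp add: expansion_def indep[OF that] v_def)
  have EQ: "expansion v n a \<in> Q" if "\<And>i. i < n \<Longrightarrow> a i \<in> Q" for n a
    unfolding expansion_def
    by (intro fun_ideal_sum[OF Qid] fun_ideal_mult_right[OF Qid] subalgebra_power[OF A])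
       (use that adjoin_generator[OF R] in \<open>auto simp: A_def\<close>)
  have point: "\<exists>x. (\<forall>p\<in>Q \<inter> R. p x = 0) \<and> c x \<noteq> 0" if "c \<in> R" "c \<notin> Q" for c
  proof -
    have "fun_ideal R (Q \<inter> R)"
      unfolding fun_ideal_def
      using Qid RA subalgebra_const[OF R] subalgebra_add[OF R] subalgebra_mult[OF R]
      unfolding fun_ideal_def by blast
    then have "prime_fun_ideal R (Q \<inter> R)"
      unfolding prime_fun_ideal_def
      using prime_fun_ideal_one[OF Q] prime_fun_idealD[OF Q] RA by blast
    then show ?thesis using points that unfolding has_enough_points_def by blast
  qed
  show "\<exists>x. (\<forall>p\<in>Q. p x = 0) \<and> b x \<noteq> 0"
  proof (cases "\<forall>n a. (\<forall>i. a i \<in> R) \<and> expansion v n a \<in> Q \<longrightarrow> (\<forall>i<n. a i \<in> Q)")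
    case True
    obtain n \<beta> where \<beta>: "\<forall>i. \<beta> i \<in> R" "b = expansion v n \<beta>"
      using adjoin_expansion bA unfolding A_def by blast
    then obtain i where i: "i < n" "\<beta> i \<notin> Q" using EQ bQ by blast
    obtain x where x: "\<forall>p\<in>Q \<inter> R. p x = 0" "\<beta> i x \<noteq> 0" using point \<beta>(1) i(2) by blast
    obtain \<xi> where \<xi>: "(\<Sum>j<n. \<beta> j x * \<xi> ^ j) \<noteq> 0" using exists_nonroot[of i n "\<lambda>j. \<beta> j x"] i x by blast
    have "p (x(w := \<xi>)) = 0" if p: "p \<in> Q" for p
    proof -
      obtain l a where a: "\<forall>i. a i \<in> R" "p = expansion v l a"
        using adjoin_expansion fun_ideal_subset[OF Qid p] unfolding A_def by blast
      then have "\<forall>i<l. a i \<in> Q" using True p by blast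
      then have "\<forall>i<l. a i x = 0" using x(1) a(1) by blast
      then show ?thesis using Eval a by simp
    qed
    moreover have "b (x(w := \<xi>)) \<noteq> 0" using \<xi> \<beta> Eval by simp
    ultimately show ?thesis by blast
  next
    case False
    have least: "\<exists>d m. (\<forall>i. m i \<in> R) \<and> expansion v (Suc d) m \<in> J \<and> m d \<notin> Q \<and> d < n \<and>
        (\<forall>n a. (\<forall>i. a i \<in> R) \<and> expansion v n a \<in> J \<and> n \<le> d \<longrightarrow> (\<forall>i<n. a i \<in> Q))"
      if J: "fun_ideal A J" "Q \<subseteq> J" and a: "\<forall>i. a i \<in> R" "expansion v n a \<in> J" "i < n" "a i \<notin> Q"
      for J a n i
    proof -
      let ?P = "\<lambda>d. \<exists>m. (\<forall>i. m i \<in> R) \<and> expansion v (Suc d) m \<in> J \<and> m d \<notin> Q"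
      have trim: "\<exists>e<n. ?P e" if "\<forall>i. a i \<in> R" "expansion v n a \<in> J" "i < n" "a i \<notin> Q" for a n i
        using expansion_trim[OF R J(1)[unfolded A_def] J(2), of a n i] that by blast
      obtain e where e: "e < n" "?P e" using trim[OF a] by blast
      define d where "d = (LEAST d. ?P d)"
      have "?P d" unfolding d_def by (rule LeastI[of ?P e]) (rule e)
      moreover have "d \<le> e" unfolding d_def by (rule Least_le) (rule e)
      moreover have "\<forall>i<n. a i \<in> Q"
        if a: "\<forall>i. a i \<in> R" "expansion v n a \<in> J" and n: "n \<le> d" for n a
      proof (rule ccontr)
        assume "\<not> ?thesis"
        then obtain d' where "d' < n" "?P d'" using trim[OF a] by blast
        moreover have "d \<le> d'" unfolding d_def by (rule Least_le) fact
        ultimately show False using n by simp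
      qed
      moreover have "d < n" using \<open>d \<le> e\<close> e(1) by simp
      ultimately show ?thesis by blast
    qed
    obtain n0 a0 i0 where "\<forall>i. a0 i \<in> R" "expansion v n0 a0 \<in> Q" "i0 < n0" "a0 i0 \<notin> Q"
      using False by blast
    from least[OF Qid order_refl this] obtain d m where
      m: "\<forall>i. m i \<in> R" "expansion v (Suc d) m \<in> Q" "m d \<notin> Q" and
      m_min: "\<forall>n a. (\<forall>i. a i \<in> R) \<and> expansion v n a \<in> Q \<and> n \<le> d \<longrightarrow> (\<forall>i<n. a i \<in> Q)"
      by blast
    note mR = m(1)[rule_format]
    have mpow: "(\<lambda>x. m d x ^ k) \<notin> Q" for k
      by (rule prime_fun_ideal_power[OF A Q RA[OF mR] m(3)])
    \<comment> \<open>The ideal generated by \<open>b\<close> and \<open>Q\<close>.\<close>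
    define I where "I = {f \<in> A. \<exists>g\<in>A. (\<lambda>x. f x - g x * b x) \<in> Q}"
    have I: "fun_ideal A I"
      unfolding fun_ideal_def
    proof (intro conjI ballI)
      show "I \<subseteq> A" by (auto simp: I_def)
      show "(\<lambda>_. 0) \<in> I" unfolding I_def
        using subalgebra_const[OF A, of 0] fun_ideal_zero[OF Qid] by (auto intro!: bexI[of _ "\<lambda>_. 0"])
      fix f2 assume "f2 \<in> I"
      then obtain g2 where g2: "f2 \<in> A" "g2 \<in> A" "(\<lambda>x. f2 x - g2 x * b x) \<in> Q" by (auto simp: I_def)
      show "(\<lambda>x. f x + f2 x) \<in> I" if f: "f \<in> I" for f
      proof -
        obtain g where g: "f \<in> A" "g \<in> A" "(\<lambda>x. f x - g x * b x) \<in> Q" using f by (auto simp: I_def)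
        have "(\<lambda>x. (f x + f2 x) - (g x + g2 x) * b x) \<in> Q"
          using fun_ideal_add[OF Qid g(3) g2(3)] by (simp add: algebra_simps)
        then show ?thesis using subalgebra_add[OF A] g g2 by (auto simp: I_def)
      qed
      show "(\<lambda>x. f x * f2 x) \<in> I" if "f \<in> A" for f
      proof -
        have "(\<lambda>x. f x * f2 x - (f x * g2 x) * b x) \<in> Q"
          using fun_ideal_mult[OF Qid that g2(3)] by (simp add: algebra_simps)
        moreover have "(\<lambda>x. f x * f2 x) \<in> A" "(\<lambda>x. f x * g2 x) \<in> A"
          using subalgebra_mult[OF A that] g2 by auto
        ultimately show ?thesis unfolding I_def by (intro CollectI conjI bexI[of _ "\<lambda>x. f x * g2 x"])
      qed
    qed
    have QI: "Q \<subseteq> I"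
      using fun_ideal_subset[OF Qid] subalgebra_const[OF A, of 0]
      by (auto simp: I_def intro!: bexI[of _ "\<lambda>_. 0"])
    have bI: "b \<in> I"
      using bA subalgebra_const[OF A, of 1] fun_ideal_zero[OF Qid]
      by (auto simp: I_def intro!: bexI[of _ "\<lambda>_. 1"])
    obtain nb \<beta> where \<beta>: "\<forall>i. \<beta> i \<in> R" "b = expansion v nb \<beta>"
      using adjoin_expansion bA unfolding A_def by blast
    obtain k u r where u: "\<forall>i. u i \<in> R" and r: "\<forall>i. r i \<in> R" and
      "\<forall>x. m d x ^ k * expansion v nb \<beta> x = expansion v (nb - d) u x * expansion v (Suc d) m x + expansion v d r x"
      using expansion_pseudo_division[OF R m(1) \<beta>(1), of d v nb] by blast
    note div = this(3)[folded \<beta>(2)]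
    have uA: "expansion v (nb - d) u \<in> A" by (rule EA) (use u in blast)
    have r_eq: "expansion v d r = (\<lambda>x. m d x ^ k * b x - expansion v (nb - d) u x * expansion v (Suc d) m x)"
      using div by auto
    have um: "(\<lambda>x. expansion v (nb - d) u x * expansion v (Suc d) m x) \<in> Q"
      by (rule fun_ideal_mult[OF Qid uA m(2)])
    have mb: "(\<lambda>x. m d x ^ k * b x) \<in> I"
      by (rule fun_ideal_mult[OF I subalgebra_power[OF A RA[OF mR]] bI])
    have "expansion v d r \<in> I" unfolding r_eq
      by (rule fun_ideal_diff[OF A I mb subsetD[OF QI um]])
    moreover have "expansion v d r \<notin> Q"
    proof
      assume "expansion v d r \<in> Q"
      from fun_ideal_add[OF Qid this um] have "(\<lambda>x. m d x ^ k * b x) \<in> Q" by (simp add: r_eq)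
      then show False
        using prime_fun_idealD[OF Q _ subalgebra_power[OF A RA[OF mR]] bA] mpow bQ by blast
    qed
    then obtain i where "i < d" "r i \<notin> Q" using EQ by blast
    ultimately obtain e c where
      c: "\<forall>i. c i \<in> R" "expansion v (Suc e) c \<in> I" "c e \<notin> Q" "e < d" and
      c_min: "\<forall>n a. (\<forall>i. a i \<in> R) \<and> expansion v n a \<in> I \<and> n \<le> e \<longrightarrow> (\<forall>i<n. a i \<in> Q)"
      using least[OF I QI r] by blast
    note cR = c(1)[rule_format]
    \<comment> \<open>Otherwise dividing \<open>m\<close> by \<open>c\<close> would factor a multiple of \<open>m\<close> modulo \<open>Q\<close> into parts of
      smaller degree.\<close>
    have e0: "e = 0"
    proof (rule ccontr)
      assume "e \<noteq> 0"
      obtain k u r j where u: "\<forall>i. u i \<in> R" and r: "\<forall>i. r i \<in> R" and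
        div: "\<forall>x. c e x ^ k * expansion v (Suc d) m x =
          expansion v (Suc d - e) u x * expansion v (Suc e) c x + expansion v e r x" and
        lead: "u (d - e) = (\<lambda>x. c e x ^ j * m d x)"
        using expansion_pseudo_division[OF R c(1) m(1), of e v "Suc d"] c(4) by auto
      have uA: "expansion v (Suc d - e) u \<in> A" by (rule EA) (use u in blast)
      have cA: "expansion v (Suc e) c \<in> A" by (rule EA) (rule cR)
      have cm: "(\<lambda>x. c e x ^ k * expansion v (Suc d) m x) \<in> Q"
        by (rule fun_ideal_mult[OF Qid subalgebra_power[OF A RA[OF cR]] m(2)])
      have uc: "(\<lambda>x. expansion v (Suc d - e) u x * expansion v (Suc e) c x) \<in> I"
        by (rule fun_ideal_mult[OF I uA c(2)])
      have "expansion v e r = (\<lambda>x. c e x ^ k * expansion v (Suc d) m x -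
          expansion v (Suc d - e) u x * expansion v (Suc e) c x)"
        using div by auto
      then have "expansion v e r \<in> I"
        using fun_ideal_diff[OF A I subsetD[OF QI cm] uc] by simp
      then have rQ: "expansion v e r \<in> Q" using EQ c_min r by blast
      have "(\<lambda>x. expansion v (Suc d - e) u x * expansion v (Suc e) c x) =
          (\<lambda>x. c e x ^ k * expansion v (Suc d) m x - expansion v e r x)"
        using div by auto
      then have "(\<lambda>x. expansion v (Suc d - e) u x * expansion v (Suc e) c x) \<in> Q"
        using fun_ideal_diff[OF A Qid cm rQ] by simp
      then consider "expansion v (Suc d - e) u \<in> Q" | "expansion v (Suc e) c \<in> Q"
        using prime_fun_idealD[OF Q _ uA cA] by blast
      then show False
      proof cases
        case 1
        moreover have "Suc d - e \<le> d" "d - e < Suc d - e" using \<open>e \<noteq> 0\<close> c(4) by auto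
        ultimately have "u (d - e) \<in> Q" using m_min u by blast
        then show False
          using prime_fun_idealD[OF Q, of "\<lambda>x. c e x ^ j" "m d"] lead m(3)
            prime_fun_ideal_power[OF A Q RA[OF cR] c(3)] subalgebra_power[OF A RA[OF cR]] RA[OF mR]
          by auto
      next
        case 2
        then show False using m_min c(1,3,4) Suc_leI lessI by blast
      qed
    qed
    have "c 0 \<in> I" using c(2) e0 by (simp add: expansion_def)
    then obtain g where g: "g \<in> A" "(\<lambda>x. c 0 x - g x * b x) \<in> Q" by (auto simp: I_def)
    have "(\<lambda>x. m d x * c 0 x) \<notin> Q"
      using prime_fun_idealD[OF Q _ RA[OF mR] RA[OF cR]] m(3) c(3) e0 by blast
    then obtain x where x: "\<forall>p\<in>Q \<inter> R. p x = 0" "m d x \<noteq> 0" "c 0 x \<noteq> 0"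
      using point[OF subalgebra_mult[OF R mR cR]] by force
    obtain \<xi> where "(\<Sum>i\<le>d. m i x * \<xi> ^ i) = 0"
      using alg_closed[of d "\<lambda>i. m i x"] x(2) c(4) by auto
    then have \<xi>: "expansion v (Suc d) m (x(w := \<xi>)) = 0"
      using Eval[OF mR, of "Suc d"] by (simp add: lessThan_Suc_atMost)
    have zero: "p (x(w := \<xi>)) = 0" if p: "p \<in> Q" for p
    proof -
      obtain l a where a: "\<forall>i. a i \<in> R" "p = expansion v l a"
        using adjoin_expansion fun_ideal_subset[OF Qid p] unfolding A_def by blast
      obtain k u r where u: "\<forall>i. u i \<in> R" and r: "\<forall>i. r i \<in> R" and
        "\<forall>x. m d x ^ k * expansion v l a x = expansion v (l - d) u x * expansion v (Suc d) m x + expansion v d r x"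
        using expansion_pseudo_division[OF R m(1) a(1), of d v l] by blast
      note div = this(3)[folded a(2)]
      have uA: "expansion v (l - d) u \<in> A" by (rule EA) (use u in blast)
      have "expansion v d r = (\<lambda>x. m d x ^ k * p x - expansion v (l - d) u x * expansion v (Suc d) m x)"
        using div by auto
      also have "\<dots> \<in> Q"
        by (intro fun_ideal_diff[OF A Qid] fun_ideal_mult[OF Qid] p m(2) uA
            subalgebra_power[OF A RA[OF mR]])
      finally have "\<forall>i<d. r i \<in> Q" using m_min r by blast
      then have "\<forall>i<d. r i x = 0" using x(1) r by blast
      then have "expansion v d r (x(w := \<xi>)) = 0" using Eval[of r d] r by simp
      then have "m d (x(w := \<xi>)) ^ k * p (x(w := \<xi>)) = 0" using div \<xi> by simp
      then show ?thesis using x(2) indep[OF mR] by simp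
    qed
    moreover have "b (x(w := \<xi>)) \<noteq> 0"
      using zero[OF g(2)] x(3) indep[OF cR] by auto
    ultimately show ?thesis by blast
  qed
qed

lemma has_enough_points_coords:
  fixes J :: "'n set"
  assumes "finite J"
  shows "has_enough_points (fun_algebra ((\<lambda>i x. x i :: 'k::{alg_closed_field, field_char_0}) ` J))"
  using assms
proof induction
  case empty
  have "\<exists>x. (\<forall>p\<in>Q. p x = 0) \<and> b x \<noteq> 0"
    if Q: "prime_fun_ideal (fun_algebra {}) Q" and b: "b \<in> fun_algebra {}" "b \<notin> Q"
    for Q and b :: "('n \<Rightarrow> 'k) \<Rightarrow> 'k"
  proof -
    note Qid = prime_fun_ideal_fun_ideal[OF Q]
    have "p = (\<lambda>_. 0)" if p: "p \<in> Q" for p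
    proof -
      obtain c where c: "p = (\<lambda>_. c)" using fun_algebra_empty fun_ideal_subset[OF Qid p] by blast
      have "c = 0"
      proof (rule ccontr)
        assume "c \<noteq> 0"
        then have "(\<lambda>_. 1) \<in> Q"
          using fun_ideal_mult[OF Qid fun_algebra.const[of "inverse c"] p] c by simp
        then show False using prime_fun_ideal_one[OF Q] by blast
      qed
      then show ?thesis using c by simp
    qed
    moreover obtain c where c: "b = (\<lambda>_. c)" using fun_algebra_empty b(1) by blast
    moreover have "c \<noteq> 0" using c b(2) fun_ideal_zero[OF Qid] by auto
    ultimately show ?thesis by auto
  qed
  then show ?case by (auto simp: has_enough_points_def)
next
  case (insert w J)
  let ?R = "fun_algebra ((\<lambda>i x. x i :: 'k) ` J)"
  have "f (x(w := \<xi>)) = f x" if "f \<in> ?R" for f x \<xi>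
    using that insert(2) by (induction rule: fun_algebra.induct) auto
  then show ?case
    using has_enough_points_adjoin[OF subalgebra_fun_algebra insert(3), of w]
    by (simp add: fun_algebra_insert)
qed

theorem nullstellensatz:
  fixes Q :: "(('n::finite \<Rightarrow> 'k::{alg_closed_field, field_char_0}) \<Rightarrow> 'k) set"
  assumes "prime_fun_ideal polynomial_funs Q" "b \<in> polynomial_funs" "b \<notin> Q"
  shows "\<exists>x. (\<forall>p\<in>Q. p x = 0) \<and> b x \<noteq> 0"
  using has_enough_points_coords[OF finite_UNIV] assms
  unfolding has_enough_points_def polynomial_funs_def by blast

section \<open>Closed sets, irreducibility and prime divisors\<close>

definition vanishing_ideal :: "('n::finite \<Rightarrow> 'k::field) set \<Rightarrow> (('n \<Rightarrow> 'k) \<Rightarrow> 'k) set" where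
  "vanishing_ideal X = {p \<in> polynomial_funs. \<forall>x\<in>X. p x = 0}"

lemma vanishing_idealI: "p \<in> polynomial_funs \<Longrightarrow> (\<And>x. x \<in> X \<Longrightarrow> p x = 0) \<Longrightarrow> p \<in> vanishing_ideal X"
  and vanishing_idealD: "p \<in> vanishing_ideal X \<Longrightarrow> x \<in> X \<Longrightarrow> p x = 0"
  and vanishing_ideal_polynomial: "p \<in> vanishing_ideal X \<Longrightarrow> p \<in> polynomial_funs"
  and vanishing_ideal_antimono: "X \<subseteq> Y \<Longrightarrow> vanishing_ideal Y \<subseteq> vanishing_ideal X"
  by (auto simp: vanishing_ideal_def)

lemma fun_ideal_vanishing_ideal: "fun_ideal polynomial_funs (vanishing_ideal X)"
  by (auto simp: fun_ideal_def vanishing_ideal_def intro: polynomial_closed)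

lemma closedin_zariski:
  "closedin zariski C \<longleftrightarrow> (\<exists>S\<subseteq>polynomial_funs. C = {x. \<forall>p\<in>S. p x = 0})"
proof -
  have "closedin zariski C \<longleftrightarrow> (\<exists>S\<subseteq>polynomial_funs. - C = {x. \<exists>p\<in>S. p x \<noteq> 0})"
    by (simp add: closedin_def openin_zariski Compl_eq_Diff_UNIV)
  also have "\<dots> \<longleftrightarrow> (\<exists>S\<subseteq>polynomial_funs. C = {x. \<forall>p\<in>S. p x = 0})"
    by (intro ex_cong conj_cong refl) blast
  finally show ?thesis .
qed

lemma closedin_zariski_vanishing:
  assumes "closedin zariski C" and "\<And>p. p \<in> vanishing_ideal C \<Longrightarrow> p x = 0"
  shows "x \<in> C"
proof -
  obtain S where S: "S \<subseteq> polynomial_funs" "C = {x. \<forall>p\<in>S. p x = 0}"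
    using assms(1) unfolding closedin_zariski by blast
  have "p x = 0" if p: "p \<in> S" for p
  proof (rule assms(2), rule vanishing_idealI)
    show "p \<in> polynomial_funs" using p S(1) by blast
    show "p y = 0" if "y \<in> C" for y using that p unfolding S(2) by simp
  qed
  then show ?thesis unfolding S(2) by simp
qed

lemma affine_variety_prime:
  assumes X: "affine_variety X"
  shows "prime_fun_ideal polynomial_funs (vanishing_ideal X)"
  unfolding prime_fun_ideal_def
proof (intro conjI ballI impI fun_ideal_vanishing_ideal)
  show "(\<lambda>_. 1) \<notin> vanishing_ideal X"
    using X by (auto simp: affine_variety_def vanishing_ideal_def)
  fix f g :: "('a \<Rightarrow> 'b) \<Rightarrow> 'b"
  assume f: "f \<in> polynomial_funs" and g: "g \<in> polynomial_funs"
    and fg: "(\<lambda>x. f x * g x) \<in> vanishing_ideal X"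
  have Xcl: "closedin zariski X" using X by (simp add: affine_variety_def)
  have cl: "closedin zariski (X \<inter> {x. h x = 0})" if "h \<in> polynomial_funs" for h
    by (rule closedin_Int[OF Xcl]) (use that in \<open>auto simp: closedin_zariski intro!: exI[of _ "{h}"]\<close>)
  have "X = (X \<inter> {x. f x = 0}) \<union> (X \<inter> {x. g x = 0})"
    using vanishing_idealD[OF fg] by auto
  then have "X = X \<inter> {x. f x = 0} \<or> X = X \<inter> {x. g x = 0}"
    using X cl[OF f] cl[OF g] unfolding affine_variety_def by blast
  then show "f \<in> vanishing_ideal X \<or> g \<in> vanishing_ideal X"
    using f g unfolding vanishing_ideal_def by blast
qed

lemma prime_affine_variety:
  assumes X: "closedin zariski X" and prime: "prime_fun_ideal polynomial_funs (vanishing_ideal X)"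
  shows "affine_variety X"
  unfolding affine_variety_def
proof (intro conjI allI impI X)
  show "X \<noteq> {}"
    using prime_fun_ideal_one[OF prime] by (auto simp: vanishing_ideal_def polynomial_closed)
  fix Y Z :: "('a \<Rightarrow> 'b) set"
  assume YZ: "closedin zariski Y \<and> closedin zariski Z \<and> X = Y \<union> Z"
  show "X = Y \<or> X = Z"
  proof (rule ccontr)
    assume "\<not> ?thesis"
    then obtain y z where "y \<in> X" "y \<notin> Y" "z \<in> X" "z \<notin> Z" using YZ by blast
    then obtain p q where p: "p \<in> vanishing_ideal Y" "p y \<noteq> 0" and q: "q \<in> vanishing_ideal Z" "q z \<noteq> 0"
      using YZ closedin_zariski_vanishing by metis
    have "(\<lambda>x. p x * q x) \<in> vanishing_ideal X"
      using p(1) q(1) YZ by (auto simp: vanishing_ideal_def polynomial_closed)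
    then have "p \<in> vanishing_ideal X \<or> q \<in> vanishing_ideal X"
      using prime_fun_idealD[OF prime] p(1) q(1) vanishing_ideal_polynomial by blast
    then show False
      using p(2) q(2) \<open>y \<in> X\<close> \<open>z \<in> X\<close> vanishing_idealD by blast
  qed
qed

lemma openin_basic:
  assumes "p \<in> polynomial_funs"
  shows "openin (subtopology zariski X) {x \<in> X. p x \<noteq> 0}"
  unfolding openin_subtopology
  by (rule exI[of _ "{x. p x \<noteq> 0}"]) (use assms in \<open>auto simp: openin_zariski intro!: exI[of _ "{p}"]\<close>)

lemma openin_contains_basic:
  assumes "openin (subtopology zariski X) U" "U \<noteq> {}"
  shows "\<exists>p\<in>polynomial_funs. (\<exists>x\<in>X. p x \<noteq> 0) \<and> (\<forall>x\<in>X. p x \<noteq> 0 \<longrightarrow> x \<in> U)"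
proof -
  obtain T where T: "openin zariski T" "U = T \<inter> X"
    using assms(1) unfolding openin_subtopology by blast
  obtain S where S: "S \<subseteq> polynomial_funs" "T = {x. \<exists>p\<in>S. p x \<noteq> 0}"
    using T(1) unfolding openin_zariski by blast
  obtain x where "x \<in> U" using assms(2) by blast
  then obtain p where "p \<in> S" "p x \<noteq> 0" "x \<in> X" using T(2) S(2) by blast
  then show ?thesis using T(2) S by blast
qed

lemma vanishes_if_vanishes_on_basic:
  assumes X: "affine_variety X" and p: "p \<in> polynomial_funs" "\<exists>x\<in>X. p x \<noteq> 0"
    and q: "q \<in> polynomial_funs" "\<And>x. x \<in> X \<Longrightarrow> p x \<noteq> 0 \<Longrightarrow> q x = 0"
    and x: "x \<in> X"
  shows "q x = 0"
proof -
  have "(\<lambda>x. p x * q x) \<in> vanishing_ideal X"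
    using p q by (auto simp: vanishing_ideal_def polynomial_closed)
  then show ?thesis
    using prime_fun_idealD[OF affine_variety_prime[OF X] _ p(1) q(1)] p(2) x vanishing_idealD by blast
qed

lemma nonzero_mult_on_variety:
  assumes X: "affine_variety X" and p: "p \<in> polynomial_funs" "\<exists>x\<in>X. p x \<noteq> 0"
    and q: "q \<in> polynomial_funs" "\<exists>x\<in>X. q x \<noteq> 0"
  shows "\<exists>x\<in>X. p x \<noteq> 0 \<and> q x \<noteq> 0"
  using vanishes_if_vanishes_on_basic[OF X p q(1)] q(2) by blast

lemma closure_of_zariski:
  assumes "S \<subseteq> X"
  shows "(subtopology zariski X) closure_of S = {x \<in> X. \<forall>p\<in>vanishing_ideal S. p x = 0}" (is "_ = ?C")
proof
  have "closedin zariski {x. \<forall>p\<in>vanishing_ideal S. p x = 0}"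
    unfolding closedin_zariski by (rule exI[of _ "vanishing_ideal S"]) (auto simp: vanishing_ideal_def)
  then have "closedin (subtopology zariski X) ?C"
    unfolding closedin_subtopology by blast
  then show "(subtopology zariski X) closure_of S \<subseteq> ?C"
    by (rule closure_of_minimal[rotated]) (use assms in \<open>auto simp: vanishing_ideal_def\<close>)
  show "?C \<subseteq> (subtopology zariski X) closure_of S"
  proof
    fix x assume x: "x \<in> ?C"
    show "x \<in> (subtopology zariski X) closure_of S"
      unfolding in_closure_of
    proof (intro conjI allI impI)
      show "x \<in> topspace (subtopology zariski X)" using x by simp
      fix T assume T: "x \<in> T \<and> openin (subtopology zariski X) T"
      then obtain T' where T': "openin zariski T'" "T = T' \<inter> X" unfolding openin_subtopology by blast
      then obtain A where A: "A \<subseteq> polynomial_funs" "T' = {x. \<exists>p\<in>A. p x \<noteq> 0}" unfolding openin_zariski by blast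
      then obtain p where p: "p \<in> A" "p x \<noteq> 0" using T T' by blast
      then have "p \<notin> vanishing_ideal S" using x by blast
      then obtain y where "y \<in> S" "p y \<noteq> 0" using p A(1) by (auto simp: vanishing_ideal_def)
      then show "\<exists>y. y \<in> S \<and> y \<in> T" using T'(2) A(2) p(1) assms by blast
    qed
  qed
qed

text \<open>A chain of length two from \<open>D\<close> to \<open>X\<close> is the same as a variety strictly between them, and chains
  from \<open>X\<close> to \<open>X\<close> have length zero.\<close>

lemma prime_divisor_iff:
  assumes X: "affine_variety X"
  shows "prime_divisor X D \<longleftrightarrow> affine_variety D \<and> D \<subset> X \<and>
    (\<forall>Z. affine_variety Z \<and> D \<subseteq> Z \<and> Z \<subset> X \<longrightarrow> Z = D)"
proof -
  let ?chain = "\<lambda>m Z. Z 0 = D \<and> Z m = X \<and> (\<forall>i\<le>m. affine_variety (Z i)) \<and> (\<forall>i<m. Z i \<subset> Z (Suc i))"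
  have codim: "codimension X D = Sup {enat m | m. \<exists>Z. ?chain m Z}" by (simp add: codimension_def)
  have incr: "Z i \<subseteq> Z j" if "?chain m Z" "i \<le> j" "j \<le> m" for m Z i j
    using that(2,3)
  proof (induction j rule: dec_induct)
    case (step j)
    then show ?case using that(1) by (meson Suc_le_lessD less_imp_le_nat order_trans psubset_imp_subset)
  qed simp
  show ?thesis
  proof
    assume D: "prime_divisor X D"
    then have D1: "affine_variety D" "D \<subseteq> X" "codimension X D = 1" by (simp_all add: prime_divisor_def)
    have upper: "m \<le> 1" if "?chain m Z" for m Z
    proof -
      have "enat m \<le> codimension X D" unfolding codim
        by (rule Sup_upper, intro CollectI exI[of _ m] conjI refl exI[of _ Z]) (use that in auto)
      then show ?thesis using D1(3) by (simp add: one_enat_def)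
    qed
    have "D \<noteq> X"
    proof
      assume eq: "D = X"
      have "m = 0" if "?chain m Z" for m Z
      proof (rule ccontr)
        assume "m \<noteq> 0"
        then have "Z 0 \<subset> Z 1" "Z 1 \<subseteq> Z m" using that incr[OF that, of 1 m] by auto
        then show False using that eq by auto
      qed
      then have "codimension X D \<le> 0"
        unfolding codim by (intro Sup_least) (auto simp: zero_enat_def)
      then show False using D1(3) by simp
    qed
    moreover have "Z = D" if "affine_variety Z" "D \<subseteq> Z" "Z \<subset> X" for Z
    proof (rule ccontr)
      assume "Z \<noteq> D"
      then have "?chain 2 (\<lambda>i. if i = 0 then D else if i = 1 then Z else X)"
        using that D1(1) X by (auto simp: less_Suc_eq numeral_2_eq_2)
      from upper[OF this] show False by simp
    qed
    ultimately show "affine_variety D \<and> D \<subset> X \<and> (\<forall>Z. affine_variety Z \<and> D \<subseteq> Z \<and> Z \<subset> X \<longrightarrow> Z = D)"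
      using D1 by blast
  next
    assume D: "affine_variety D \<and> D \<subset> X \<and> (\<forall>Z. affine_variety Z \<and> D \<subseteq> Z \<and> Z \<subset> X \<longrightarrow> Z = D)"
    have "\<exists>Z. ?chain 1 Z"
      by (rule exI[of _ "\<lambda>i. if i = 0 then D else X"]) (use D X in \<open>auto simp: le_Suc_eq\<close>)
    then have "enat 1 \<in> {enat m | m. \<exists>Z. ?chain m Z}" by (intro CollectI exI[of _ 1] conjI refl)
    then have "enat 1 \<le> codimension X D" unfolding codim by (rule Sup_upper)
    moreover have "codimension X D \<le> enat 1"
      unfolding codim
    proof (rule Sup_least)
      fix y assume "y \<in> {enat m | m. \<exists>Z. ?chain m Z}"
      then obtain m Z where y: "y = enat m" and Z: "?chain m Z" by blast
      have "m \<le> 1"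
      proof (rule ccontr)
        assume "\<not> m \<le> 1"
        then have m: "1 < m" by simp
        have "Z 0 \<subset> Z (Suc 0)" "Z 1 \<subset> Z (Suc 1)" using Z m by auto
        moreover have "Z (Suc 1) \<subseteq> Z m" using incr[OF Z] m by simp
        ultimately have "D \<subset> Z 1" "Z 1 \<subset> X" using Z by auto
        moreover have "affine_variety (Z 1)" using Z m by auto
        ultimately show False using D by blast
      qed
      then show "y \<le> enat 1" using y by simp
    qed
    ultimately have "codimension X D = 1" by (simp add: one_enat_def)
    then show "prime_divisor X D" using D by (simp add: prime_divisor_def less_imp_le)
  qed
qed

text \<open>By the Nullstellensatz a prime ideal is the full vanishing ideal of its zero set, so that it can be
  recovered from a variety between \<open>D\<close> and \<open>X\<close>.\<close>

lemma prime_divisor_height_one: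
  fixes X :: "('n::finite \<Rightarrow> 'k::{alg_closed_field, field_char_0}) set"
  assumes X: "affine_variety X" and D: "prime_divisor X D"
    and Q: "prime_fun_ideal polynomial_funs Q"
    and XQ: "vanishing_ideal X \<subseteq> Q" and QD: "Q \<subseteq> vanishing_ideal D" and "Q \<noteq> vanishing_ideal X"
  shows "Q = vanishing_ideal D"
proof -
  define Z where "Z = {x. \<forall>p\<in>Q. p x = 0}"
  have Qsub: "Q \<subseteq> polynomial_funs"
    using fun_ideal_subset[OF prime_fun_ideal_fun_ideal[OF Q]] by blast
  have Zcl: "closedin zariski Z" unfolding closedin_zariski Z_def using Qsub by blast
  have IZ: "vanishing_ideal Z = Q"
  proof
    show "vanishing_ideal Z \<subseteq> Q"
    proof
      fix b assume b: "b \<in> vanishing_ideal Z"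
      show "b \<in> Q"
      proof (rule ccontr)
        assume "b \<notin> Q"
        then obtain x where "\<forall>p\<in>Q. p x = 0" "b x \<noteq> 0"
          using nullstellensatz[OF Q vanishing_ideal_polynomial[OF b]] by blast
        then show False using vanishing_idealD[OF b, of x] by (simp add: Z_def)
      qed
    qed
    show "Q \<subseteq> vanishing_ideal Z" using Qsub by (auto simp: Z_def vanishing_ideal_def)
  qed
  have "affine_variety Z" by (rule prime_affine_variety[OF Zcl]) (use IZ Q in simp)
  moreover have "D \<subseteq> Z" using QD vanishing_idealD unfolding Z_def by blast
  moreover have "Z \<subseteq> X"
  proof
    fix x assume "x \<in> Z"
    then show "x \<in> X"
      using X XQ by (intro closedin_zariski_vanishing) (auto simp: affine_variety_def Z_def)
  qed
  moreover have "Z \<noteq> X" using IZ assms(6) by blast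
  ultimately have "Z = D" using D unfolding prime_divisor_iff[OF X] by blast
  then show ?thesis using IZ by simp
qed


section \<open>The local ring of a normal variety along a prime divisor\<close>

text \<open>Normality in a form free of rational functions: the equation says that \<open>p / q\<close> is integral.\<close>

lemma normal_integrally_closed:
  assumes normal: "normal_affine_variety X"
    and p: "p \<in> polynomial_funs" and q: "q \<in> polynomial_funs" "\<exists>x\<in>X. q x \<noteq> 0"
    and a: "\<And>i. i < d \<Longrightarrow> a i \<in> polynomial_funs"
    and eq: "\<And>x. x \<in> X \<Longrightarrow> p x ^ d + (\<Sum>i<d. a i x * p x ^ i * q x ^ (d - i)) = 0"
  shows "\<exists>r\<in>polynomial_funs. \<forall>x\<in>X. p x = q x * r x"
proof -
  have X: "affine_variety X" using normal by (simp add: normal_affine_variety_def)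
  have reg: "regular_fun X f" if "f \<in> polynomial_funs" for f
    using that unfolding regular_fun_def by blast
  let ?h = "\<lambda>x. p x / q x"
  let ?U = "{x \<in> X. q x \<noteq> 0}"
  have U: "openin (subtopology zariski X) ?U" "?U \<noteq> {}" using openin_basic[OF q(1)] q(2) by auto
  have "generically_eq X ?h ?h" unfolding generically_eq_def using U by blast
  then have "rational_fun X ?h" unfolding rational_fun_def using reg p q by blast
  moreover have "integral_fun X ?h"
    unfolding integral_fun_def
  proof (intro exI conjI allI impI)
    show "regular_fun X (a i)" if "i < d" for i by (rule reg[OF a[OF that]])
    show "generically_eq X (\<lambda>x. ?h x ^ d + (\<Sum>i<d. a i x * ?h x ^ i)) (\<lambda>_. 0)"
      unfolding generically_eq_def
    proof (intro exI conjI ballI)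
      fix x assume x: "x \<in> ?U"
      then have qx: "q x \<noteq> 0" by simp
      have "q x ^ d * (?h x ^ d + (\<Sum>i<d. a i x * ?h x ^ i)) =
          p x ^ d + (\<Sum>i<d. a i x * (q x ^ d * ?h x ^ i))"
        using qx by (simp add: distrib_left sum_distrib_left power_divide mult_ac)
      also have "(\<Sum>i<d. a i x * (q x ^ d * ?h x ^ i)) = (\<Sum>i<d. a i x * p x ^ i * q x ^ (d - i))"
      proof (rule sum.cong[OF refl])
        fix i assume "i \<in> {..<d}"
        then have "q x ^ d = q x ^ (d - i) * q x ^ i" by (simp flip: power_add)
        then show "a i x * (q x ^ d * ?h x ^ i) = a i x * p x ^ i * q x ^ (d - i)"
          using qx by (simp add: power_divide mult_ac)
      qed
      finally have "q x ^ d * (?h x ^ d + (\<Sum>i<d. a i x * ?h x ^ i)) = 0" using eq x by simp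
      then show "?h x ^ d + (\<Sum>i<d. a i x * ?h x ^ i) = 0" using qx by simp
    qed (fact U)+
  qed
  ultimately obtain r' where "regular_fun X r'" "generically_eq X ?h r'"
    using normal unfolding normal_affine_variety_def by blast
  then obtain r U' where r: "r \<in> polynomial_funs" "\<forall>x\<in>X. r' x = r x" and
    U': "openin (subtopology zariski X) U'" "U' \<noteq> {}" "\<forall>x\<in>U'. ?h x = r' x"
    unfolding regular_fun_def generically_eq_def by blast
  obtain s where s: "s \<in> polynomial_funs" "\<exists>x\<in>X. s x \<noteq> 0" "\<forall>x\<in>X. s x \<noteq> 0 \<longrightarrow> x \<in> U'"
    using openin_contains_basic[OF U'(1,2)] by blast
  have "p x - q x * r x = 0" if x: "x \<in> X" for x
  proof (rule vanishes_if_vanishes_on_basic[OF X, of "\<lambda>x. s x * q x" "\<lambda>x. p x - q x * r x"])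
    show "\<exists>x\<in>X. s x * q x \<noteq> 0" using nonzero_mult_on_variety[OF X s(1,2) q] by auto
    show "p x - q x * r x = 0" if "x \<in> X" "s x * q x \<noteq> 0" for x
    proof -
      have "?h x = r x" using that s(3) U'(3) r(2) by auto
      then show ?thesis using that by (simp add: field_simps)
    qed
  qed (use p q r s x in \<open>auto intro!: polynomial_closed\<close>)
  then show ?thesis using r(1) by auto
qed

text \<open>In the local ring at \<open>P\<close> this is the ideal quotient of \<open>(f)\<close> by \<open>g\<close>, pulled back to
  polynomial functions.\<close>

definition local_colon :: "('n::finite \<Rightarrow> 'k::field) set \<Rightarrow> (('n \<Rightarrow> 'k) \<Rightarrow> 'k) set \<Rightarrow>
    (('n \<Rightarrow> 'k) \<Rightarrow> 'k) \<Rightarrow> (('n \<Rightarrow> 'k) \<Rightarrow> 'k) \<Rightarrow> (('n \<Rightarrow> 'k) \<Rightarrow> 'k) set" where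
  "local_colon X P f g = {c \<in> polynomial_funs. \<exists>h\<in>polynomial_funs - P. \<exists>b\<in>polynomial_funs.
     \<forall>x\<in>X. h x * c x * g x = f x * b x}"

lemma local_colonI:
  assumes "c \<in> polynomial_funs" "h \<in> polynomial_funs" "h \<notin> P" "b \<in> polynomial_funs"
    "\<And>x. x \<in> X \<Longrightarrow> h x * c x * g x = f x * b x"
  shows "c \<in> local_colon X P f g"
  unfolding local_colon_def using assms by blast

lemma local_colonD:
  assumes "c \<in> local_colon X P f g"
  shows "c \<in> polynomial_funs \<and> (\<exists>h b. h \<in> polynomial_funs \<and> h \<notin> P \<and> b \<in> polynomial_funs \<and>
    (\<forall>x\<in>X. h x * c x * g x = f x * b x))"
  using assms unfolding local_colon_def by blast

lemma prime_mult_notin: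
  assumes "prime_fun_ideal polynomial_funs P" "f \<in> polynomial_funs" "f \<notin> P" "g \<in> polynomial_funs" "g \<notin> P"
  shows "(\<lambda>x. f x * g x) \<notin> P"
  using prime_fun_idealD[OF assms(1)] assms by blast

lemma fun_ideal_local_colon:
  fixes X :: "('n::finite \<Rightarrow> 'k::field) set"
  assumes P: "prime_fun_ideal polynomial_funs P"
  shows "fun_ideal polynomial_funs (local_colon X P f g)"
  unfolding fun_ideal_def
proof (intro conjI ballI)
  show "local_colon X P f g \<subseteq> polynomial_funs" unfolding local_colon_def by blast
  show "(\<lambda>_. 0) \<in> local_colon X P f g"
    by (rule local_colonI[where h = "\<lambda>_. 1" and b = "\<lambda>_. 0"])
       (use prime_fun_ideal_one[OF P] in \<open>auto intro: polynomial_closed\<close>)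
  fix c2 assume c2: "c2 \<in> local_colon X P f g"
  obtain h2 b2 where 2: "c2 \<in> polynomial_funs" "h2 \<in> polynomial_funs" "h2 \<notin> P" "b2 \<in> polynomial_funs"
    "\<forall>x\<in>X. h2 x * c2 x * g x = f x * b2 x"
    using local_colonD[OF c2] by blast
  show "(\<lambda>x. c1 x + c2 x) \<in> local_colon X P f g" if c1: "c1 \<in> local_colon X P f g" for c1
  proof -
    obtain h1 b1 where 1: "c1 \<in> polynomial_funs" "h1 \<in> polynomial_funs" "h1 \<notin> P" "b1 \<in> polynomial_funs"
      "\<forall>x\<in>X. h1 x * c1 x * g x = f x * b1 x"
      using local_colonD[OF c1] by blast
    show ?thesis
    proof (rule local_colonI[where h = "\<lambda>x. h1 x * h2 x" and b = "\<lambda>x. h2 x * b1 x + h1 x * b2 x"])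
      fix x assume x: "x \<in> X"
      have "h1 x * h2 x * (c1 x + c2 x) * g x = h2 x * (h1 x * c1 x * g x) + h1 x * (h2 x * c2 x * g x)"
        by (simp add: algebra_simps)
      also have "\<dots> = f x * (h2 x * b1 x + h1 x * b2 x)" using 1(5) 2(5) x by (simp add: algebra_simps)
      finally show "h1 x * h2 x * (c1 x + c2 x) * g x = f x * (h2 x * b1 x + h1 x * b2 x)" .
    qed (use 1 2 prime_mult_notin[OF P] in \<open>auto intro: polynomial_closed\<close>)
  qed
  show "(\<lambda>x. c1 x * c2 x) \<in> local_colon X P f g" if c1: "c1 \<in> polynomial_funs" for c1
  proof (rule local_colonI[where h = h2 and b = "\<lambda>x. c1 x * b2 x"])
    fix x assume x: "x \<in> X"
    have "h2 x * (c1 x * c2 x) * g x = c1 x * (h2 x * c2 x * g x)" by (simp add: mult_ac)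
    also have "\<dots> = f x * (c1 x * b2 x)" using 2(5) x by (simp add: mult_ac)
    finally show "h2 x * (c1 x * c2 x) * g x = f x * (c1 x * b2 x)" .
  qed (use c1 2 in \<open>auto intro: polynomial_closed\<close>)
qed

lemma variety_cancel:
  assumes X: "affine_variety X" and f: "f \<in> polynomial_funs" "f \<notin> vanishing_ideal X"
    and a: "a \<in> polynomial_funs" "b \<in> polynomial_funs"
    and eq: "\<And>x. x \<in> X \<Longrightarrow> f x * a x = f x * b x" and x: "x \<in> X"
  shows "a x = b x"
proof -
  have "(\<lambda>x. f x * (a x - b x)) \<in> vanishing_ideal X"
    by (rule vanishing_idealI) (use f a eq in \<open>auto intro!: polynomial_closed simp: right_diff_distrib\<close>)
  then have "(\<lambda>x. a x - b x) \<in> vanishing_ideal X"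
    using prime_fun_idealD[OF affine_variety_prime[OF X] _ f(1) polynomial_closed(5)[OF a]] f(2) by simp
  then show ?thesis using vanishing_idealD x by fastforce
qed

text \<open>A maximal proper ideal quotient \<open>local_colon X P f0 g\<close> is prime, hence equal to \<open>P\<close> as \<open>P\<close> has
  height one. So \<open>g / f0\<close> multiplies \<open>P\<close> into the local ring without lying in it. If it multiplied
  \<open>P\<close> into \<open>P\<close>, then some multiple of it by a unit would be integral over the coordinate ring
  because of the ascending chain condition, which normality forbids. Hence \<open>g / f0\<close> multiplies some
  generator \<open>\<tau>\<close> of \<open>P\<close> to a unit, and \<open>\<tau>\<close> divides everything in \<open>P\<close>. Repeated division by \<open>\<tau>\<close> stops,
  again by the ascending chain condition.\<close>

lemma exists_uniformizer:
  fixes X :: "('n::finite \<Rightarrow> 'k::{alg_closed_field, field_char_0}) set"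
  assumes normal: "normal_affine_variety X" and D: "prime_divisor X D"
    and H: "H \<subseteq> vanishing_ideal D"
    and gen: "\<And>E. fun_ideal polynomial_funs E \<Longrightarrow> vanishing_ideal X \<subseteq> E \<Longrightarrow> H \<subseteq> E \<Longrightarrow>
      vanishing_ideal D \<subseteq> E"
  shows "\<exists>\<tau>\<in>H. \<forall>f\<in>polynomial_funs. f \<notin> vanishing_ideal X \<longrightarrow>
    (\<exists>n q p. q \<in> polynomial_funs - vanishing_ideal D \<and> p \<in> polynomial_funs - vanishing_ideal D \<and>
      (\<forall>x\<in>X. q x * f x = \<tau> x ^ n * p x))"
proof -
  define P where "P = vanishing_ideal D"
  define N where "N = vanishing_ideal X"
  define R where "R = (polynomial_funs :: (('n \<Rightarrow> 'k) \<Rightarrow> 'k) set)"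
  have Ralg: "subalgebra R" unfolding R_def by (rule subalgebra_polynomial_funs)
  note closed = subalgebra_closed[OF Ralg]
  have X: "affine_variety X" using normal by (simp add: normal_affine_variety_def)
  have D': "affine_variety D" "D \<subset> X" using D prime_divisor_iff[OF X] by blast+
  have P: "prime_fun_ideal R P" unfolding P_def R_def by (rule affine_variety_prime[OF D'(1)])
  have Nprime: "prime_fun_ideal R N" unfolding N_def R_def by (rule affine_variety_prime[OF X])
  note Pid = prime_fun_ideal_fun_ideal[OF P] and Nid = prime_fun_ideal_fun_ideal[OF Nprime]
  have NP: "N \<subseteq> P" unfolding N_def P_def using D'(2) by (intro vanishing_ideal_antimono) auto
  have PR: "p \<in> R" if "p \<in> P" for p using that fun_ideal_subset[OF Pid] by blast
  have one: "(\<lambda>_. 1) \<in> R" "(\<lambda>_. 1) \<notin> P" using prime_fun_ideal_one[OF P] closed(1) by auto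
  have NI: "f \<in> N" if "f \<in> R" "\<And>x. x \<in> X \<Longrightarrow> f x = 0" for f
    using that unfolding N_def R_def by (rule vanishing_idealI)
  have ND: "f x = 0" if "f \<in> N" "x \<in> X" for f x using that unfolding N_def by (rule vanishing_idealD)
  have cancel: "a x = b x" if "f \<in> R" "f \<notin> N" "a \<in> R" "b \<in> R" "\<And>x. x \<in> X \<Longrightarrow> f x * a x = f x * b x"
      "x \<in> X" for f a b x
    using variety_cancel[OF X, of f a b x] that unfolding N_def R_def by blast
  have notP: "(\<lambda>x. f x * g x) \<notin> P" "(\<lambda>x. f x * g x) \<in> R" if "f \<in> R" "f \<notin> P" "g \<in> R" "g \<notin> P" for f g
    using prime_fun_idealD[OF P, of f g] that closed(3) by auto
  have transfer: "g \<in> P" if "f \<in> P" "g \<in> R" "\<And>x. x \<in> X \<Longrightarrow> f x = g x" for f g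
  proof -
    have "(\<lambda>x. g x - f x) \<in> N" by (rule NI) (use that PR closed(5) in auto)
    then have "(\<lambda>x. (g x - f x) + f x) \<in> P" using NP that(1) by (intro fun_ideal_add[OF Pid]) auto
    then show ?thesis by simp
  qed
  define C where "C = local_colon X P"
  have CI: "c \<in> C f g" if "c \<in> R" "h \<in> R" "h \<notin> P" "b \<in> R" "\<And>x. x \<in> X \<Longrightarrow> h x * c x * g x = f x * b x" for c h b f g
    unfolding C_def by (rule local_colonI[of c h P b]) (use that in \<open>auto simp: R_def\<close>)
  have CD: "\<exists>h b. h \<in> R \<and> h \<notin> P \<and> b \<in> R \<and> (\<forall>x\<in>X. h x * c x * g x = f x * b x)" if "c \<in> C f g" for c f g
    using local_colonD[OF that[unfolded C_def]] unfolding R_def by blast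
  have Cid: "fun_ideal R (C f g)" for f g
    unfolding C_def R_def by (rule fun_ideal_local_colon) (use P in \<open>simp add: R_def\<close>)
  have noeth: "noetherian R" unfolding R_def by (rule noetherian_polynomial_funs)

  \<comment> \<open>Any function that vanishes on \<open>D\<close> but not on \<open>X\<close> can serve as denominator.\<close>
  obtain y where y: "y \<in> X" "y \<notin> D" using D'(2) by blast
  then obtain f0 where f0: "f0 \<in> P" "f0 \<notin> N"
    using D'(1) closedin_zariski_vanishing[of D y] ND unfolding affine_variety_def P_def by blast
  note f0R = PR[OF f0(1)]

  let ?S = "{C f0 g | g. g \<in> R \<and> (\<lambda>_. 1) \<notin> C f0 g}"
  have "(\<lambda>_. 1) \<notin> C f0 (\<lambda>_. 1)"
  proof
    assume "(\<lambda>_. 1) \<in> C f0 (\<lambda>_. 1)"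
    then obtain h b where h: "h \<in> R" "h \<notin> P" "b \<in> R" "\<forall>x\<in>X. h x * 1 * 1 = f0 x * b x"
      using CD by blast
    have "h \<in> P" by (rule transfer[OF fun_ideal_mult_right[OF Pid f0(1) h(3)] h(1)]) (use h(4) in simp)
    then show False using h(2) by blast
  qed
  then have "?S \<noteq> {}" using one(1) by blast
  then have "\<exists>M\<in>?S. \<forall>J\<in>?S. M \<subseteq> J \<longrightarrow> J = M"
    by (rule noetherian_maximal[OF noeth]) (use Cid in blast)
  then obtain M where M: "M \<in> ?S" and "\<forall>J\<in>?S. M \<subseteq> J \<longrightarrow> J = M" ..
  note Mmax = this(2)[rule_format]
  obtain g where g: "g \<in> R" "M = C f0 g" "(\<lambda>_. 1) \<notin> C f0 g" using M by blast
  have Mprime: "prime_fun_ideal R M"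
    unfolding prime_fun_ideal_def
  proof (intro conjI ballI impI)
    show "fun_ideal R M" "(\<lambda>_. 1) \<notin> M" using g Cid by simp_all
    fix c d assume c: "c \<in> R" and d: "d \<in> R" and cd: "(\<lambda>x. c x * d x) \<in> M"
    show "c \<in> M \<or> d \<in> M"
    proof (rule disjCI[THEN disj_commute[THEN iffD1]])
      assume cM: "c \<notin> M"
      let ?g = "\<lambda>x. c x * g x"
      have "(\<lambda>_. 1) \<notin> C f0 ?g"
      proof
        assume "(\<lambda>_. 1) \<in> C f0 ?g"
        then obtain h b where h: "h \<in> R" "h \<notin> P" "b \<in> R" "\<forall>x\<in>X. h x * 1 * (c x * g x) = f0 x * b x"
          using CD by blast
        have "c \<in> C f0 g" by (rule CI[OF c h(1-3)]) (use h(4) in \<open>simp add: mult_ac\<close>)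
        then show False using cM g(2) by blast
      qed
      then have "C f0 ?g \<in> ?S" using closed(3)[OF c g(1)] by blast
      moreover have "M \<subseteq> C f0 ?g"
      proof
        fix e assume e: "e \<in> M"
        then obtain h b where h: "h \<in> R" "h \<notin> P" "b \<in> R" "\<forall>x\<in>X. h x * e x * g x = f0 x * b x"
          using CD g(2) by blast
        show "e \<in> C f0 ?g"
        proof (rule CI[OF _ h(1,2), of _ "\<lambda>x. c x * b x"])
          show "e \<in> R" using e g(2) fun_ideal_subset[OF Cid] by blast
          show "(\<lambda>x. c x * b x) \<in> R" by (rule closed(3)[OF c h(3)])
          fix x assume x: "x \<in> X"
          have "h x * e x * (c x * g x) = c x * (h x * e x * g x)" by (simp add: mult_ac)
          then show "h x * e x * (c x * g x) = f0 x * (c x * b x)" using h(4) x by (simp add: mult_ac)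
        qed
      qed
      ultimately have eq: "C f0 ?g = M" by (rule Mmax)
      obtain h b where h: "h \<in> R" "h \<notin> P" "b \<in> R" "\<forall>x\<in>X. h x * (c x * d x) * g x = f0 x * b x"
        using CD cd g(2) by blast
      have "d \<in> C f0 ?g" by (rule CI[OF d h(1-3)]) (use h(4) in \<open>simp add: mult_ac\<close>)
      then show "d \<in> M" using eq by blast
    qed
  qed
  have f0M: "f0 \<in> M" unfolding g(2) by (rule CI[OF f0R one g(1)]) simp
  have "M \<subseteq> P"
  proof (rule subsetI, rule ccontr)
    fix c assume c: "c \<in> M" "c \<notin> P"
    then obtain h b where h: "h \<in> R" "h \<notin> P" "b \<in> R" "\<forall>x\<in>X. h x * c x * g x = f0 x * b x"
      using CD g(2) by blast
    have cR: "c \<in> R" using c(1) g(2) fun_ideal_subset[OF Cid] by blast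
    have "(\<lambda>_. 1) \<in> C f0 g"
      by (rule CI[OF one(1) notP(2)[OF h(1,2) cR c(2)] notP(1)[OF h(1,2) cR c(2)] h(3)]) (use h(4) in simp)
    then show False using g(3) by blast
  qed
  moreover have "N \<subseteq> M"
  proof
    fix c assume c: "c \<in> N"
    show "c \<in> M" unfolding g(2)
      by (rule CI[OF fun_ideal_subset[OF Nid c] one closed(1)[of 0]]) (use ND[OF c] in simp)
  qed
  ultimately have MP: "M = P"
    using prime_divisor_height_one[OF X D] Mprime f0M f0(2) unfolding R_def N_def P_def by blast

  \<comment> \<open>The functions that \<open>g / f0\<close> multiplies into the maximal ideal of the local ring.\<close>
  define E where "E = {p \<in> R. \<exists>h b. h \<in> R \<and> h \<notin> P \<and> b \<in> P \<and> (\<forall>x\<in>X. h x * g x * p x = f0 x * b x)}"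
  have EI: "p \<in> E" if "p \<in> R" "h \<in> R" "h \<notin> P" "b \<in> P" "\<And>x. x \<in> X \<Longrightarrow> h x * g x * p x = f0 x * b x" for p h b
    unfolding E_def using that by blast
  have Eid: "fun_ideal R E"
    unfolding fun_ideal_def
  proof (intro conjI ballI)
    show "E \<subseteq> R" unfolding E_def by blast
    show "(\<lambda>_. 0) \<in> E" by (rule EI[OF closed(1) one fun_ideal_zero[OF Pid]]) simp
    fix p2 assume "p2 \<in> E"
    then obtain h2 b2 where 2: "p2 \<in> R" "h2 \<in> R" "h2 \<notin> P" "b2 \<in> P" "\<forall>x\<in>X. h2 x * g x * p2 x = f0 x * b2 x"
      unfolding E_def by blast
    show "(\<lambda>x. p1 x + p2 x) \<in> E" if p1: "p1 \<in> E" for p1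
    proof -
      obtain h1 b1 where 1: "p1 \<in> R" "h1 \<in> R" "h1 \<notin> P" "b1 \<in> P" "\<forall>x\<in>X. h1 x * g x * p1 x = f0 x * b1 x"
        using p1 unfolding E_def by blast
      show ?thesis
      proof (rule EI[OF closed(2)[OF 1(1) 2(1)] notP(2)[OF 1(2,3) 2(2,3)] notP(1)[OF 1(2,3) 2(2,3)]])
        show "(\<lambda>x. h2 x * b1 x + h1 x * b2 x) \<in> P"
          by (intro fun_ideal_add[OF Pid] fun_ideal_mult[OF Pid] 1 2)
        fix x assume x: "x \<in> X"
        have "h1 x * h2 x * g x * (p1 x + p2 x) = h2 x * (h1 x * g x * p1 x) + h1 x * (h2 x * g x * p2 x)"
          by (simp add: algebra_simps)
        also have "\<dots> = h2 x * (f0 x * b1 x) + h1 x * (f0 x * b2 x)" using 1(5) 2(5) x by simp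
        finally show "h1 x * h2 x * g x * (p1 x + p2 x) = f0 x * (h2 x * b1 x + h1 x * b2 x)"
          by (simp add: algebra_simps)
      qed
    qed
    show "(\<lambda>x. p1 x * p2 x) \<in> E" if p1: "p1 \<in> R" for p1
    proof (rule EI[OF closed(3)[OF p1 2(1)] 2(2,3) fun_ideal_mult[OF Pid p1 2(4)]])
      fix x assume x: "x \<in> X"
      have "h2 x * g x * (p1 x * p2 x) = p1 x * (h2 x * g x * p2 x)" by (simp add: mult_ac)
      also have "\<dots> = p1 x * (f0 x * b2 x)" using 2(5) x by simp
      finally show "h2 x * g x * (p1 x * p2 x) = f0 x * (p1 x * b2 x)" by (simp add: mult_ac)
    qed
  qed
  have "\<not> H \<subseteq> E"
  proof
    assume HE: "H \<subseteq> E"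
    have "N \<subseteq> E"
    proof
      fix c assume c: "c \<in> N"
      show "c \<in> E"
        by (rule EI[OF fun_ideal_subset[OF Nid c] one fun_ideal_zero[OF Pid]]) (use ND[OF c] in simp)
    qed
    then have PE: "P \<subseteq> E" using gen[OF Eid[unfolded R_def] _ HE] unfolding P_def N_def by blast
    \<comment> \<open>A single denominator \<open>h\<close> serves all of \<open>P\<close>.\<close>
    define F where "F = (\<lambda>h. {p \<in> P. \<exists>b\<in>P. \<forall>x\<in>X. h x * g x * p x = f0 x * b x})"
    have Fid: "fun_ideal R (F h)" for h
      unfolding fun_ideal_def
    proof (intro conjI ballI)
      show "F h \<subseteq> R" unfolding F_def using PR by blast
      show "(\<lambda>_. 0) \<in> F h" unfolding F_def using fun_ideal_zero[OF Pid] by auto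
      fix p2 assume "p2 \<in> F h"
      then obtain b2 where 2: "p2 \<in> P" "b2 \<in> P" "\<forall>x\<in>X. h x * g x * p2 x = f0 x * b2 x"
        unfolding F_def by blast
      show "(\<lambda>x. p1 x + p2 x) \<in> F h" if p1: "p1 \<in> F h" for p1
      proof -
        obtain b1 where 1: "p1 \<in> P" "b1 \<in> P" "\<forall>x\<in>X. h x * g x * p1 x = f0 x * b1 x"
          using p1 unfolding F_def by blast
        show ?thesis unfolding F_def
          by (intro CollectI conjI bexI[of _ "\<lambda>x. b1 x + b2 x"] fun_ideal_add[OF Pid] 1 2)
             (use 1 2 in \<open>auto simp: distrib_left\<close>)
      qed
      show "(\<lambda>x. p1 x * p2 x) \<in> F h" if p1: "p1 \<in> R" for p1
        unfolding F_def
        by (intro CollectI conjI bexI[of _ "\<lambda>x. p1 x * b2 x"] fun_ideal_mult[OF Pid] p1 2)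
           (use 2 in \<open>auto simp: mult.left_commute\<close>)
    qed
    let ?S2 = "{F h | h. h \<in> R \<and> h \<notin> P}"
    have "?S2 \<noteq> {}" using one by blast
    then have "\<exists>M\<in>?S2. \<forall>J\<in>?S2. M \<subseteq> J \<longrightarrow> J = M"
      by (rule noetherian_maximal[OF noeth]) (use Fid in blast)
    then obtain M2 where M2: "M2 \<in> ?S2" and "\<forall>J\<in>?S2. M2 \<subseteq> J \<longrightarrow> J = M2" ..
    note M2max = this(2)[rule_format]
    obtain h where h: "h \<in> R" "h \<notin> P" "M2 = F h" using M2 by blast
    have "P \<subseteq> F h"
    proof
      fix p assume p: "p \<in> P"
      then have "p \<in> E" using PE by blast
      then obtain h' b where h': "h' \<in> R" "h' \<notin> P" "b \<in> P" "\<forall>x\<in>X. h' x * g x * p x = f0 x * b x"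
        unfolding E_def by blast
      let ?h = "\<lambda>x. h x * h' x"
      have "M2 \<subseteq> F ?h"
      proof
        fix p' assume "p' \<in> M2"
        then obtain b' where b': "p' \<in> P" "b' \<in> P" "\<forall>x\<in>X. h x * g x * p' x = f0 x * b' x"
          unfolding h(3) F_def by blast
        have "\<forall>x\<in>X. h x * h' x * g x * p' x = f0 x * (h' x * b' x)"
        proof
          fix x assume "x \<in> X"
          then have "h' x * (h x * g x * p' x) = h' x * (f0 x * b' x)" using b'(3) by simp
          then show "h x * h' x * g x * p' x = f0 x * (h' x * b' x)" by (simp add: mult_ac)
        qed
        then show "p' \<in> F ?h" unfolding F_def
          using b'(1) fun_ideal_mult[OF Pid h'(1) b'(2)] by (intro CollectI conjI bexI[of _ "\<lambda>x. h' x * b' x"])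
      qed
      moreover have "F ?h \<in> ?S2" using notP[OF h(1,2) h'(1,2)] by blast
      ultimately have eq: "F ?h = M2" using M2max by blast
      have "\<forall>x\<in>X. h x * h' x * g x * p x = f0 x * (h x * b x)"
      proof
        fix x assume "x \<in> X"
        then have "h x * (h' x * g x * p x) = h x * (f0 x * b x)" using h'(4) by simp
        then show "h x * h' x * g x * p x = f0 x * (h x * b x)" by (simp add: mult_ac)
      qed
      then have "p \<in> F ?h" unfolding F_def
        using p fun_ideal_mult[OF Pid h(1) h'(3)] by (intro CollectI conjI bexI[of _ "\<lambda>x. h x * b x"])
      then show "p \<in> F h" using eq h(3) by simp
    qed
    then have "\<forall>p. \<exists>b. p \<in> P \<longrightarrow> b \<in> P \<and> (\<forall>x\<in>X. h x * g x * p x = f0 x * b x)"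
      unfolding F_def by blast
    then obtain B where B: "\<forall>p. p \<in> P \<longrightarrow> B p \<in> P \<and> (\<forall>x\<in>X. h x * g x * p x = f0 x * B p x)"
      by (rule choice[THEN exE])
    \<comment> \<open>\<open>b n\<close> represents \<open>(h g / f0) ^ n * f0\<close>.\<close>
    define b where "b = (\<lambda>n. (B ^^ n) f0)"
    have bP: "b n \<in> P" for n by (induction n) (use B f0(1) in \<open>auto simp: b_def\<close>)
    have b_eq: "f0 x ^ n * b n x = (h x * g x) ^ n * f0 x" if x: "x \<in> X" for n x
    proof (induction n)
      case (Suc n)
      have step: "f0 x * b (Suc n) x = h x * g x * b n x" using B bP[of n] x by (simp add: b_def)
      have "f0 x ^ Suc n * b (Suc n) x = f0 x ^ n * (f0 x * b (Suc n) x)" by (simp add: mult_ac)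
      also have "\<dots> = h x * g x * (f0 x ^ n * b n x)" unfolding step by (simp only: mult_ac)
      finally show ?case unfolding Suc by (simp only: power_Suc mult_ac)
    qed (simp add: b_def)
    \<comment> \<open>A relation that expresses \<open>b n\<close> by its predecessors is an equation of integral dependence.\<close>
    define I where "I = (\<lambda>n. {c \<in> R. \<exists>a. (\<forall>k. a k \<in> R) \<and> (\<forall>x\<in>X. c x = (\<Sum>k<n. a k x * b k x))})"
    have II: "c \<in> I n" if "c \<in> R" "\<And>k. a k \<in> R" "\<And>x. x \<in> X \<Longrightarrow> c x = (\<Sum>k<n. a k x * b k x)" for c a n
      unfolding I_def using that by blast
    have Iid: "fun_ideal R (I n)" for n
      unfolding fun_ideal_def
    proof (intro conjI ballI)
      show "I n \<subseteq> R" unfolding I_def by blast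
      show "(\<lambda>_. 0) \<in> I n" by (rule II[of _ "\<lambda>_ _. 0"]) (auto intro: closed)
      fix c2 assume "c2 \<in> I n"
      then obtain a2 where 2: "c2 \<in> R" "\<forall>k. a2 k \<in> R" "\<forall>x\<in>X. c2 x = (\<Sum>k<n. a2 k x * b k x)"
        unfolding I_def by blast
      show "(\<lambda>x. c1 x + c2 x) \<in> I n" if c1: "c1 \<in> I n" for c1
      proof -
        obtain a1 where 1: "c1 \<in> R" "\<forall>k. a1 k \<in> R" "\<forall>x\<in>X. c1 x = (\<Sum>k<n. a1 k x * b k x)"
          using c1 unfolding I_def by blast
        show ?thesis
          by (rule II[of _ "\<lambda>k x. a1 k x + a2 k x"])
             (use 1 2 in \<open>auto intro: closed simp: distrib_right sum.distrib\<close>)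
      qed
      show "(\<lambda>x. c1 x * c2 x) \<in> I n" if c1: "c1 \<in> R" for c1
        by (rule II[of _ "\<lambda>k x. c1 x * a2 k x"])
           (use c1 2 in \<open>auto intro: closed simp: sum_distrib_left mult.assoc\<close>)
    qed
    have Imono: "I n \<subseteq> I (Suc n)" for n
    proof
      fix c assume "c \<in> I n"
      then obtain a where a: "c \<in> R" "\<forall>k. a k \<in> R" "\<forall>x\<in>X. c x = (\<Sum>k<n. a k x * b k x)"
        unfolding I_def by blast
      show "c \<in> I (Suc n)"
        by (rule II[of _ "\<lambda>k. if k < n then a k else (\<lambda>_. 0)"]) (use a in \<open>auto intro: closed\<close>)
    qed
    obtain n where n: "\<forall>m\<ge>n. I m = I n"
      using noetherianD[OF noeth, of I, OF Iid Imono] ..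
    have "b n \<in> I (Suc n)"
      by (rule II[of _ "\<lambda>k _. if k < n then 0 else 1"]) (use PR[OF bP] closed(1) in simp_all)
    then have "b n \<in> I n" using n by (metis le_Suc_eq order_refl)
    then obtain a where a: "\<forall>k. a k \<in> R" "\<forall>x\<in>X. b n x = (\<Sum>k<n. a k x * b k x)"
      unfolding I_def by blast
    let ?s = "\<lambda>x. \<Sum>k<n. a k x * (h x * g x) ^ k * f0 x ^ (n - k)"
    have "(h x * g x) ^ n = ?s x" if x: "x \<in> X" for x
    proof (rule cancel[OF f0R f0(2) _ _ _ x])
      show "(\<lambda>x. (h x * g x) ^ n) \<in> R" by (intro closed h g)
      show "?s \<in> R" using a(1) by (intro closed h g f0R) auto
      fix x assume x: "x \<in> X"
      have "f0 x * (h x * g x) ^ n = f0 x ^ n * b n x" using b_eq[OF x] by (simp add: mult.commute)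
      also have "\<dots> = (\<Sum>k<n. a k x * (f0 x ^ n * b k x))"
        using a(2) x by (simp add: sum_distrib_left mult_ac)
      also have "\<dots> = (\<Sum>k<n. f0 x * (a k x * (h x * g x) ^ k * f0 x ^ (n - k)))"
      proof (rule sum.cong[OF refl])
        fix k assume "k \<in> {..<n}"
        then have "f0 x ^ n = f0 x ^ (n - k) * f0 x ^ k" by (simp flip: power_add)
        then have "f0 x ^ n * b k x = f0 x ^ (n - k) * ((h x * g x) ^ k * f0 x)"
          using b_eq[OF x, of k] by (simp add: mult.assoc)
        then show "a k x * (f0 x ^ n * b k x) = f0 x * (a k x * (h x * g x) ^ k * f0 x ^ (n - k))"
          by (simp add: mult_ac)
      qed
      finally show "f0 x * (h x * g x) ^ n = f0 x * ?s x" by (simp add: sum_distrib_left)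
    qed
    then have "\<exists>r\<in>R. \<forall>x\<in>X. h x * g x = f0 x * r x"
      unfolding R_def
    proof (intro normal_integrally_closed[OF normal, where d = n and a = "\<lambda>k x. - a k x"])
      show "\<exists>x\<in>X. f0 x \<noteq> 0" using f0(2) NI[OF f0R] by blast
    qed (use a h g f0R closed(3,4) in \<open>auto simp: R_def sum_negf\<close>)
    then obtain r where r: "r \<in> R" "\<forall>x\<in>X. h x * g x = f0 x * r x" by blast
    have "(\<lambda>_. 1) \<in> C f0 g" by (rule CI[OF one(1) h(1,2) r(1)]) (use r(2) in simp)
    then show False using g(3) by blast
  qed
  then obtain \<tau> where \<tau>: "\<tau> \<in> H" "\<tau> \<notin> E" by blast
  have \<tau>P: "\<tau> \<in> P" using \<tau>(1) H P_def by blast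
  note \<tau>R = PR[OF \<tau>P]
  obtain h u where hu: "h \<in> R" "h \<notin> P" "u \<in> R" "\<forall>x\<in>X. h x * \<tau> x * g x = f0 x * u x"
    using CD \<tau>P MP g(2) by blast
  have uP: "u \<notin> P"
  proof
    assume "u \<in> P"
    then have "\<tau> \<in> E" by (rule EI[OF \<tau>R hu(1,2)]) (use hu(4) in \<open>simp add: mult_ac\<close>)
    then show False using \<tau>(2) by blast
  qed
  have divide: "\<exists>q a. q \<in> R \<and> q \<notin> P \<and> a \<in> R \<and> (\<forall>x\<in>X. q x * p x = \<tau> x * a x)" if p: "p \<in> P" for p
  proof -
    obtain h' b where h': "h' \<in> R" "h' \<notin> P" "b \<in> R" "\<forall>x\<in>X. h' x * p x * g x = f0 x * b x"
      using CD p MP g(2) by blast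
    have "h' x * u x * p x = \<tau> x * (h x * b x)" if x: "x \<in> X" for x
    proof (rule cancel[OF f0R f0(2) _ _ _ x])
      show "(\<lambda>x. h' x * u x * p x) \<in> R" by (intro closed h' hu PR[OF p])
      show "(\<lambda>x. \<tau> x * (h x * b x)) \<in> R" by (intro closed h' hu \<tau>R)
      fix x assume x: "x \<in> X"
      have "f0 x * (h' x * u x * p x) = h' x * p x * (f0 x * u x)" by (simp add: mult_ac)
      also have "\<dots> = h' x * p x * (h x * \<tau> x * g x)" using hu(4) x by simp
      also have "\<dots> = h x * \<tau> x * (h' x * p x * g x)" by (simp only: mult_ac)
      also have "\<dots> = h x * \<tau> x * (f0 x * b x)" using h'(4) x by simp
      also have "\<dots> = f0 x * (\<tau> x * (h x * b x))" by (simp only: mult_ac)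
      finally show "f0 x * (h' x * u x * p x) = f0 x * (\<tau> x * (h x * b x))" .
    qed
    then show ?thesis
      using notP[OF h'(1,2) hu(3) uP] closed(3)[OF hu(1) h'(3)]
      by (intro exI[of _ "\<lambda>x. h' x * u x"] exI[of _ "\<lambda>x. h x * b x"]) simp
  qed
  define good where "good = (\<lambda>f. \<exists>n q p. q \<in> R - P \<and> p \<in> R - P \<and> (\<forall>x\<in>X. q x * f x = \<tau> x ^ n * p x))"
  have "good f" if "f \<in> R" "f \<notin> N" for f
  proof (rule ccontr)
    assume "\<not> good f"
    let ?one = "\<lambda>_::'n \<Rightarrow> 'k. 1::'k"
    let ?S3 = "{C f ?one | f. f \<in> R \<and> f \<notin> N \<and> \<not> good f}"
    have "?S3 \<noteq> {}" using that \<open>\<not> good f\<close> by blast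
    then have "\<exists>M\<in>?S3. \<forall>J\<in>?S3. M \<subseteq> J \<longrightarrow> J = M"
      by (rule noetherian_maximal[OF noeth]) (use Cid in blast)
    then obtain M3 where M3: "M3 \<in> ?S3" and "\<forall>J\<in>?S3. M3 \<subseteq> J \<longrightarrow> J = M3" ..
    note M3max = this(2)[rule_format]
    obtain f where f: "f \<in> R" "f \<notin> N" "\<not> good f" "M3 = C f ?one" using M3 by blast
    have "f \<in> P"
    proof (rule ccontr)
      assume "f \<notin> P"
      then have "good f" unfolding good_def using one f(1)
        by (intro exI[of _ 0] exI[of _ "\<lambda>_. 1"] exI[of _ f]) simp
      then show False using f(3) by blast
    qed
    then obtain q f' where q: "q \<in> R" "q \<notin> P" "f' \<in> R" "\<forall>x\<in>X. q x * f x = \<tau> x * f' x"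
      using divide by blast
    have f'N: "f' \<notin> N"
    proof
      assume "f' \<in> N"
      then have "(\<lambda>x. q x * f x) \<in> N" using q ND by (intro NI closed(3) f) auto
      then show False using prime_fun_idealD[OF Nprime _ q(1) f(1)] f(2) q(2) NP by blast
    qed
    have "\<not> good f'"
    proof
      assume "good f'"
      then obtain n q' p' where q': "q' \<in> R" "q' \<notin> P" "p' \<in> R - P" "\<forall>x\<in>X. q' x * f' x = \<tau> x ^ n * p' x"
        unfolding good_def by blast
      have "\<forall>x\<in>X. q' x * q x * f x = \<tau> x ^ Suc n * p' x"
      proof
        fix x assume x: "x \<in> X"
        have "q' x * q x * f x = q' x * (q x * f x)" by (simp add: mult_ac)
        also have "\<dots> = q' x * (\<tau> x * f' x)" using q(4) x by simp
        also have "\<dots> = \<tau> x * (q' x * f' x)" by (simp only: mult_ac)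
        also have "\<dots> = \<tau> x * (\<tau> x ^ n * p' x)" using q'(4) x by simp
        finally show "q' x * q x * f x = \<tau> x ^ Suc n * p' x" by (simp only: power_Suc mult_ac)
      qed
      then have "good f" unfolding good_def using notP[OF q'(1,2) q(1,2)] q'(3)
        by (intro exI[of _ "Suc n"] exI[of _ "\<lambda>x. q' x * q x"] exI[of _ p']) simp
      then show False using f(3) by blast
    qed
    then have "C f' ?one \<in> ?S3" using q(3) f'N by blast
    moreover have "M3 \<subseteq> C f' ?one"
    proof
      fix c assume c: "c \<in> M3"
      then obtain h b where h: "h \<in> R" "h \<notin> P" "b \<in> R" "\<forall>x\<in>X. h x * c x * 1 = f x * b x"
        using CD f(4) by blast
      show "c \<in> C f' ?one"
      proof (rule CI[OF _ notP(2)[OF q(1,2) h(1,2)] notP(1)[OF q(1,2) h(1,2)] closed(3)[OF \<tau>R h(3)]])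
        show "c \<in> R" using c f(4) fun_ideal_subset[OF Cid] by blast
        fix x assume x: "x \<in> X"
        have "q x * h x * c x * 1 = q x * (h x * c x * 1)" by (simp add: mult_ac)
        also have "\<dots> = q x * f x * b x" using h(4) x by simp
        also have "\<dots> = f' x * (\<tau> x * b x)" using q(4) x by simp
        finally show "q x * h x * c x * 1 = f' x * (\<tau> x * b x)" .
      qed
    qed
    ultimately have "C f' ?one = M3" by (rule M3max)
    moreover have "f' \<in> C f' ?one" by (rule CI[OF q(3) one one(1)]) simp
    ultimately obtain h b where h: "h \<in> R" "h \<notin> P" "b \<in> R" "\<forall>x\<in>X. h x * f' x * 1 = f x * b x"
      using CD f(4) by blast
    have "\<tau> x * b x = q x * h x" if x: "x \<in> X" for x
    proof (rule cancel[OF q(3) f'N _ _ _ x])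
      fix x assume x: "x \<in> X"
      have "f' x * (\<tau> x * b x) = q x * f x * b x" using q(4) x by simp
      also have "\<dots> = q x * (h x * f' x * 1)" using h(4) x by simp
      also have "\<dots> = f' x * (q x * h x)" by simp
      finally show "f' x * (\<tau> x * b x) = f' x * (q x * h x)" .
    qed (intro closed q h \<tau>R)+
    then have "(\<lambda>x. q x * h x) \<in> P"
      using transfer[OF fun_ideal_mult_right[OF Pid \<tau>P h(3)] closed(3)[OF q(1) h(1)]] by blast
    then show False using notP[OF q(1,2) h(1,2)] by blast
  qed
  then show ?thesis using \<tau>(1) unfolding good_def R_def P_def N_def by blast
qed

section \<open>Polynomial dependence on a parameter\<close>

text \<open>Functions of a parameter \<open>t\<close> and a point \<open>x\<close>, seen as polynomials in \<open>t\<close> over the polynomial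
  functions of \<open>x\<close>.\<close>

definition param_polynomials :: "('k \<times> ('n::finite \<Rightarrow> 'k::field) \<Rightarrow> 'k) set" where
  "param_polynomials = adjoin ((\<lambda>p. p \<circ> snd) ` polynomial_funs) fst"

lemma subalgebra_pullback: "subalgebra ((\<lambda>p. p \<circ> snd) ` polynomial_funs)"
  unfolding subalgebra_def
proof (intro conjI allI ballI)
  show "(\<lambda>_. c) \<in> (\<lambda>p. p \<circ> snd) ` polynomial_funs" for c
    by (rule image_eqI[of _ _ "\<lambda>_. c"]) (auto intro: polynomial_closed)
  fix f g :: "'a \<times> ('b \<Rightarrow> 'c) \<Rightarrow> 'c"
  assume "f \<in> (\<lambda>p. p \<circ> snd) ` polynomial_funs" "g \<in> (\<lambda>p. p \<circ> snd) ` polynomial_funs"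
  then obtain p q where pq: "p \<in> polynomial_funs" "f = p \<circ> snd" "q \<in> polynomial_funs" "g = q \<circ> snd"
    by blast
  show "(\<lambda>x. f x + g x) \<in> (\<lambda>p. p \<circ> snd) ` polynomial_funs"
    by (rule image_eqI[of _ _ "\<lambda>x. p x + q x"]) (use pq in \<open>auto intro: polynomial_closed\<close>)
  show "(\<lambda>x. f x * g x) \<in> (\<lambda>p. p \<circ> snd) ` polynomial_funs"
    by (rule image_eqI[of _ _ "\<lambda>x. p x * q x"]) (use pq in \<open>auto intro: polynomial_closed\<close>)
qed

lemma subalgebra_param_polynomials: "subalgebra param_polynomials"
  unfolding param_polynomials_def by (rule subalgebra_adjoin[OF subalgebra_pullback])

lemmas param_closed = subalgebra_closed[OF subalgebra_param_polynomials]

lemma param_polynomials_fst: "fst \<in> param_polynomials"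
  unfolding param_polynomials_def by (rule adjoin_generator[OF subalgebra_pullback])

lemma param_polynomials_snd: "p \<in> polynomial_funs \<Longrightarrow> (\<lambda>z. p (snd z)) \<in> param_polynomials"
  unfolding param_polynomials_def
  by (rule subsetD[OF subset_adjoin[OF subalgebra_pullback]], rule image_eqI[of _ _ p]) auto

lemma param_polynomials_expansion:
  assumes "f \<in> param_polynomials"
  shows "\<exists>c d. (\<forall>i. c i \<in> polynomial_funs) \<and> (\<forall>i>d. c i = (\<lambda>_. 0)) \<and>
    (\<forall>t x. f (t, x) = (\<Sum>i\<le>d. c i x * t ^ i))"
proof -
  obtain a d where a: "\<forall>i. a i \<in> (\<lambda>p. p \<circ> snd) ` polynomial_funs" "\<forall>i>d. a i = (\<lambda>_. 0)"
    "\<forall>z. f z = (\<Sum>i\<le>d. a i z * fst z ^ i)"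
    using adjoinD[OF assms[unfolded param_polynomials_def]] by blast
  from a(1) have "\<forall>i. \<exists>p. p \<in> polynomial_funs \<and> a i = p \<circ> snd" by blast
  then obtain c where c: "\<forall>i. c i \<in> polynomial_funs \<and> a i = c i \<circ> snd" by metis
  have "c i = (\<lambda>_. 0)" if "i > d" for i
  proof
    fix x
    have "a i (undefined, x) = 0" using a(2) that by simp
    then show "c i x = 0" using c by simp
  qed
  then show ?thesis using a(3) c by (intro exI[of _ c] exI[of _ d]) simp
qed

lemma subalgebra_compose:
  assumes S: "subalgebra S" and p: "p \<in> polynomial_funs" and f: "\<And>j. (\<lambda>z. f z j) \<in> S"
  shows "(\<lambda>z. p (f z)) \<in> S"
  using p unfolding polynomial_funs_def
proof (induction rule: fun_algebra.induct)
  case (gen h)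
  then show ?case using f by auto
qed (auto intro: subalgebra_closed[OF S])

lemma subalgebra_product_funs: "subalgebra (product_funs A)"
  unfolding product_funs_def by (rule subalgebra_fun_algebra)

lemma product_funs_Ga: "product_funs Ga_funs \<subseteq> param_polynomials"
proof
  fix p :: "'k \<times> ('n::finite \<Rightarrow> 'k::field) \<Rightarrow> 'k"
  assume "p \<in> product_funs Ga_funs"
  then show "p \<in> param_polynomials"
    unfolding product_funs_def
  proof (rule fun_algebra_least[OF _ subalgebra_param_polynomials])
    have "(\<lambda>z. u (fst z)) \<in> (param_polynomials :: ('k \<times> ('n \<Rightarrow> 'k) \<Rightarrow> 'k) set)" if "u \<in> Ga_funs" for u
      using that unfolding Ga_funs_def
      by (induction rule: fun_algebra.induct)
         (use param_polynomials_fst in \<open>auto intro: param_closed\<close>)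
    then show "(\<lambda>u. u \<circ> fst) ` Ga_funs \<union> (\<lambda>p. p \<circ> snd) ` polynomial_funs \<subseteq>
        (param_polynomials :: ('k \<times> ('n \<Rightarrow> 'k) \<Rightarrow> 'k) set)"
      using param_polynomials_snd by (auto simp: comp_def)
  qed
qed

text \<open>A power of the parameter clears the denominators that its inverse brings in.\<close>

lemma product_funs_Gm:
  fixes p :: "'k::field \<times> ('n::finite \<Rightarrow> 'k) \<Rightarrow> 'k"
  assumes "p \<in> product_funs Gm_funs"
  shows "\<exists>N::nat. \<exists>f\<in>param_polynomials. \<forall>t x. t \<noteq> 0 \<longrightarrow> t ^ N * p (t, x) = f (t, x)"
proof -
  let ?S = "{p :: 'k \<times> ('n \<Rightarrow> 'k) \<Rightarrow> 'k. \<exists>N::nat. \<exists>f\<in>param_polynomials.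
    \<forall>t x. t \<noteq> 0 \<longrightarrow> t ^ N * p (t, x) = f (t, x)}"
  have SI: "p \<in> ?S" if "f \<in> param_polynomials" "\<And>t x. t \<noteq> 0 \<Longrightarrow> t ^ N * p (t, x) = f (t, x)" for p f N
    using that by blast
  have t: "(\<lambda>z. fst z ^ N) \<in> (param_polynomials :: ('k \<times> ('n \<Rightarrow> 'k) \<Rightarrow> 'k) set)" for N
    using param_closed(7)[OF param_polynomials_fst] .
  have sub: "p \<in> ?S" if "p \<in> param_polynomials" for p
    by (rule SI[OF that, of 0]) simp
  have S: "subalgebra ?S"
    unfolding subalgebra_def
  proof (intro conjI allI ballI)
    show "(\<lambda>_. c) \<in> ?S" for c by (rule sub[OF param_closed(1)])
    fix p q assume "p \<in> ?S" "q \<in> ?S"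
    then obtain N f M g where f: "f \<in> param_polynomials" "\<forall>t x. t \<noteq> 0 \<longrightarrow> t ^ N * p (t, x) = f (t, x)"
      and g: "g \<in> param_polynomials" "\<forall>t x. t \<noteq> 0 \<longrightarrow> t ^ M * q (t, x) = g (t, x)"
      by blast
    show "(\<lambda>x. p x + q x) \<in> ?S"
    proof (rule SI)
      show "(\<lambda>z. fst z ^ M * f z + fst z ^ N * g z) \<in> param_polynomials"
        by (intro param_closed(2,3) t f g)
      fix t :: 'k and x :: "'n \<Rightarrow> 'k" assume "t \<noteq> 0"
      then show "t ^ (N + M) * (p (t, x) + q (t, x)) =
          fst (t, x) ^ M * f (t, x) + fst (t, x) ^ N * g (t, x)"
        using f(2)[rule_format, of t x, symmetric] g(2)[rule_format, of t x, symmetric]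
        by (simp add: power_add algebra_simps)
    qed
    show "(\<lambda>x. p x * q x) \<in> ?S"
    proof (rule SI)
      show "(\<lambda>z. f z * g z) \<in> param_polynomials" by (intro param_closed(3) f g)
      fix t :: 'k and x :: "'n \<Rightarrow> 'k" assume "t \<noteq> 0"
      then show "t ^ (N + M) * (p (t, x) * q (t, x)) = f (t, x) * g (t, x)"
        using f(2)[rule_format, of t x, symmetric] g(2)[rule_format, of t x, symmetric]
        by (simp add: power_add algebra_simps)
    qed
  qed
  have "(\<lambda>z. u (fst z)) \<in> ?S" if "u \<in> Gm_funs" for u
    using that unfolding Gm_funs_def
  proof (induction rule: fun_algebra.induct)
    case (gen u)
    then consider "u = (\<lambda>t. t)" | "u = (\<lambda>t. inverse t)" by blast
    then show ?case
    proof cases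
      case 1
      then show ?thesis using sub[OF param_polynomials_fst] by simp
    next
      case 2
      show ?thesis
        by (rule SI[OF param_closed(1)[of 1], of 1]) (simp add: 2)
    qed
  next
    case (const c)
    then show ?case by (rule subalgebra_const[OF S])
  next
    case (add f g)
    show ?case by (rule subalgebra_add[OF S add(3,4)])
  next
    case (mult f g)
    show ?case by (rule subalgebra_mult[OF S mult(3,4)])
  qed
  then have "(\<lambda>u. u \<circ> fst) ` Gm_funs \<union> (\<lambda>p. p \<circ> snd) ` polynomial_funs \<subseteq> ?S"
    using sub[OF param_polynomials_snd] unfolding comp_def by blast
  then have "p \<in> ?S"
    using fun_algebra_least[OF assms[unfolded product_funs_def] S] by blast
  then show ?thesis by blast
qed

lemma regular_action_pullback:
  assumes act: "regular_action G A X \<phi>" and f: "f \<in> polynomial_funs"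
  shows "\<exists>p\<in>product_funs A. \<forall>g\<in>carrier G. \<forall>x\<in>X. f (\<phi> g x) = p (g, x)"
proof -
  have "\<forall>i. \<exists>p. p \<in> product_funs A \<and> (\<forall>g\<in>carrier G. \<forall>x\<in>X. \<phi> g x i = p (g, x))"
    using act unfolding regular_action_def by blast
  then obtain q where q: "\<And>i. q i \<in> product_funs A" "\<And>i. \<forall>g\<in>carrier G. \<forall>x\<in>X. \<phi> g x i = q i (g, x)"
    by metis
  have "(\<lambda>z. f (\<lambda>i. q i z)) \<in> product_funs A"
    by (rule subalgebra_compose[OF subalgebra_product_funs f]) (simp add: q(1))
  moreover have "f (\<phi> g x) = f (\<lambda>i. q i (g, x))" if "g \<in> carrier G" "x \<in> X" for g x
  proof -
    have "\<phi> g x = (\<lambda>i. q i (g, x))" using q(2) that by (intro ext) simp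
    then show ?thesis by simp
  qed
  ultimately show ?thesis by (intro bexI[of _ "\<lambda>z. f (\<lambda>i. q i z)"]) auto
qed

lemma polynomial_eq_zero:
  fixes a :: "nat \<Rightarrow> 'k::field_char_0"
  assumes "finite E" "\<And>t. t \<notin> E \<Longrightarrow> (\<Sum>i\<le>n. a i * t ^ i) = 0" "i \<le> n"
  shows "a i = 0"
proof -
  let ?p = "\<Sum>j\<le>n. monom (a j) j"
  have p: "poly ?p t = (\<Sum>i\<le>n. a i * t ^ i)" for t by (simp add: poly_sum poly_monom)
  have "?p = 0"
  proof (rule ccontr)
    assume "?p \<noteq> 0"
    then have "finite {t. poly ?p t = 0}" by (rule poly_roots_finite)
    moreover have "UNIV = E \<union> {t. poly ?p t = 0}" using assms(2) p by auto
    ultimately have "finite (UNIV :: 'k set)" using assms(1) by (metis finite_UnI)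
    then show False using infinite_UNIV_char_0 by blast
  qed
  moreover have "coeff ?p i = a i" using assms(3) by (simp add: coeff_sum)
  ultimately show ?thesis by simp
qed

lemma laurent_eq_zero:
  fixes c :: "int \<Rightarrow> 'k::field_char_0"
  assumes S: "finite S" and 0: "\<And>t. t \<noteq> 0 \<Longrightarrow> (\<Sum>k\<in>S. c k * t powi k) = 0" and k: "k \<in> S"
  shows "c k = 0"
proof -
  define N where "N = Max ((\<lambda>k. nat \<bar>k\<bar>) ` S)"
  have N: "\<bar>k\<bar> \<le> int N" if "k \<in> S" for k
  proof -
    have "nat \<bar>k\<bar> \<le> N" unfolding N_def using S that by (intro Max_ge) auto
    then show ?thesis by simp
  qed
  define a where "a = (\<lambda>i::nat. if int i - int N \<in> S then c (int i - int N) else 0)"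
  have "(\<Sum>i\<le>2*N. a i * t ^ i) = 0" if t: "t \<notin> {0}" for t
  proof -
    have "(\<Sum>i\<le>2*N. a i * t ^ i) = (\<Sum>i | i \<le> 2*N \<and> int i - int N \<in> S. a i * t ^ i)"
      by (rule sum.mono_neutral_right) (auto simp: a_def)
    also have "\<dots> = (\<Sum>k\<in>S. t ^ N * (c k * t powi k))"
    proof (rule sum.reindex_bij_witness[of _ "\<lambda>k. nat (k + int N)" "\<lambda>i. int i - int N"])
      fix i assume i: "i \<in> {i. i \<le> 2*N \<and> int i - int N \<in> S}"
      have "t ^ N * t powi (int i - int N) = t powi (int N + (int i - int N))"
        using t by (subst power_int_add) auto
      also have "\<dots> = t ^ i" by simp
      finally have "t ^ N * t powi (int i - int N) = t ^ i" .
      then show "t ^ N * (c (int i - int N) * t powi (int i - int N)) = a i * t ^ i"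
        using i by (simp add: a_def mult.left_commute)
    qed (use N in \<open>force+\<close>)
    also have "\<dots> = t ^ N * (\<Sum>k\<in>S. c k * t powi k)" by (simp add: sum_distrib_left)
    also have "\<dots> = 0" using 0 t by simp
    finally show ?thesis .
  qed
  then have "a (nat (k + int N)) = 0"
    by (rule polynomial_eq_zero[of "{0}", rotated]) (use N[OF k] in auto)
  moreover have "0 \<le> k + int N" using N[OF k] by linarith
  ultimately show ?thesis using k by (simp add: a_def)
qed

lemma two_power_int_neq_one:
  assumes "k \<noteq> 0"
  shows "(2::'k::field_char_0) powi k \<noteq> 1"
proof -
  have pos: "(2::'k) ^ n \<noteq> 1" if "n > 0" for n
  proof
    assume "(2::'k) ^ n = 1"
    then have "of_nat (2 ^ n) = (of_nat 1 :: 'k)" by simp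
    then have "(2::nat) ^ n = 1" by (simp only: of_nat_eq_iff)
    then show False using that by simp
  qed
  show ?thesis using assms pos[of "nat k"] pos[of "nat (- k)"]
    by (cases "k > 0") (auto simp: power_int_def power_one_over)
qed


section \<open>The grading defined by an action of the torus\<close>

locale Gm_variety =
  fixes X :: "('n::finite \<Rightarrow> 'k::{alg_closed_field, field_char_0}) set"
    and \<phi> :: "'k \<Rightarrow> ('n \<Rightarrow> 'k) \<Rightarrow> ('n \<Rightarrow> 'k)"
  assumes X: "affine_variety X" and action: "regular_Gm_action X \<phi>"
begin

lemma group_action_Gm: "group_action Gm X \<phi>"
  using action by (simp add: regular_action_def)

lemma in_variety: "t \<noteq> 0 \<Longrightarrow> x \<in> X \<Longrightarrow> \<phi> t x \<in> X"
  using group_action.element_image[OF group_action_Gm, of t x] by (simp add: Gm_def)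

lemma action_mult: "s \<noteq> 0 \<Longrightarrow> t \<noteq> 0 \<Longrightarrow> x \<in> X \<Longrightarrow> \<phi> s (\<phi> t x) = \<phi> (s * t) x"
  using group_action.composition_rule[OF group_action_Gm, of x s t] by (simp add: Gm_def)

lemma action_one: "x \<in> X \<Longrightarrow> \<phi> 1 x = x"
  using group_action.id_eq_one[OF group_action_Gm, symmetric] by (simp add: Gm_def)

lemma action_morphism: "t \<noteq> 0 \<Longrightarrow> morphism X X (\<phi> t)"
  using regular_action_in_Aut[OF action, of t] by (simp add: Aut_def Gm_def)

lemma prime_X: "prime_fun_ideal polynomial_funs (vanishing_ideal X)"
  by (rule affine_variety_prime[OF X])

definition homogeneous :: "int \<Rightarrow> (('n \<Rightarrow> 'k) \<Rightarrow> 'k) \<Rightarrow> bool" where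
  "homogeneous k f \<longleftrightarrow> f \<in> polynomial_funs \<and> (\<forall>t x. t \<noteq> 0 \<longrightarrow> x \<in> X \<longrightarrow> f (\<phi> t x) = t powi k * f x)"

lemma homogeneous_polynomial: "homogeneous k f \<Longrightarrow> f \<in> polynomial_funs"
  by (simp add: homogeneous_def)

lemma homogeneousD: "homogeneous k f \<Longrightarrow> t \<noteq> 0 \<Longrightarrow> x \<in> X \<Longrightarrow> f (\<phi> t x) = t powi k * f x"
  by (simp add: homogeneous_def)

lemma homogeneous_zero: "homogeneous k (\<lambda>_. 0)"
  by (simp add: homogeneous_def polynomial_closed)

lemma homogeneous_mult: "homogeneous k f \<Longrightarrow> homogeneous l g \<Longrightarrow> homogeneous (k + l) (\<lambda>x. f x * g x)"
  by (auto simp: homogeneous_def polynomial_closed power_int_add)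

lemma homogeneous_diff: "homogeneous k f \<Longrightarrow> homogeneous k g \<Longrightarrow> homogeneous k (\<lambda>x. f x - g x)"
  by (auto simp: homogeneous_def polynomial_closed right_diff_distrib)

lemma homogeneous_power: "homogeneous k f \<Longrightarrow> homogeneous (int n * k) (\<lambda>x. f x ^ n)"
proof (induction n)
  case 0
  then show ?case by (simp add: homogeneous_def polynomial_closed)
next
  case (Suc n)
  then show ?case using homogeneous_mult[of k f "int n * k" "\<lambda>x. f x ^ n"] by (simp add: algebra_simps)
qed

lemma homogeneous_unique:
  assumes S: "finite S" and c: "\<And>k. k \<in> S \<Longrightarrow> homogeneous k (c k)"
    and 0: "\<And>x. x \<in> X \<Longrightarrow> (\<Sum>k\<in>S. c k x) = 0" and k: "k \<in> S" and x: "x \<in> X"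
  shows "c k x = 0"
proof (rule laurent_eq_zero[OF S _ k, of "\<lambda>k. c k x"])
  fix t :: 'k assume t: "t \<noteq> 0"
  have "(\<Sum>k\<in>S. c k x * t powi k) = (\<Sum>k\<in>S. c k (\<phi> t x))"
    using homogeneousD[OF c t x] by (intro sum.cong) (simp_all add: mult.commute)
  then show "(\<Sum>k\<in>S. c k x * t powi k) = 0" using 0[OF in_variety[OF t x]] by simp
qed

text \<open>The components are the Laurent coefficients of \<open>f (\<phi> t x)\<close> in \<open>t\<close>. Comparing the expansions of
  \<open>f (\<phi> s (\<phi> t x))\<close> and \<open>f (\<phi> (s * t) x)\<close> in \<open>s\<close> shows that they are homogeneous.\<close>

lemma homogeneous_decomposition:
  assumes f: "f \<in> polynomial_funs"
  shows "\<exists>c S. finite S \<and> (\<forall>k. homogeneous k (c k)) \<and> (\<forall>k. k \<notin> S \<longrightarrow> c k = (\<lambda>_. 0)) \<and>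
    (\<forall>x\<in>X. f x = (\<Sum>k\<in>S. c k x))"
proof -
  obtain p where p: "p \<in> product_funs Gm_funs" "\<forall>t\<in>carrier Gm. \<forall>x\<in>X. f (\<phi> t x) = p (t, x)"
    using regular_action_pullback[OF action f] by blast
  obtain N g where g: "g \<in> param_polynomials" "\<forall>t x. t \<noteq> 0 \<longrightarrow> t ^ N * p (t, x) = g (t, x)"
    using product_funs_Gm[OF p(1)] by blast
  obtain a d where a: "\<forall>i. a i \<in> polynomial_funs" "\<forall>t x. g (t, x) = (\<Sum>i\<le>d. a i x * t ^ i)"
    using param_polynomials_expansion[OF g(1)] by blast
  define S where "S = {- int N..int d - int N}"
  define c where "c = (\<lambda>k. if k \<in> S then a (nat (k + int N)) else (\<lambda>_. 0))"
  have expand: "f (\<phi> t x) = (\<Sum>k\<in>S. c k x * t powi k)" if t: "t \<noteq> 0" and x: "x \<in> X" for t x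
  proof -
    have "t ^ N * f (\<phi> t x) = (\<Sum>i\<le>d. a i x * t ^ i)"
      using p(2) g(2) a(2) t x by (simp add: Gm_def)
    also have "\<dots> = (\<Sum>k\<in>S. t ^ N * (c k x * t powi k))"
    proof (rule sum.reindex_bij_witness[of _ "\<lambda>k. nat (k + int N)" "\<lambda>i. int i - int N"])
      fix i assume i: "i \<in> {..d}"
      have "t ^ N * t powi (int i - int N) = t powi (int N + (int i - int N))"
        using t by (subst power_int_add) auto
      also have "\<dots> = t ^ i" by simp
      finally have "t ^ N * t powi (int i - int N) = t ^ i" .
      then show "t ^ N * (c (int i - int N) x * t powi (int i - int N)) = a i x * t ^ i"
        using i by (simp add: c_def S_def mult.left_commute)
    qed (auto simp: S_def)
    also have "\<dots> = t ^ N * (\<Sum>k\<in>S. c k x * t powi k)" by (simp add: sum_distrib_left)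
    finally show ?thesis using t by simp
  qed
  have "homogeneous k (c k)" for k
  proof (cases "k \<in> S")
    case True
    have "c k (\<phi> t x) = t powi k * c k x" if t: "t \<noteq> 0" and x: "x \<in> X" for t x
    proof -
      have "c k (\<phi> t x) - t powi k * c k x = 0"
      proof (rule laurent_eq_zero[of S "\<lambda>k. c k (\<phi> t x) - t powi k * c k x"])
        fix s :: 'k assume s: "s \<noteq> 0"
        have "(\<Sum>k\<in>S. c k (\<phi> t x) * s powi k) = f (\<phi> s (\<phi> t x))"
          using expand[OF s in_variety[OF t x]] by simp
        also have "\<dots> = f (\<phi> (s * t) x)" using action_mult[OF s t x] by simp
        also have "\<dots> = (\<Sum>k\<in>S. c k x * (s * t) powi k)" using expand s t x by simp
        finally show "(\<Sum>k\<in>S. (c k (\<phi> t x) - t powi k * c k x) * s powi k) = 0"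
          by (simp add: left_diff_distrib right_diff_distrib sum_subtractf power_int_mult_distrib mult_ac)
      qed (use True in \<open>simp_all add: S_def\<close>)
      then show ?thesis by simp
    qed
    then show ?thesis using a(1) True by (auto simp: homogeneous_def c_def)
  next
    case False
    then show ?thesis by (simp add: c_def homogeneous_zero)
  qed
  moreover have "\<forall>x\<in>X. f x = (\<Sum>k\<in>S. c k x)" using expand[of 1] action_one by simp
  moreover have "finite S" by (simp add: S_def)
  moreover have "\<forall>k. k \<notin> S \<longrightarrow> c k = (\<lambda>_. 0)" by (simp add: c_def)
  ultimately show ?thesis by blast
qed

definition invariant_funs :: "(('n \<Rightarrow> 'k) \<Rightarrow> 'k) set" where
  "invariant_funs = {f. homogeneous 0 f}"

lemma invariant_funs_iff:
  "f \<in> invariant_funs \<longleftrightarrow> f \<in> polynomial_funs \<and> (\<forall>t x. t \<noteq> 0 \<longrightarrow> x \<in> X \<longrightarrow> f (\<phi> t x) = f x)"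
  by (simp add: invariant_funs_def homogeneous_def)

lemma subalgebra_invariant_funs: "subalgebra invariant_funs"
  by (auto simp: subalgebra_def invariant_funs_iff polynomial_closed)

lemma invariant_funs_polynomial: "f \<in> invariant_funs \<Longrightarrow> f \<in> polynomial_funs"
  by (simp add: invariant_funs_iff)

lemma nontrivial_action:
  assumes "faithful_action Gm X \<phi>"
  shows "\<exists>x\<in>X. \<phi> 2 x \<noteq> x"
proof (rule ccontr)
  assume "\<not> ?thesis"
  then have eq: "\<phi> 2 x = \<phi> 1 x" if "x \<in> X" for x using that action_one by simp
  have "\<phi> t \<in> extensional X" if "t \<in> carrier Gm" for t
    using group_hom.hom_closed[OF group_action.group_hom[OF group_action_Gm] that]
    by (simp add: BijGroup_def Bij_def)
  then have "\<phi> 2 = \<phi> 1" by (intro extensionalityI[of _ X]) (auto simp: eq Gm_def)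
  then have "(2::'k) = 1"
    by (rule inj_onD[OF faithful_action.faithful[OF assms]]) (simp_all add: Gm_def)
  then show False by simp
qed

lemma exists_nonzero_weight:
  assumes "faithful_action Gm X \<phi>"
  shows "\<exists>k f. k \<noteq> 0 \<and> homogeneous k f \<and> f \<notin> vanishing_ideal X"
proof (rule ccontr)
  assume none: "\<not> ?thesis"
  obtain x where x: "x \<in> X" "\<phi> 2 x \<noteq> x" using nontrivial_action[OF assms] by blast
  then obtain j where j: "\<phi> 2 x j \<noteq> x j" by blast
  obtain c S where c: "finite S" "\<forall>k. homogeneous k (c k)" "\<forall>k. k \<notin> S \<longrightarrow> c k = (\<lambda>_. 0)"
    "\<forall>x\<in>X. x j = (\<Sum>k\<in>S. c k x)"
    using homogeneous_decomposition[OF polynomial_coord[of j]] by blast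
  have "c k x = 0" if "k \<noteq> 0" "x \<in> X" for k x
    using none c(2) that vanishing_idealD by blast
  then have "(\<Sum>k\<in>S. c k x) = (\<Sum>k\<in>S. if k = 0 then c 0 x else 0)" if "x \<in> X" for x
    using that by (intro sum.cong) auto
  then have c0: "x j = c 0 x" if "x \<in> X" for x
    using c(1,3,4) that by (cases "0 \<in> S") (auto simp: sum.delta)
  have "\<phi> 2 x j = c 0 (\<phi> 2 x)" using c0 in_variety[of 2 x] x(1) by simp
  also have "\<dots> = c 0 x" using homogeneousD[of 0 "c 0" 2 x] c(2) x(1) by simp
  finally show False using j c0[OF x(1)] by simp
qed

end

section \<open>From a fixed prime divisor to a compatible action\<close>

lemma sum_int_shift:
  fixes g :: "int \<Rightarrow> 'b::comm_monoid_add"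
  assumes "finite U" "(\<lambda>k. k + i) ` S \<subseteq> U" "\<And>k. k \<notin> S \<Longrightarrow> g k = 0"
  shows "(\<Sum>l\<in>U. g (l - i)) = (\<Sum>k\<in>S. g k)"
proof -
  have "(\<Sum>l\<in>U. g (l - i)) = (\<Sum>l\<in>(\<lambda>k. k + i) ` S. g (l - i))"
  proof (rule sum.mono_neutral_right[OF assms(1,2)], rule ballI)
    fix l assume "l \<in> U - (\<lambda>k. k + i) ` S"
    then have "l - i \<notin> S" by force
    then show "g (l - i) = 0" by (rule assms(3))
  qed
  also have "\<dots> = (\<Sum>k\<in>S. g k)" by (subst sum.reindex) (auto simp: inj_on_def)
  finally show ?thesis .
qed

context Gm_variety
begin

lemma not_vanishing_mult:
  assumes "f \<in> polynomial_funs" "f \<notin> vanishing_ideal X" "g \<in> polynomial_funs" "g \<notin> vanishing_ideal X"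
  shows "(\<lambda>x. f x * g x) \<notin> vanishing_ideal X"
  by (rule prime_mult_notin[OF prime_X assms])

text \<open>Components of nonzero weight vanish on \<open>D\<close>, so the weight zero component of a function that does
  not vanish on \<open>D\<close> does not either. In \<open>q f = \<tau> ^ n p\<close> both \<open>q\<close> and \<open>p\<close> are such functions. If the
  weights of \<open>f\<close> and \<open>\<tau> ^ n\<close> were different, their weight zero components would be paired with
  components of nonzero weight and their product would vanish on \<open>D\<close>.\<close>

lemma fixed_divisor_uniformizer:
  assumes normal: "normal_affine_variety X" and faithful: "faithful_action Gm X \<phi>"
    and D: "prime_divisor X D" and fixed: "\<forall>x\<in>D. \<forall>t\<in>carrier Gm. \<phi> t x = x"
  shows "\<exists>\<tau> m. homogeneous m \<tau> \<and> m \<noteq> 0 \<and> \<tau> \<notin> vanishing_ideal X \<and>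
    (\<forall>i f. homogeneous i f \<longrightarrow> f \<notin> vanishing_ideal X \<longrightarrow>
      (\<exists>n q p. q \<in> invariant_funs \<and> q \<notin> vanishing_ideal X \<and> p \<in> invariant_funs \<and>
        (\<forall>x\<in>X. q x * f x = \<tau> x ^ n * p x)))"
proof -
  define P where "P = vanishing_ideal D"
  have D': "affine_variety D" "D \<subset> X" using D prime_divisor_iff[OF X] by blast+
  have P: "prime_fun_ideal polynomial_funs P" unfolding P_def by (rule affine_variety_prime[OF D'(1)])
  note Pid = prime_fun_ideal_fun_ideal[OF P]
  have NP: "vanishing_ideal X \<subseteq> P" unfolding P_def using D'(2) by (intro vanishing_ideal_antimono) auto
  have fixed: "\<phi> t x = x" if "x \<in> D" "t \<noteq> 0" for t x using fixed that by (simp add: Gm_def)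
  have weight_P: "f \<in> P" if f: "homogeneous k f" and k: "k \<noteq> 0" for k f
    unfolding P_def
  proof (rule vanishing_idealI[OF homogeneous_polynomial[OF f]])
    fix x assume x: "x \<in> D"
    then have "x \<in> X" using D'(2) by blast
    then have "f (\<phi> 2 x) = 2 powi k * f x" using homogeneousD[OF f, of 2 x] by simp
    then have "f x = 2 powi k * f x" using fixed[OF x] by simp
    then show "f x = 0" using two_power_int_neq_one[OF k, where 'k = 'k] by simp
  qed
  define H where "H = {f \<in> P. \<exists>k. homogeneous k f}"
  have "\<exists>\<tau>\<in>H. \<forall>f\<in>polynomial_funs. f \<notin> vanishing_ideal X \<longrightarrow>
    (\<exists>n q p. q \<in> polynomial_funs - vanishing_ideal D \<and> p \<in> polynomial_funs - vanishing_ideal D \<and>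
      (\<forall>x\<in>X. q x * f x = \<tau> x ^ n * p x))"
  proof (rule exists_uniformizer[OF normal D])
    show "H \<subseteq> vanishing_ideal D" unfolding H_def P_def by blast
    fix E assume E: "fun_ideal polynomial_funs E" and XE: "vanishing_ideal X \<subseteq> E" and HE: "H \<subseteq> E"
    show "vanishing_ideal D \<subseteq> E"
    proof
      fix p assume p: "p \<in> vanishing_ideal D"
      note pR = vanishing_ideal_polynomial[OF p]
      obtain c S where c: "finite S" "\<forall>k. homogeneous k (c k)" "\<forall>k. k \<notin> S \<longrightarrow> c k = (\<lambda>_. 0)"
        "\<forall>x\<in>X. p x = (\<Sum>k\<in>S. c k x)"
        using homogeneous_decomposition[OF pR] by blast
      have cP: "c k \<in> P" if "k \<noteq> 0" for k using weight_P c(2) that by blast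
      have "c 0 \<in> P" unfolding P_def
      proof (rule vanishing_idealI[OF homogeneous_polynomial[OF c(2)[rule_format]]])
        fix x assume x: "x \<in> D"
        have "(\<Sum>k\<in>S. c k x) = (\<Sum>k\<in>S. if k = 0 then c 0 x else 0)"
          using cP x vanishing_idealD unfolding P_def by (intro sum.cong) auto
        also have "\<dots> = c 0 x" using c(1,3) by (cases "0 \<in> S") (auto simp: sum.delta)
        finally have "p x = c 0 x" using c(4) x D'(2) by auto
        then show "c 0 x = 0" using vanishing_idealD[OF p x] by simp
      qed
      then have "c k \<in> E" for k using HE cP c(2) unfolding H_def by (cases "k = 0") auto
      then have sum: "(\<lambda>x. \<Sum>k\<in>S. c k x) \<in> E" by (intro fun_ideal_sum[OF E])
      have "(\<lambda>x. p x - (\<Sum>k\<in>S. c k x)) \<in> vanishing_ideal X"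
        by (rule vanishing_idealI)
           (use c(2,4) pR homogeneous_polynomial in \<open>auto intro!: polynomial_closed\<close>)
      then have "(\<lambda>x. (p x - (\<Sum>k\<in>S. c k x)) + (\<Sum>k\<in>S. c k x)) \<in> E"
        using XE by (intro fun_ideal_add[OF E _ sum]) blast
      then show "p \<in> E" by simp
    qed
  qed
  then obtain \<tau> where \<tau>: "\<tau> \<in> H" and \<tau>_div: "\<And>f. f \<in> polynomial_funs \<Longrightarrow> f \<notin> vanishing_ideal X \<Longrightarrow>
    \<exists>n q p. q \<in> polynomial_funs - P \<and> p \<in> polynomial_funs - P \<and> (\<forall>x\<in>X. q x * f x = \<tau> x ^ n * p x)"
    unfolding P_def by blast
  obtain m where m: "homogeneous m \<tau>" using \<tau> unfolding H_def by blast
  have key: "\<exists>n q p. i = int n * m \<and> q \<in> invariant_funs \<and> q \<notin> vanishing_ideal X \<and> p \<in> invariant_funs \<and>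
      (\<forall>x\<in>X. q x * f x = \<tau> x ^ n * p x)"
    if f: "homogeneous i f" "f \<notin> vanishing_ideal X" for i f
  proof -
    note fR = homogeneous_polynomial[OF f(1)]
    obtain n q p where q: "q \<in> polynomial_funs" "q \<notin> P" and p: "p \<in> polynomial_funs" "p \<notin> P"
      and eq: "\<forall>x\<in>X. q x * f x = \<tau> x ^ n * p x"
      using \<tau>_div[OF fR f(2)] by blast
    obtain c S where c: "finite S" "\<forall>k. homogeneous k (c k)" "\<forall>k. k \<notin> S \<longrightarrow> c k = (\<lambda>_. 0)"
      "\<forall>x\<in>X. q x = (\<Sum>k\<in>S. c k x)"
      using homogeneous_decomposition[OF q(1)] by blast
    obtain e T where e: "finite T" "\<forall>k. homogeneous k (e k)" "\<forall>k. k \<notin> T \<longrightarrow> e k = (\<lambda>_. 0)"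
      "\<forall>x\<in>X. p x = (\<Sum>k\<in>T. e k x)"
      using homogeneous_decomposition[OF p(1)] by blast
    \<comment> \<open>Only the component of weight zero can lie outside \<open>P\<close>.\<close>
    have zero_part: "g0 0 \<notin> P"
      if g: "g \<in> polynomial_funs" "g \<notin> P" "finite V" "\<forall>k. homogeneous k (g0 k)"
        "\<forall>x\<in>X. g x = (\<Sum>k\<in>V. g0 k x)" for g g0 V
    proof
      assume "g0 0 \<in> P"
      then have "g0 k \<in> P" for k using weight_P g(4) by (cases "k = 0") auto
      then have "(\<lambda>x. \<Sum>k\<in>V. g0 k x) \<in> P" by (intro fun_ideal_sum[OF Pid])
      then have "g \<in> P" unfolding P_def
        using g(1,5) D'(2) by (auto simp: vanishing_ideal_def)
      then show False using g(2) by blast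
    qed
    have c0: "c 0 \<notin> P" by (rule zero_part[OF q c(1,2,4)])
    have e0: "e 0 \<notin> P" by (rule zero_part[OF p e(1,2,4)])
    define U where "U = (\<lambda>k. k + i) ` S \<union> (\<lambda>k. k + int n * m) ` T \<union> {i, int n * m}"
    have U: "finite U" "(\<lambda>k. k + i) ` S \<subseteq> U" "(\<lambda>k. k + int n * m) ` T \<subseteq> U" "i \<in> U" "int n * m \<in> U"
      using c(1) e(1) by (auto simp: U_def)
    have compare: "c (l - i) x * f x = \<tau> x ^ n * e (l - int n * m) x" if l: "l \<in> U" and x: "x \<in> X" for l x
    proof -
      have hom: "homogeneous l (\<lambda>x. c (l - i) x * f x - \<tau> x ^ n * e (l - int n * m) x)" for l
      proof (rule homogeneous_diff)
        show "homogeneous l (\<lambda>x. c (l - i) x * f x)"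
          using homogeneous_mult[OF c(2)[rule_format, of "l - i"] f(1)] by simp
        show "homogeneous l (\<lambda>x. \<tau> x ^ n * e (l - int n * m) x)"
          using homogeneous_mult[OF homogeneous_power[OF m, of n] e(2)[rule_format, of "l - int n * m"]]
          by simp
      qed
      have "c (l - i) x * f x - \<tau> x ^ n * e (l - int n * m) x = 0"
      proof (rule homogeneous_unique[OF U(1) hom _ l x])
        fix x assume x: "x \<in> X"
        have "(\<Sum>l\<in>U. c (l - i) x * f x - \<tau> x ^ n * e (l - int n * m) x) =
            (\<Sum>l\<in>U. c (l - i) x) * f x - \<tau> x ^ n * (\<Sum>l\<in>U. e (l - int n * m) x)"
          by (simp add: sum_subtractf sum_distrib_left sum_distrib_right)
        also have "(\<Sum>l\<in>U. c (l - i) x) = q x"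
          using sum_int_shift[OF U(1,2), of "\<lambda>k. c k x"] c(3,4) x by simp
        also have "(\<Sum>l\<in>U. e (l - int n * m) x) = p x"
          using sum_int_shift[OF U(1,3), of "\<lambda>k. e k x"] e(3,4) x by simp
        finally show "(\<Sum>l\<in>U. c (l - i) x * f x - \<tau> x ^ n * e (l - int n * m) x) = 0"
          using eq x by simp
      qed
      then show ?thesis by simp
    qed
    have i: "i = int n * m"
    proof (rule ccontr)
      assume ne: "i \<noteq> int n * m"
      let ?c = "c (int n * m - i)" and ?e = "e (i - int n * m)"
      have cR: "c k \<in> polynomial_funs" and eR: "e k \<in> polynomial_funs" for k
        using c(2) e(2) homogeneous_polynomial by blast+
      have "f x * (c 0 x * e 0 x) = f x * (?c x * ?e x)" if x: "x \<in> X" for x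
      proof -
        have 1: "c 0 x * f x = \<tau> x ^ n * ?e x" using compare[OF U(4) x] by simp
        have 2: "?c x * f x = \<tau> x ^ n * e 0 x" using compare[OF U(5) x] by simp
        have "f x * (c 0 x * e 0 x) = ?e x * (\<tau> x ^ n * e 0 x)" using 1 by (simp add: mult_ac)
        also have "\<dots> = f x * (?c x * ?e x)" unfolding 2[symmetric] by (simp add: mult_ac)
        finally show ?thesis .
      qed
      then have *: "c 0 x * e 0 x = ?c x * ?e x" if "x \<in> X" for x
        using variety_cancel[OF X fR f(2), of "\<lambda>x. c 0 x * e 0 x" "\<lambda>x. ?c x * ?e x" x]
          that polynomial_closed(3)[OF cR eR] by blast
      have "?c \<in> P" using weight_P[OF c(2)[rule_format], of "int n * m - i"] ne by simp
      then have "(\<lambda>x. ?c x * ?e x) \<in> P" by (rule fun_ideal_mult_right[OF Pid _ eR])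
      then have zero: "?c x * ?e x = 0" if "x \<in> D" for x
        using that unfolding P_def by (rule vanishing_idealD)
      have "(\<lambda>x. c 0 x * e 0 x) \<in> P" unfolding P_def
      proof (rule vanishing_idealI)
        show "(\<lambda>x. c 0 x * e 0 x) \<in> polynomial_funs" by (rule polynomial_closed(3)[OF cR eR])
        fix x assume x: "x \<in> D"
        then have "x \<in> X" using D'(2) by blast
        then show "c 0 x * e 0 x = 0" using * zero[OF x] by simp
      qed
      then show False using prime_mult_notin[OF P cR c0 eR e0] by blast
    qed
    have "\<forall>x\<in>X. c 0 x * f x = \<tau> x ^ n * e 0 x" using compare[OF U(4)] i by simp
    moreover have "c 0 \<notin> vanishing_ideal X" using c0 NP by blast
    ultimately show ?thesis
      using i c(2) e(2) by (intro exI[of _ n] exI[of _ "c 0"] exI[of _ "e 0"]) (simp add: invariant_funs_def)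
  qed
  obtain k f where f: "k \<noteq> 0" "homogeneous k f" "f \<notin> vanishing_ideal X"
    using exists_nonzero_weight[OF faithful] by blast
  obtain n q p where n: "k = int n * m" "q \<in> invariant_funs" "q \<notin> vanishing_ideal X"
    "\<forall>x\<in>X. q x * f x = \<tau> x ^ n * p x"
    using key[OF f(2,3)] by blast
  have "m \<noteq> 0" using n(1) f(1) by auto
  moreover have "\<tau> \<notin> vanishing_ideal X"
  proof
    assume \<tau>0: "\<tau> \<in> vanishing_ideal X"
    have "n \<noteq> 0" using n(1) f(1) by auto
    have "(\<lambda>x. q x * f x) \<in> vanishing_ideal X"
    proof (rule vanishing_idealI)
      show "(\<lambda>x. q x * f x) \<in> polynomial_funs"
        by (intro polynomial_closed(3) invariant_funs_polynomial[OF n(2)] homogeneous_polynomial[OF f(2)])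
      fix x assume "x \<in> X"
      then show "q x * f x = 0" using n(4) vanishing_idealD[OF \<tau>0] \<open>n \<noteq> 0\<close> by simp
    qed
    then show False
      using not_vanishing_mult[OF invariant_funs_polynomial[OF n(2)] n(3) homogeneous_polynomial[OF f(2)] f(3)]
      by blast
  qed
  ultimately show ?thesis using m key by blast
qed

text \<open>The coordinates are sums of homogeneous functions. Only finitely many summands occur altogether,
  so that the product of their denominators can be taken.\<close>

lemma common_denominator:
  assumes "\<And>i f. homogeneous i f \<Longrightarrow> f \<notin> vanishing_ideal X \<Longrightarrow>
      \<exists>n q p. q \<in> invariant_funs \<and> q \<notin> vanishing_ideal X \<and> p \<in> invariant_funs \<and>
        (\<forall>x\<in>X. q x * f x = \<tau> x ^ n * p x)"
  shows "\<exists>q\<in>invariant_funs. q \<notin> vanishing_ideal X \<and>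
    (\<forall>j. \<exists>e\<in>adjoin invariant_funs \<tau>. \<forall>x\<in>X. q x * x j = e x)"
proof -
  define good where "good = (\<lambda>f. \<exists>q e. q \<in> invariant_funs \<and> q \<notin> vanishing_ideal X \<and>
    e \<in> adjoin invariant_funs \<tau> \<and> (\<forall>x\<in>X. q x * f x = e x))"
  note closed = subalgebra_closed[OF subalgebra_invariant_funs]
    and aclosed = subalgebra_closed[OF subalgebra_adjoin[OF subalgebra_invariant_funs]]
  have inv_adj: "p \<in> adjoin invariant_funs \<tau>" if "p \<in> invariant_funs" for p
    using subset_adjoin[OF subalgebra_invariant_funs] that by blast
  have one: "(\<lambda>_. 1) \<in> invariant_funs" "(\<lambda>_. 1) \<notin> vanishing_ideal X"
    using closed(1) prime_fun_ideal_one[OF prime_X] by auto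
  have notin: "(\<lambda>x. p x * q x) \<notin> vanishing_ideal X"
    if "p \<in> invariant_funs" "p \<notin> vanishing_ideal X" "q \<in> invariant_funs" "q \<notin> vanishing_ideal X" for p q
    using that by (intro not_vanishing_mult invariant_funs_polynomial)
  have goodI: "good f" if "q \<in> invariant_funs" "q \<notin> vanishing_ideal X" "e \<in> adjoin invariant_funs \<tau>"
      "\<And>x. x \<in> X \<Longrightarrow> q x * f x = e x" for q e f
    unfolding good_def using that by blast
  have good_hom: "good f" if f: "homogeneous i f" for i f
  proof (cases "f \<in> vanishing_ideal X")
    case True
    show ?thesis by (rule goodI[OF one aclosed(1)[of 0]]) (use vanishing_idealD[OF True] in simp)
  next
    case False
    then obtain n q p where *: "q \<in> invariant_funs" "q \<notin> vanishing_ideal X" "p \<in> invariant_funs"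
      "\<forall>x\<in>X. q x * f x = \<tau> x ^ n * p x"
      using assms[OF f] by blast
    have "(\<lambda>x. \<tau> x ^ n * p x) \<in> adjoin invariant_funs \<tau>"
      by (intro aclosed adjoin_generator subalgebra_invariant_funs inv_adj *)
    then show ?thesis by (rule goodI[OF *(1,2)]) (use *(4) in simp)
  qed
  have good_add: "good (\<lambda>x. f x + g x)" if "good f" "good g" for f g
  proof -
    obtain q e where 1: "q \<in> invariant_funs" "q \<notin> vanishing_ideal X" "e \<in> adjoin invariant_funs \<tau>"
      "\<forall>x\<in>X. q x * f x = e x"
      using \<open>good f\<close> unfolding good_def by blast
    obtain q' e' where 2: "q' \<in> invariant_funs" "q' \<notin> vanishing_ideal X" "e' \<in> adjoin invariant_funs \<tau>"
      "\<forall>x\<in>X. q' x * g x = e' x"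
      using \<open>good g\<close> unfolding good_def by blast
    show ?thesis
    proof (rule goodI[OF closed(3)[OF 1(1) 2(1)] notin[OF 1(1,2) 2(1,2)]])
      show "(\<lambda>x. q' x * e x + q x * e' x) \<in> adjoin invariant_funs \<tau>"
        by (intro aclosed inv_adj 1 2)
      show "q x * q' x * (f x + g x) = q' x * e x + q x * e' x" if "x \<in> X" for x
        using 1(4)[rule_format, OF that, symmetric] 2(4)[rule_format, OF that, symmetric]
        by (simp add: algebra_simps)
    qed
  qed
  have good_sum: "good (\<lambda>x. \<Sum>k\<in>S. c k x)" if "finite S" "\<forall>k. homogeneous k (c k)" for S c
    using that(1)
  proof induction
    case empty
    show ?case by (rule goodI[OF one aclosed(1)[of 0]]) simp
  next
    case (insert k S)
    then show ?case using good_add[OF good_hom[of k "c k"] insert(3)] that(2) by simp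
  qed
  have good_coord: "good (\<lambda>x. x j)" for j
  proof -
    obtain c S where c: "finite S" "\<forall>k. homogeneous k (c k)" "\<forall>x\<in>X. x j = (\<Sum>k\<in>S. c k x)"
      using homogeneous_decomposition[OF polynomial_coord[of j]] by blast
    then show ?thesis using good_sum[OF c(1,2)] unfolding good_def by auto
  qed
  have "\<exists>q\<in>invariant_funs. q \<notin> vanishing_ideal X \<and>
      (\<forall>j\<in>J. \<exists>e\<in>adjoin invariant_funs \<tau>. \<forall>x\<in>X. q x * x j = e x)" if "finite J" for J
    using that
  proof induction
    case empty
    then show ?case using one by blast
  next
    case (insert j J)
    then obtain q where q: "q \<in> invariant_funs" "q \<notin> vanishing_ideal X"
      "\<forall>j\<in>J. \<exists>e\<in>adjoin invariant_funs \<tau>. \<forall>x\<in>X. q x * x j = e x" by blast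
    obtain q' e' where q': "q' \<in> invariant_funs" "q' \<notin> vanishing_ideal X" "e' \<in> adjoin invariant_funs \<tau>"
      "\<forall>x\<in>X. q' x * x j = e' x"
      using good_coord[of j] unfolding good_def by blast
    have "\<exists>e\<in>adjoin invariant_funs \<tau>. \<forall>x\<in>X. q x * q' x * x l = e x" if l: "l \<in> insert j J" for l
    proof (cases "l = j")
      case True
      show ?thesis
      proof (rule bexI[of _ "\<lambda>x. q x * e' x"])
        show "(\<lambda>x. q x * e' x) \<in> adjoin invariant_funs \<tau>" by (rule aclosed(3)[OF inv_adj[OF q(1)] q'(3)])
        show "\<forall>x\<in>X. q x * q' x * x l = q x * e' x"
          using True q'(4)[rule_format, symmetric] by simp
      qed
    next
      case False
      then obtain e where e: "e \<in> adjoin invariant_funs \<tau>" "\<forall>x\<in>X. q x * x l = e x" using q(3) l by blast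
      have "\<forall>x\<in>X. q x * q' x * x l = q' x * e x" using e(2)[rule_format, symmetric] by simp
      then show ?thesis
        by (rule bexI[of _ "\<lambda>x. q' x * e x"]) (rule aclosed(3)[OF inv_adj[OF q'(1)] e(1)])
    qed
    then show ?case
      by (intro bexI[OF _ closed(3)[OF q(1) q'(1)]] conjI[OF notin[OF q(1,2) q'(1,2)]] ballI)
  qed
  from this[OF finite_UNIV] show ?thesis by simp
qed

end

lemma regular_fun_polynomial: "f \<in> polynomial_funs \<Longrightarrow> regular_fun X f"
  by (auto simp: regular_fun_def)

lemma morphism_eqI:
  assumes X: "affine_variety X" and f: "morphism X Y f" and g: "morphism X Z g"
    and p: "p \<in> polynomial_funs" "p \<notin> vanishing_ideal X"
    and eq: "\<And>x. x \<in> X \<Longrightarrow> p x \<noteq> 0 \<Longrightarrow> f x = g x" and x: "x \<in> X"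
  shows "f x = g x"
proof
  fix j
  obtain u where u: "u \<in> polynomial_funs" "\<forall>x\<in>X. f x j = u x"
    using f unfolding morphism_def regular_fun_def by blast
  obtain v where v: "v \<in> polynomial_funs" "\<forall>x\<in>X. g x j = v x"
    using g unfolding morphism_def regular_fun_def by blast
  have "u x - v x = 0"
  proof (rule vanishes_if_vanishes_on_basic[OF X p(1) _ polynomial_closed(5)[OF u(1) v(1)] _ x])
    show "\<exists>x\<in>X. p x \<noteq> 0" using p by (auto simp: vanishing_ideal_def)
    show "u x - v x = 0" if "x \<in> X" "p x \<noteq> 0" for x using eq[OF that] u(2) v(2) that by auto
  qed
  then show "f x j = g x j" using u(2) v(2) x by simp
qed

lemma Aut_mult:
  assumes "f \<in> carrier (Aut X)" "g \<in> carrier (Aut X)"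
  shows "f \<otimes>\<^bsub>Aut X\<^esub> g = compose X f g"
  using assms by (simp add: Aut_def BijGroup_def)

lemma (in group) mem_normalizerI:
  assumes H: "H \<subseteq> carrier G" and g: "g \<in> carrier G"
    and 1: "\<And>h. h \<in> H \<Longrightarrow> \<exists>h'\<in>H. g \<otimes> h = h' \<otimes> g"
    and 2: "\<And>h. h \<in> H \<Longrightarrow> \<exists>h'\<in>H. g \<otimes> h' = h \<otimes> g"
  shows "g \<in> normalizer G H"
proof -
  have "g <# H #> inv g = H"
  proof
    show "g <# H #> inv g \<subseteq> H"
    proof
      fix x assume "x \<in> g <# H #> inv g"
      then obtain h where h: "h \<in> H" "x = g \<otimes> h \<otimes> inv g" by (auto simp: l_coset_def r_coset_def)
      obtain h' where h': "h' \<in> H" "g \<otimes> h = h' \<otimes> g" using 1[OF h(1)] by blast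
      then have "x = h'" using h(2) H g by (simp add: m_assoc subset_iff)
      then show "x \<in> H" using h' by simp
    qed
    show "H \<subseteq> g <# H #> inv g"
    proof
      fix h assume h: "h \<in> H"
      obtain h' where h': "h' \<in> H" "g \<otimes> h' = h \<otimes> g" using 2[OF h] by blast
      have "g \<otimes> h' \<otimes> inv g = h" unfolding h'(2) using h H g by (simp add: m_assoc subset_iff)
      then show "h \<in> g <# H #> inv g" using h'(1) by (force simp: l_coset_def r_coset_def)
    qed
  qed
  then show ?thesis using g H by (simp add: normalizer_def stabilizer_def)
qed

text \<open>Here \<open>q\<close> and the \<open>a j i\<close> have weight zero, so on the orbit of a general point they are
  constant and the coordinates are polynomials in \<open>\<tau>\<close>.\<close>

locale uniformized_Gm_variety = Gm_variety X \<phi>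
  for X :: "('n::finite \<Rightarrow> 'k::{alg_closed_field, field_char_0}) set" and \<phi> +
  fixes \<tau> q :: "('n \<Rightarrow> 'k) \<Rightarrow> 'k" and m :: int
    and a :: "'n \<Rightarrow> nat \<Rightarrow> ('n \<Rightarrow> 'k) \<Rightarrow> 'k" and d :: "'n \<Rightarrow> nat"
  assumes \<tau>: "homogeneous m \<tau>" "\<tau> \<notin> vanishing_ideal X" and m: "m \<noteq> 0"
    and q: "q \<in> invariant_funs" "q \<notin> vanishing_ideal X"
    and a: "\<And>j i. a j i \<in> invariant_funs"
    and coord: "\<And>x j. x \<in> X \<Longrightarrow> q x * x j = (\<Sum>i\<le>d j. a j i x * \<tau> x ^ i)"
begin

text \<open>Wherever \<open>q\<close> does not vanish, this replaces \<open>\<tau>\<close> by \<open>\<tau> + u q\<close> in the expressions for the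
  coordinates. The formula is the result of dividing \<open>(\<tau> + u q) ^ i - \<tau> ^ i\<close> by \<open>q\<close>.\<close>

definition shift :: "'k \<Rightarrow> ('n \<Rightarrow> 'k) \<Rightarrow> ('n \<Rightarrow> 'k)" where
  "shift u x j = x j + u * (\<Sum>i\<le>d j. a j i x * (\<Sum>l<i. \<tau> x ^ (i - Suc l) * (\<tau> x + u * q x) ^ l))"

text \<open>The curve obtained from the coordinates of \<open>x\<close> by letting the value \<open>\<sigma>\<close> of \<open>\<tau>\<close> vary.\<close>

definition orbit_line :: "('n \<Rightarrow> 'k) \<Rightarrow> 'k \<Rightarrow> ('n \<Rightarrow> 'k)" where
  "orbit_line x \<sigma> j = (\<Sum>i\<le>d j. a j i x * \<sigma> ^ i) / q x"

definition \<psi> :: "'k \<Rightarrow> ('n \<Rightarrow> 'k) \<Rightarrow> ('n \<Rightarrow> 'k)" where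
  "\<psi> u = restrict (shift u) X"

lemma orbit_line_\<tau>: "x \<in> X \<Longrightarrow> q x \<noteq> 0 \<Longrightarrow> orbit_line x (\<tau> x) = x"
  by (rule ext) (simp add: orbit_line_def coord[symmetric])

lemma shift_eq_orbit_line:
  assumes "x \<in> X" "q x \<noteq> 0"
  shows "shift u x = orbit_line x (\<tau> x + u * q x)"
proof
  fix j
  have "q x * shift u x j = (\<Sum>i\<le>d j. a j i x * \<tau> x ^ i) +
      (\<Sum>i\<le>d j. a j i x * (u * q x * (\<Sum>l<i. \<tau> x ^ (i - Suc l) * (\<tau> x + u * q x) ^ l)))"
    unfolding shift_def using coord[OF assms(1), of j]
    by (simp add: distrib_left sum_distrib_left mult_ac)
  also have "\<dots> = (\<Sum>i\<le>d j. a j i x * (\<tau> x + u * q x) ^ i)"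
    unfolding sum.distrib[symmetric]
  proof (rule sum.cong[OF refl])
    fix i
    have "(\<tau> x + u * q x) ^ i - \<tau> x ^ i = u * q x * (\<Sum>l<i. \<tau> x ^ (i - Suc l) * (\<tau> x + u * q x) ^ l)"
      using power_diff_sumr2[of "\<tau> x + u * q x" i "\<tau> x"] by simp
    then show "a j i x * \<tau> x ^ i + a j i x * (u * q x * (\<Sum>l<i. \<tau> x ^ (i - Suc l) * (\<tau> x + u * q x) ^ l)) =
        a j i x * (\<tau> x + u * q x) ^ i"
      by (metis add_diff_cancel_left' add.commute diff_add_cancel distrib_left)
  qed
  finally show "shift u x j = orbit_line x (\<tau> x + u * q x) j"
    using assms(2) by (simp add: orbit_line_def field_simps)
qed

lemma orbit_line_action:
  assumes "t \<noteq> 0" "x \<in> X"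
  shows "orbit_line (\<phi> t x) = orbit_line x"
  using assms a q by (intro ext) (simp add: orbit_line_def invariant_funs_iff)

lemma q_action: "t \<noteq> 0 \<Longrightarrow> x \<in> X \<Longrightarrow> q (\<phi> t x) = q x"
  using q(1) by (simp add: invariant_funs_iff)

lemma action_eq_orbit_line:
  assumes "t \<noteq> 0" "x \<in> X" "q x \<noteq> 0"
  shows "\<phi> t x = orbit_line x (t powi m * \<tau> x)"
  using orbit_line_\<tau>[OF in_variety[OF assms(1,2)]] assms homogeneousD[OF \<tau>(1) assms(1,2)]
  by (simp add: q_action orbit_line_action)

lemma exists_root:
  assumes "\<sigma> \<noteq> 0"
  shows "\<exists>t. t \<noteq> 0 \<and> t powi m = (\<sigma>::'k)"
proof (cases "m > 0")
  case True
  then obtain t where "t ^ nat m = \<sigma>" using nth_root_exists[of "nat m" \<sigma>] by auto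
  then show ?thesis using True assms by (intro exI[of _ t]) (auto simp: power_int_def)
next
  case False
  then obtain t where "t ^ nat (- m) = inverse \<sigma>"
    using nth_root_exists[of "nat (- m)" "inverse \<sigma>"] m by auto
  moreover from this have "t \<noteq> 0" using False m assms by (auto simp: power_0_left)
  ultimately show ?thesis using False assms m
    by (intro exI[of _ t]) (auto simp: power_int_def power_inverse)
qed

lemma orbit_line_in_orbit:
  assumes "x \<in> X" "q x \<noteq> 0" "\<tau> x \<noteq> 0" "\<sigma> \<noteq> 0"
  shows "\<exists>t. t \<noteq> 0 \<and> t powi m * \<tau> x = \<sigma> \<and> orbit_line x \<sigma> = \<phi> t x"
proof -
  obtain t where t: "t \<noteq> 0" "t powi m = \<sigma> / \<tau> x" using exists_root[of "\<sigma> / \<tau> x"] assms by auto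
  then show ?thesis using action_eq_orbit_line[OF t(1) assms(1,2)] assms(3) by auto
qed

text \<open>A general point is moved within its torus orbit. All properties of \<open>shift\<close> are identities between
  regular maps, which hold everywhere once they hold at such points.\<close>

lemma shift_generic:
  assumes "x \<in> X" "q x * \<tau> x * (\<tau> x + u * q x) \<noteq> 0"
  shows "\<exists>t. t \<noteq> 0 \<and> t powi m * \<tau> x = \<tau> x + u * q x \<and> shift u x = \<phi> t x"
  using orbit_line_in_orbit[of x "\<tau> x + u * q x"] shift_eq_orbit_line[of x u] assms by auto

lemma \<tau>_polynomial: "\<tau> \<in> polynomial_funs"
  by (rule homogeneous_polynomial[OF \<tau>(1)])

lemma q_polynomial: "q \<in> polynomial_funs"
  by (rule invariant_funs_polynomial[OF q(1)])

lemma generic_polynomial: "(\<lambda>x. q x * \<tau> x * (\<tau> x + u * q x)) \<in> polynomial_funs"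
  by (intro polynomial_closed \<tau>_polynomial q_polynomial)

lemma generic_not_vanishing: "(\<lambda>x. q x * \<tau> x * (\<tau> x + u * q x)) \<notin> vanishing_ideal X"
proof -
  have "(\<lambda>x. \<tau> x + u * q x) \<notin> vanishing_ideal X"
  proof
    assume *: "(\<lambda>x. \<tau> x + u * q x) \<in> vanishing_ideal X"
    obtain x where x: "x \<in> X" "\<tau> x \<noteq> 0" using \<tau> \<tau>_polynomial by (auto simp: vanishing_ideal_def)
    have "\<tau> x + u * q x = 0" by (rule vanishing_idealD[OF * x(1)])
    moreover have "2 powi m * \<tau> x + u * q x = 0"
      using vanishing_idealD[OF * in_variety[of 2 x]] x(1) homogeneousD[OF \<tau>(1), of 2 x] q_action[of 2 x]
      by simp
    ultimately have "2 powi m * \<tau> x + u * q x = \<tau> x + u * q x" by simp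
    then have "2 powi m * \<tau> x = \<tau> x" by (simp only: add_right_cancel)
    then show False using x(2) two_power_int_neq_one[OF m, where 'k = 'k] by simp
  qed
  then show ?thesis
    by (intro not_vanishing_mult polynomial_closed \<tau>_polynomial q_polynomial \<tau> q)
qed

lemma shift_polynomial: "(\<lambda>x. shift u x j) \<in> polynomial_funs"
  unfolding shift_def
  by (intro polynomial_closed polynomial_coord \<tau>_polynomial q_polynomial invariant_funs_polynomial a)

lemma shift_in_variety:
  assumes x: "x \<in> X"
  shows "shift u x \<in> X"
proof (rule closedin_zariski_vanishing)
  show "closedin zariski X" using X by (simp add: affine_variety_def)
  fix p assume p: "p \<in> vanishing_ideal X"
  show "p (shift u x) = 0"
  proof (rule vanishes_if_vanishes_on_basic[OF X generic_polynomial, of u "\<lambda>x. p (shift u x)"])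
    show "\<exists>x\<in>X. q x * \<tau> x * (\<tau> x + u * q x) \<noteq> 0"
      using generic_not_vanishing[of u] generic_polynomial[of u] by (auto simp: vanishing_ideal_def)
    show "(\<lambda>x. p (shift u x)) \<in> polynomial_funs"
      by (rule polynomial_funs_compose[OF vanishing_ideal_polynomial[OF p] shift_polynomial])
    show "p (shift u x) = 0" if "x \<in> X" "q x * \<tau> x * (\<tau> x + u * q x) \<noteq> 0" for x
      using shift_generic[OF that] vanishing_idealD[OF p in_variety] that(1) by auto
  qed (rule x)
qed

lemma shift_morphism: "morphism X X (shift u)"
  using shift_in_variety shift_polynomial by (auto simp: morphism_def regular_fun_polynomial)

lemma shift_shift:
  assumes x: "x \<in> X"
  shows "shift u (shift v x) = shift (u + v) x"
proof (rule morphism_eqI[OF X morphism_compose[OF shift_morphism shift_morphism] shift_morphism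
      generic_polynomial[of v] generic_not_vanishing[of v] _ x])
  fix x assume x: "x \<in> X" and gen: "q x * \<tau> x * (\<tau> x + v * q x) \<noteq> 0"
  obtain t where t: "t \<noteq> 0" "t powi m * \<tau> x = \<tau> x + v * q x" "shift v x = \<phi> t x"
    using shift_generic[OF x gen] by blast
  have "shift u (\<phi> t x) = orbit_line x (t powi m * \<tau> x + u * q x)"
    using shift_eq_orbit_line[OF in_variety[OF t(1) x], of u] gen
    by (simp add: q_action orbit_line_action homogeneousD[OF \<tau>(1)] t(1) x)
  moreover have "q x \<noteq> 0" using gen by auto
  ultimately show "shift u (shift v x) = shift (u + v) x"
    using shift_eq_orbit_line[OF x, of "u + v"] t(2,3) by (simp add: algebra_simps)
qed

lemma shift_zero: "shift 0 x = x"
  by (rule ext) (simp add: shift_def)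

lemma action_shift:
  assumes t: "t \<noteq> 0" and x: "x \<in> X"
  shows "\<phi> t (shift u x) = shift (t powi m * u) (\<phi> t x)"
proof (rule morphism_eqI[OF X morphism_compose[OF shift_morphism action_morphism[OF t]]
      morphism_compose[OF action_morphism[OF t] shift_morphism]
      generic_polynomial[of u] generic_not_vanishing[of u] _ x])
  fix x assume x: "x \<in> X" and gen: "q x * \<tau> x * (\<tau> x + u * q x) \<noteq> 0"
  obtain s where s: "s \<noteq> 0" "s powi m * \<tau> x = \<tau> x + u * q x" "shift u x = \<phi> s x"
    using shift_generic[OF x gen] by blast
  have "\<phi> t (shift u x) = \<phi> (t * s) x" using s action_mult[OF t s(1) x] by simp
  also have "\<dots> = orbit_line x ((t * s) powi m * \<tau> x)"
    using action_eq_orbit_line[of "t * s" x] t s(1) gen x by simp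
  also have "(t * s) powi m * \<tau> x = t powi m * (\<tau> x + u * q x)"
    unfolding s(2)[symmetric] by (simp add: power_int_mult_distrib mult.assoc)
  also have "orbit_line x (t powi m * (\<tau> x + u * q x)) = shift (t powi m * u) (\<phi> t x)"
  proof -
    have "q (\<phi> t x) \<noteq> 0" using gen q_action[OF t x] by auto
    from shift_eq_orbit_line[OF in_variety[OF t x] this, of "t powi m * u"] show ?thesis
      by (simp add: q_action orbit_line_action homogeneousD[OF \<tau>(1)] t x distrib_left mult.assoc)
  qed
  finally show "\<phi> t (shift u x) = shift (t powi m * u) (\<phi> t x)" .
qed

lemma \<psi>_Bij: "\<psi> u \<in> Bij X"
proof -
  have "bij_betw (\<psi> u) X X"
    by (rule bij_betwI[where g = "shift (- u)"])
       (auto simp: \<psi>_def shift_in_variety shift_shift shift_zero)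
  then show ?thesis by (simp add: Bij_def \<psi>_def)
qed

lemma \<psi>_regular_action: "regular_Ga_action X \<psi>"
  unfolding regular_action_def
proof (intro conjI allI)
  have "\<psi> (u + v) = compose X (\<psi> u) (\<psi> v)" for u v
    by (rule ext) (simp add: \<psi>_def compose_def shift_shift shift_in_variety)
  then have "\<psi> \<in> hom Ga (BijGroup X)"
    by (auto simp: hom_def Ga_def BijGroup_def \<psi>_Bij)
  then show "group_action Ga X \<psi>"
    by (simp add: group_action_def group_hom_def group_hom_axioms_def group_Ga group_BijGroup)
  fix j
  have snd: "(\<lambda>z. p (snd z)) \<in> product_funs Ga_funs" if "p \<in> polynomial_funs" for p :: "('n \<Rightarrow> 'k) \<Rightarrow> 'k"
    unfolding product_funs_def using that by (intro fun_algebra.gen) (auto simp: comp_def)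
  have "(\<lambda>t. t) \<circ> fst \<in> (product_funs Ga_funs :: ('k \<times> ('n \<Rightarrow> 'k) \<Rightarrow> 'k) set)"
    unfolding product_funs_def Ga_funs_def by (intro fun_algebra.gen UnI1 imageI) simp
  then have fst: "fst \<in> (product_funs Ga_funs :: ('k \<times> ('n \<Rightarrow> 'k) \<Rightarrow> 'k) set)" by (simp add: comp_def)
  have "(\<lambda>z. shift (fst z) (snd z) j) \<in> product_funs Ga_funs"
    unfolding shift_def
    by (intro subalgebra_closed[OF subalgebra_product_funs] fst snd[OF polynomial_coord] snd[OF \<tau>_polynomial]
        snd[OF q_polynomial] snd[OF invariant_funs_polynomial[OF a]])
  then show "\<exists>p\<in>product_funs Ga_funs. \<forall>g\<in>carrier Ga. \<forall>x\<in>X. \<psi> g x j = p (g, x)"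
    by (intro bexI[of _ "\<lambda>z. shift (fst z) (snd z) j"]) (auto simp: \<psi>_def)
qed

lemma \<psi>_normalized: "\<phi> ` carrier Gm \<subseteq> normalizer (Aut X) (\<psi> ` carrier Ga)"
proof
  fix g assume "g \<in> \<phi> ` carrier Gm"
  then obtain t where t: "t \<noteq> 0" "g = \<phi> t" by (auto simp: Gm_def)
  have g: "g \<in> carrier (Aut X)" using regular_action_in_Aut[OF action, of t] t by (simp add: Gm_def)
  have \<psi>: "\<psi> u \<in> carrier (Aut X)" for u
    using regular_action_in_Aut[OF \<psi>_regular_action, of u] by (simp add: Ga_def)
  have comm: "g \<otimes>\<^bsub>Aut X\<^esub> \<psi> u = \<psi> (t powi m * u) \<otimes>\<^bsub>Aut X\<^esub> g" for u
    unfolding Aut_mult[OF g \<psi>] Aut_mult[OF \<psi> g]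
    by (rule ext) (simp add: compose_def \<psi>_def t(2) action_shift[OF t(1)] in_variety[OF t(1)])
  show "g \<in> normalizer (Aut X) (\<psi> ` carrier Ga)"
  proof (rule group.mem_normalizerI[OF group_Aut _ g])
    show "\<psi> ` carrier Ga \<subseteq> carrier (Aut X)" using \<psi> by auto
    fix h assume "h \<in> \<psi> ` carrier Ga"
    then obtain u where h: "h = \<psi> u" by blast
    show "\<exists>h'\<in>\<psi> ` carrier Ga. g \<otimes>\<^bsub>Aut X\<^esub> h = h' \<otimes>\<^bsub>Aut X\<^esub> g"
      using comm[of u] h by (auto simp: Ga_def)
    have "g \<otimes>\<^bsub>Aut X\<^esub> \<psi> (u / t powi m) = h \<otimes>\<^bsub>Aut X\<^esub> g" using comm[of "u / t powi m"] h t by simp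
    then show "\<exists>h'\<in>\<psi> ` carrier Ga. g \<otimes>\<^bsub>Aut X\<^esub> h' = h \<otimes>\<^bsub>Aut X\<^esub> g" by (auto simp: Ga_def)
  qed
qed

text \<open>Along the orbit of a general point \<open>x\<close>, \<open>q\<close> and the \<open>a j i\<close> are constant, hence also on
  its closure; a point of the closure is therefore determined by its value of \<open>\<tau>\<close>. Conversely,
  at most one parameter \<open>u\<close> leads out of the orbit, and a polynomial in \<open>u\<close> that vanishes for all
  other parameters vanishes there as well.\<close>

lemma \<psi>_orbit:
  assumes x: "x \<in> X" "q x \<noteq> 0" "\<tau> x \<noteq> 0"
  shows "orbit Ga \<psi> x = (subtopology zariski X) closure_of (orbit Gm \<phi> x)"
proof -
  have orb: "orbit Gm \<phi> x \<subseteq> X" using in_variety x(1) by (auto simp: orbit_def Gm_def)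
  note clos = closure_of_zariski[OF orb]
  show ?thesis
    unfolding clos
  proof (intro equalityI subsetI)
    fix y assume "y \<in> orbit Ga \<psi> x"
    then obtain u where u: "y = shift u x" using x(1) by (auto simp: orbit_def \<psi>_def)
    have "p y = 0" if p: "p \<in> vanishing_ideal (orbit Gm \<phi> x)" for p
    proof -
      obtain r where r: "r \<in> product_funs Ga_funs" "\<forall>g\<in>carrier Ga. \<forall>x\<in>X. p (\<psi> g x) = r (g, x)"
        using regular_action_pullback[OF \<psi>_regular_action vanishing_ideal_polynomial[OF p]] by blast
      obtain c e where c: "\<forall>v y. r (v, y) = (\<Sum>i\<le>e. c i y * v ^ i)"
        using param_polynomials_expansion[OF subsetD[OF product_funs_Ga r(1)]] by blast
      have pr: "p (shift v x) = (\<Sum>i\<le>e. c i x * v ^ i)" for v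
        using r(2) c x(1) by (simp add: \<psi>_def Ga_def)
      have "(\<Sum>i\<le>e. c i x * v ^ i) = 0" if "v \<notin> {- \<tau> x / q x}" for v
      proof -
        have "\<tau> x + v * q x \<noteq> 0"
        proof
          assume "\<tau> x + v * q x = 0"
          then have "v * q x = - \<tau> x" by (simp add: eq_neg_iff_add_eq_0 add.commute)
          then have "v * q x / q x = - \<tau> x / q x" by simp
          then show False using that x(2) by simp
        qed
        then obtain t where "t \<noteq> 0" "shift v x = \<phi> t x" using shift_generic[OF x(1), of v] x(2,3) by auto
        then have "shift v x \<in> orbit Gm \<phi> x" by (auto simp: orbit_def Gm_def)
        then show ?thesis using vanishing_idealD[OF p] pr by metis
      qed
      then have "c i x = 0" if "i \<le> e" for i
        by (rule polynomial_eq_zero[of "{- \<tau> x / q x}", rotated]) (use that in auto)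
      then show ?thesis unfolding u pr by simp
    qed
    then show "y \<in> {y \<in> X. \<forall>p\<in>vanishing_ideal (orbit Gm \<phi> x). p y = 0}"
      using u shift_in_variety[OF x(1)] by simp
  next
    fix y assume "y \<in> {y \<in> X. \<forall>p\<in>vanishing_ideal (orbit Gm \<phi> x). p y = 0}"
    then have yX: "y \<in> X" and y: "\<And>p. p \<in> vanishing_ideal (orbit Gm \<phi> x) \<Longrightarrow> p y = 0" by auto
    have const: "p y = p x" if p: "p \<in> invariant_funs" for p
    proof -
      have "(\<lambda>z. p z - p x) \<in> vanishing_ideal (orbit Gm \<phi> x)"
        using p x(1) by (intro vanishing_idealI polynomial_closed invariant_funs_polynomial)
          (auto simp: orbit_def Gm_def invariant_funs_iff)
      then show ?thesis using y by fastforce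
    qed
    have "y = orbit_line x (\<tau> y)"
      using orbit_line_\<tau>[OF yX] x(2) by (simp add: const[OF q(1)] orbit_line_def[abs_def] const[OF a])
    also have "\<dots> = shift ((\<tau> y - \<tau> x) / q x) x" using shift_eq_orbit_line[OF x(1,2)] x(2) by simp
    finally show "y \<in> orbit Ga \<psi> x" using x(1) by (auto simp: orbit_def \<psi>_def Ga_def)
  qed
qed

lemma \<psi>_compatible: "compatible_action X \<phi> \<psi>"
  unfolding compatible_action_def
proof (intro conjI \<psi>_regular_action \<psi>_normalized)
  let ?U = "{x \<in> X. q x * \<tau> x \<noteq> 0}"
  have p: "(\<lambda>x. q x * \<tau> x) \<in> polynomial_funs" by (intro polynomial_closed q_polynomial \<tau>_polynomial)
  have "(\<lambda>x. q x * \<tau> x) \<notin> vanishing_ideal X"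
    by (intro not_vanishing_mult q_polynomial \<tau>_polynomial q \<tau>)
  then have "?U \<noteq> {}" using p by (auto simp: vanishing_ideal_def)
  moreover have "openin (subtopology zariski X) ?U" by (rule openin_basic[OF p])
  ultimately show "\<exists>U. openin (subtopology zariski X) U \<and> U \<noteq> {} \<and>
      (\<forall>x\<in>U. orbit Ga \<psi> x = (subtopology zariski X) closure_of (orbit Gm \<phi> x))"
    using \<psi>_orbit by (intro exI[of _ ?U]) auto
qed

end

theorem (in Gm_variety) fixed_divisor_imp_compatible_action:
  assumes "normal_affine_variety X" "faithful_action Gm X \<phi>"
    and "prime_divisor X D" "\<forall>x\<in>D. \<forall>t\<in>carrier Gm. \<phi> t x = x"
  shows "\<exists>\<psi>. compatible_action X \<phi> \<psi>"
proof -
  obtain \<tau> m where \<tau>: "homogeneous m \<tau>" "m \<noteq> 0" "\<tau> \<notin> vanishing_ideal X" and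
    div: "\<forall>i f. homogeneous i f \<longrightarrow> f \<notin> vanishing_ideal X \<longrightarrow>
      (\<exists>n q p. q \<in> invariant_funs \<and> q \<notin> vanishing_ideal X \<and> p \<in> invariant_funs \<and>
        (\<forall>x\<in>X. q x * f x = \<tau> x ^ n * p x))"
    using fixed_divisor_uniformizer[OF assms] by blast
  have "\<exists>q\<in>invariant_funs. q \<notin> vanishing_ideal X \<and>
    (\<forall>j. \<exists>e\<in>adjoin invariant_funs \<tau>. \<forall>x\<in>X. q x * x j = e x)"
    by (rule common_denominator) (use div in blast)
  then obtain q where q: "q \<in> invariant_funs" "q \<notin> vanishing_ideal X"
    "\<forall>j. \<exists>e\<in>adjoin invariant_funs \<tau>. \<forall>x\<in>X. q x * x j = e x"
    by blast
  have "\<forall>j. \<exists>a d. (\<forall>i. a i \<in> invariant_funs) \<and> (\<forall>x\<in>X. q x * x j = (\<Sum>i\<le>d. a i x * \<tau> x ^ i))"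
  proof
    fix j
    obtain e where e: "e \<in> adjoin invariant_funs \<tau>" "\<forall>x\<in>X. q x * x j = e x" using q(3) by blast
    obtain a d where "\<forall>i. a i \<in> invariant_funs" "\<forall>x. e x = (\<Sum>i\<le>d. a i x * \<tau> x ^ i)"
      using adjoinD[OF e(1)] by blast
    then show "\<exists>a d. (\<forall>i. a i \<in> invariant_funs) \<and> (\<forall>x\<in>X. q x * x j = (\<Sum>i\<le>d. a i x * \<tau> x ^ i))"
      using e(2) by (intro exI[of _ a] exI[of _ d]) simp
  qed
  then obtain a d where a: "\<forall>j i. a j i \<in> invariant_funs"
    "\<forall>j. \<forall>x\<in>X. q x * x j = (\<Sum>i\<le>d j. a j i x * \<tau> x ^ i)"
    by metis
  interpret uniformized_Gm_variety X \<phi> \<tau> q m a d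
    by unfold_locales (use \<tau> q a in auto)
  show ?thesis using \<psi>_compatible by blast
qed

section \<open>From a compatible action to a fixed prime divisor\<close>

lemma morphism_pullback:
  assumes h: "morphism X Y h" and f: "f \<in> polynomial_funs"
  shows "\<exists>r\<in>polynomial_funs. \<forall>x\<in>X. f (h x) = r x"
proof -
  have "\<forall>j. \<exists>p. p \<in> polynomial_funs \<and> (\<forall>x\<in>X. h x j = p x)"
    using h unfolding morphism_def regular_fun_def by blast
  then obtain p where p: "\<And>j. p j \<in> polynomial_funs" "\<And>j. \<forall>x\<in>X. h x j = p j x" by metis
  have "f (h x) = f (\<lambda>j. p j x)" if "x \<in> X" for x
  proof -
    have "h x = (\<lambda>j. p j x)" using p(2) that by auto
    then show ?thesis by simp
  qed
  then show ?thesis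
    by (intro bexI[of _ "\<lambda>x. f (\<lambda>j. p j x)"] polynomial_funs_compose[OF f] p(1)) auto
qed

lemma polynomial_value_at_zero:
  fixes a :: "nat \<Rightarrow> 'k::field_char_0"
  assumes "\<And>t. t \<noteq> 0 \<Longrightarrow> (\<Sum>i\<le>d. a i * t ^ i) = b * t ^ n"
  shows "(\<Sum>i\<le>d. a i * 0 ^ i) = b * 0 ^ n"
proof -
  define e where "e = (\<lambda>i. (if i \<le> d then a i else 0) - (if i = n then b else 0))"
  have "(\<Sum>i\<le>d+n. e i * t ^ i) = 0" if "t \<notin> {0}" for t
  proof -
    have "(\<Sum>i\<le>d+n. (if i \<le> d then a i else 0) * t ^ i) = (\<Sum>i\<le>d. a i * t ^ i)"
      by (rule sum.mono_neutral_cong_right) auto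
    moreover have "(\<Sum>i\<le>d+n. (if i = n then b else 0) * t ^ i) = b * t ^ n"
      by (simp add: if_distrib[of "\<lambda>z. z * _"] sum.delta cong: if_cong)
    ultimately show ?thesis
      using assms[of t] that by (simp add: e_def left_diff_distrib sum_subtractf)
  qed
  then have "e 0 = 0" by (rule polynomial_eq_zero[of "{0}", rotated]) auto
  then show ?thesis by (simp add: e_def power_0_left if_distrib[of "\<lambda>z. _ * z"] sum.delta cong: if_cong split: if_splits)
qed

text \<open>With \<open>b\<close> the coefficients of \<open>f (\<psi> u x)\<close> in \<open>u\<close>, those at the point \<open>\<psi> v x\<close> are the \<open>a\<close> given by
  such an identity.\<close>

lemma translation_coefficients:
  fixes a b :: "nat \<Rightarrow> 'k::field_char_0"
  assumes eq: "\<And>u. (\<Sum>i\<le>n. a i * u ^ i) = (\<Sum>i\<le>n. b i * (u + v) ^ i)"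
  shows "a n = b n" and "n > 0 \<Longrightarrow> a (n - 1) = b (n - 1) + of_nat n * v * b n"
proof -
  have coeff: "a l = (\<Sum>i\<le>n. b i * of_nat (i choose l) * v ^ (i - l))" if l: "l \<le> n" for l
  proof -
    have "a l - (\<Sum>i\<le>n. b i * of_nat (i choose l) * v ^ (i - l)) = 0"
    proof (rule polynomial_eq_zero[where E = "{}" and n = n, OF _ _ l])
      fix u
      have "(u + v) ^ i = (\<Sum>l\<le>n. of_nat (i choose l) * u ^ l * v ^ (i - l))" if "i \<le> n" for i
        unfolding binomial_ring by (rule sum.mono_neutral_left) (use that in auto)
      then have "(\<Sum>i\<le>n. b i * (u + v) ^ i) =
          (\<Sum>i\<le>n. \<Sum>l\<le>n. b i * (of_nat (i choose l) * u ^ l * v ^ (i - l)))"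
        by (simp add: sum_distrib_left)
      also have "\<dots> = (\<Sum>l\<le>n. \<Sum>i\<le>n. b i * (of_nat (i choose l) * u ^ l * v ^ (i - l)))"
        by (rule sum.swap)
      also have "\<dots> = (\<Sum>l\<le>n. (\<Sum>i\<le>n. b i * of_nat (i choose l) * v ^ (i - l)) * u ^ l)"
        unfolding sum_distrib_right by (intro sum.cong refl) (simp add: mult_ac)
      finally show "(\<Sum>l\<le>n. (a l - (\<Sum>i\<le>n. b i * of_nat (i choose l) * v ^ (i - l))) * u ^ l) = 0"
        using eq[of u] by (simp add: left_diff_distrib sum_subtractf)
    qed simp
    then show ?thesis by simp
  qed
  have top: "(\<Sum>i\<le>k. b i * of_nat (i choose k) * v ^ (i - k)) = b k" for k
  proof -
    have "(\<Sum>i\<le>k. b i * of_nat (i choose k) * v ^ (i - k)) = (\<Sum>i\<le>k. if i = k then b k else 0)"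
      by (rule sum.cong) auto
    then show ?thesis by simp
  qed
  show "a n = b n" using coeff[of n] top by simp
  show "a (n - 1) = b (n - 1) + of_nat n * v * b n" if pos: "n > 0"
  proof -
    obtain k where k: "n = Suc k" using pos gr0_conv_Suc by blast
    have "a k = (\<Sum>i\<le>Suc k. b i * of_nat (i choose k) * v ^ (i - k))" using coeff[of k] k by simp
    also have "\<dots> = b k + b (Suc k) * of_nat (Suc k choose k) * v ^ (Suc k - k)"
      by (simp only: sum.atMost_Suc top)
    also have "Suc k choose k = Suc k" by (rule binomial_Suc_n)
    finally show ?thesis using k by (simp add: mult_ac)
  qed
qed

text \<open>The sign \<open>\<epsilon>\<close> makes all weights nonnegative. Then the orbit map of every point extends to the
  parameter \<open>0\<close>, and its value there is the limit point of the orbit.\<close>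

lemma (in Gm_variety) exists_retraction:
  fixes \<epsilon> :: int
  assumes \<epsilon>: "\<epsilon> = 1 \<or> \<epsilon> = - 1"
    and one_sided: "\<forall>k f. homogeneous k f \<longrightarrow> \<epsilon> * k < 0 \<longrightarrow> f \<in> vanishing_ideal X"
  shows "\<exists>\<pi>. morphism X X \<pi> \<and> (\<forall>f\<in>invariant_funs. \<forall>x\<in>X. f (\<pi> x) = f x) \<and>
    (\<forall>k f. k \<noteq> 0 \<longrightarrow> homogeneous k f \<longrightarrow> (\<forall>x\<in>X. f (\<pi> x) = 0))"
proof -
  note one_sided = one_sided[rule_format]
  have "\<forall>j. \<exists>c S. finite S \<and> (\<forall>k. homogeneous k (c k)) \<and> (\<forall>k. k \<notin> S \<longrightarrow> c k = (\<lambda>_. 0)) \<and>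
      (\<forall>x\<in>X. x j = (\<Sum>k\<in>S. c k x))"
    using homogeneous_decomposition[OF polynomial_coord] by blast
  then obtain c S where c: "\<And>j. finite (S j)" "\<And>j k. homogeneous k (c j k)"
    "\<And>j k. k \<notin> S j \<Longrightarrow> c j k = (\<lambda>_. 0)" "\<And>j x. x \<in> X \<Longrightarrow> x j = (\<Sum>k\<in>S j. c j k x)"
    by metis
  note cR = homogeneous_polynomial[OF c(2)]
  define \<pi> where "\<pi> = (\<lambda>x j. c j 0 x)"
  define \<gamma> where "\<gamma> = (\<lambda>z j. \<Sum>k\<in>S j. if \<epsilon> * k \<ge> 0 then c j k (snd z) * fst z ^ nat (\<epsilon> * k) else 0)"
  have \<gamma>_param: "(\<lambda>z. \<gamma> z j) \<in> param_polynomials" for j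
    unfolding \<gamma>_def
  proof (rule param_closed(6))
    fix k
    show "(\<lambda>z. if \<epsilon> * k \<ge> 0 then c j k (snd z) * fst z ^ nat (\<epsilon> * k) else 0) \<in> param_polynomials"
      by (cases "\<epsilon> * k \<ge> 0")
         (auto intro!: param_closed param_polynomials_fst param_polynomials_snd cR)
  qed
  have \<gamma>_0: "\<gamma> (0, x) = \<pi> x" for x
  proof
    fix j
    have "\<gamma> (0, x) j = (\<Sum>k\<in>S j. if k = 0 then c j 0 x else 0)"
      unfolding \<gamma>_def by (rule sum.cong) (use \<epsilon> in \<open>auto simp: power_0_left\<close>)
    also have "\<dots> = c j 0 x" using c(1,3) by (cases "0 \<in> S j") (auto simp: sum.delta)
    finally show "\<gamma> (0, x) j = \<pi> x j" by (simp add: \<pi>_def)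
  qed
  have \<gamma>_t: "\<gamma> (t, x) = \<phi> (t powi \<epsilon>) x" if t: "t \<noteq> 0" and x: "x \<in> X" for t x
  proof
    fix j
    have s: "t powi \<epsilon> \<noteq> 0" using t by simp
    have "\<phi> (t powi \<epsilon>) x j = (\<Sum>k\<in>S j. c j k (\<phi> (t powi \<epsilon>) x))" by (rule c(4)[OF in_variety[OF s x]])
    also have "\<dots> = (\<Sum>k\<in>S j. t powi (\<epsilon> * k) * c j k x)"
      by (simp add: homogeneousD[OF c(2) s x] power_int_mult)
    also have "\<dots> = \<gamma> (t, x) j"
      unfolding \<gamma>_def
    proof (rule sum.cong[OF refl])
      fix k
      show "t powi (\<epsilon> * k) * c j k x =
          (if \<epsilon> * k \<ge> 0 then c j k (snd (t, x)) * fst (t, x) ^ nat (\<epsilon> * k) else 0)"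
      proof (cases "\<epsilon> * k \<ge> 0")
        case True
        then show ?thesis by (simp add: power_int_def mult.commute)
      next
        case False
        then have "c j k x = 0" using one_sided[OF c(2), of k j] vanishing_idealD x by force
        then show ?thesis using False by simp
      qed
    qed
    finally show "\<gamma> (t, x) j = \<phi> (t powi \<epsilon>) x j" by simp
  qed
  have limit: "F (\<pi> x) = b * 0 ^ n"
    if F: "F \<in> polynomial_funs" and x: "x \<in> X" and "\<And>t. t \<noteq> 0 \<Longrightarrow> F (\<phi> (t powi \<epsilon>) x) = b * t ^ n" for F x b n
  proof -
    obtain a d where a: "\<forall>t x. F (\<gamma> (t, x)) = (\<Sum>i\<le>d. a i x * t ^ i)"
      using param_polynomials_expansion[OF subalgebra_compose[where f = \<gamma>, OF subalgebra_param_polynomials F \<gamma>_param]] by blast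
    have "(\<Sum>i\<le>d. a i x * 0 ^ i) = b * 0 ^ n"
      by (rule polynomial_value_at_zero) (use that(3) \<gamma>_t[OF _ x] in \<open>simp flip: a[rule_format]\<close>)
    then show ?thesis using a \<gamma>_0 by metis
  qed
  have "\<pi> x \<in> X" if x: "x \<in> X" for x
  proof (rule closedin_zariski_vanishing)
    show "closedin zariski X" using X by (simp add: affine_variety_def)
    fix p assume p: "p \<in> vanishing_ideal X"
    show "p (\<pi> x) = 0"
      using limit[OF vanishing_ideal_polynomial[OF p] x, of 0 0] vanishing_idealD[OF p in_variety[OF _ x]]
      by simp
  qed
  then have "morphism X X \<pi>" using cR by (auto simp: morphism_def \<pi>_def regular_fun_polynomial)
  moreover have "f (\<pi> x) = f x" if f: "f \<in> invariant_funs" and x: "x \<in> X" for f x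
    using limit[OF invariant_funs_polynomial[OF f] x, of "f x" 0] f x by (simp add: invariant_funs_iff)
  moreover have "f (\<pi> x) = 0" if k: "k \<noteq> 0" and f: "homogeneous k f" and x: "x \<in> X" for k f x
  proof (cases "\<epsilon> * k > 0")
    case True
    have "f (\<phi> (t powi \<epsilon>) x) = f x * t ^ nat (\<epsilon> * k)" if t: "t \<noteq> 0" for t
    proof -
      have "f (\<phi> (t powi \<epsilon>) x) = t powi (\<epsilon> * k) * f x"
        using homogeneousD[OF f _ x, of "t powi \<epsilon>"] t by (simp add: power_int_mult)
      then show ?thesis using True by (simp add: power_int_def mult.commute)
    qed
    then show ?thesis
      using limit[OF homogeneous_polynomial[OF f] x, of "f x" "nat (\<epsilon> * k)"] True by (simp add: power_0_left)
  next
    case False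
    then have "\<epsilon> * k < 0" using k \<epsilon> by auto
    then have fX: "f \<in> vanishing_ideal X" by (rule one_sided[OF f])
    show ?thesis
      using limit[OF homogeneous_polynomial[OF f] x, of 0 0] vanishing_idealD[OF fX in_variety[OF _ x]]
      by simp
  qed
  ultimately show ?thesis by blast
qed

locale compatible_Gm_variety = Gm_variety X \<phi>
  for X :: "('n::finite \<Rightarrow> 'k::{alg_closed_field, field_char_0}) set" and \<phi> +
  fixes \<psi> :: "'k \<Rightarrow> ('n \<Rightarrow> 'k) \<Rightarrow> ('n \<Rightarrow> 'k)"
  assumes faithful: "faithful_action Gm X \<phi>" and compatible: "compatible_action X \<phi> \<psi>"
begin

lemma \<psi>_action: "regular_Ga_action X \<psi>"
  using compatible by (simp add: compatible_action_def)

lemma group_action_Ga: "group_action Ga X \<psi>"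
  using \<psi>_action by (simp add: regular_action_def)

lemma \<psi>_in_variety: "x \<in> X \<Longrightarrow> \<psi> u x \<in> X"
  using group_action.element_image[OF group_action_Ga, of u x] by (simp add: Ga_def)

lemma \<psi>_add: "x \<in> X \<Longrightarrow> \<psi> u (\<psi> v x) = \<psi> (u + v) x"
  using group_action.composition_rule[OF group_action_Ga, of x u v] by (simp add: Ga_def)

lemma \<psi>_zero: "x \<in> X \<Longrightarrow> \<psi> 0 x = x"
  using group_action.id_eq_one[OF group_action_Ga, symmetric] by (simp add: Ga_def)

lemma \<psi>_morphism: "morphism X X (\<psi> u)"
  using regular_action_in_Aut[OF \<psi>_action, of u] by (simp add: Aut_def Ga_def)

lemma \<psi>_expansion:
  assumes "f \<in> polynomial_funs"
  shows "\<exists>c d. (\<forall>i. c i \<in> polynomial_funs) \<and> (\<forall>u. \<forall>x\<in>X. f (\<psi> u x) = (\<Sum>i\<le>d. c i x * u ^ i))"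
proof -
  obtain p where p: "p \<in> product_funs Ga_funs" "\<forall>g\<in>carrier Ga. \<forall>x\<in>X. f (\<psi> g x) = p (g, x)"
    using regular_action_pullback[OF \<psi>_action assms] by blast
  obtain c d where c: "\<forall>i. c i \<in> polynomial_funs" "\<forall>t x. p (t, x) = (\<Sum>i\<le>d. c i x * t ^ i)"
    using param_polynomials_expansion[OF subsetD[OF product_funs_Ga p(1)]] by blast
  then show ?thesis using p(2) by (intro exI[of _ c] exI[of _ d]) (simp add: Ga_def)
qed

text \<open>The two properties of general orbits that are used: the torus orbit lies in the \<open>\<psi>\<close>-orbit, and an
  equation that holds on the former holds on the latter.\<close>

lemma generic_orbits:
  "\<exists>g\<in>polynomial_funs. (\<exists>x\<in>X. g x \<noteq> 0) \<and> (\<forall>x\<in>X. g x \<noteq> 0 \<longrightarrow>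
    orbit Gm \<phi> x \<subseteq> orbit Ga \<psi> x \<and> (\<forall>y\<in>orbit Ga \<psi> x. \<forall>p\<in>vanishing_ideal (orbit Gm \<phi> x). p y = 0))"
proof -
  obtain U where U: "openin (subtopology zariski X) U" "U \<noteq> {}"
    "\<forall>x\<in>U. orbit Ga \<psi> x = (subtopology zariski X) closure_of (orbit Gm \<phi> x)"
    using compatible unfolding compatible_action_def by blast
  obtain g where g: "g \<in> polynomial_funs" "\<exists>x\<in>X. g x \<noteq> 0" "\<forall>x\<in>X. g x \<noteq> 0 \<longrightarrow> x \<in> U"
    using openin_contains_basic[OF U(1,2)] by blast
  have "orbit Gm \<phi> x \<subseteq> orbit Ga \<psi> x \<and> (\<forall>y\<in>orbit Ga \<psi> x. \<forall>p\<in>vanishing_ideal (orbit Gm \<phi> x). p y = 0)"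
    if x: "x \<in> X" "g x \<noteq> 0" for x
  proof -
    have orb: "orbit Gm \<phi> x \<subseteq> X" using in_variety x(1) by (auto simp: orbit_def Gm_def)
    have eq: "orbit Ga \<psi> x = {y \<in> X. \<forall>p\<in>vanishing_ideal (orbit Gm \<phi> x). p y = 0}"
      using U(3) g(3) x closure_of_zariski[OF orb] by simp
    show ?thesis unfolding eq using orb vanishing_idealD by blast
  qed
  then show ?thesis using g(1,2) by blast
qed

lemma invariant_funs_\<psi>:
  assumes f: "f \<in> invariant_funs" and x: "x \<in> X"
  shows "f (\<psi> u x) = f x"
proof -
  obtain g where g: "g \<in> polynomial_funs" "\<exists>x\<in>X. g x \<noteq> 0" "\<forall>x\<in>X. g x \<noteq> 0 \<longrightarrow>
      orbit Gm \<phi> x \<subseteq> orbit Ga \<psi> x \<and> (\<forall>y\<in>orbit Ga \<psi> x. \<forall>p\<in>vanishing_ideal (orbit Gm \<phi> x). p y = 0)"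
    using generic_orbits by blast
  note fR = invariant_funs_polynomial[OF f]
  obtain r where r: "r \<in> polynomial_funs" "\<forall>x\<in>X. f (\<psi> u x) = r x"
    using morphism_pullback[OF \<psi>_morphism fR] by blast
  have "r x - f x = 0"
  proof (rule vanishes_if_vanishes_on_basic[OF X g(1,2) polynomial_closed(5)[OF r(1) fR] _ x])
    fix x assume x: "x \<in> X" "g x \<noteq> 0"
    have 1: "(\<lambda>y. f y - f x) \<in> vanishing_ideal (orbit Gm \<phi> x)"
      using f x(1) by (intro vanishing_idealI polynomial_closed fR) (auto simp: orbit_def Gm_def invariant_funs_iff)
    have 2: "\<psi> u x \<in> orbit Ga \<psi> x" by (auto simp: orbit_def Ga_def)
    have "\<forall>y\<in>orbit Ga \<psi> x. \<forall>p\<in>vanishing_ideal (orbit Gm \<phi> x). p y = 0" using g(3) x by blast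
    from this[rule_format, OF 2 1] have "f (\<psi> u x) - f x = 0" .
    then show "r x - f x = 0" using r(2) x(1) by simp
  qed
  then show ?thesis using r(2) x by simp
qed

lemma invariant_funsI_\<psi>:
  assumes f: "f \<in> polynomial_funs" and inv: "\<And>u x. x \<in> X \<Longrightarrow> f (\<psi> u x) = f x"
  shows "f \<in> invariant_funs"
  unfolding invariant_funs_iff
proof (intro conjI allI impI f)
  fix t :: 'k and x assume t: "t \<noteq> 0" and x: "x \<in> X"
  obtain g where g: "g \<in> polynomial_funs" "\<exists>x\<in>X. g x \<noteq> 0" "\<forall>x\<in>X. g x \<noteq> 0 \<longrightarrow>
      orbit Gm \<phi> x \<subseteq> orbit Ga \<psi> x \<and> (\<forall>y\<in>orbit Ga \<psi> x. \<forall>p\<in>vanishing_ideal (orbit Gm \<phi> x). p y = 0)"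
    using generic_orbits by blast
  obtain r where r: "r \<in> polynomial_funs" "\<forall>x\<in>X. f (\<phi> t x) = r x"
    using morphism_pullback[OF action_morphism[OF t] f] by blast
  have "r x - f x = 0"
  proof (rule vanishes_if_vanishes_on_basic[OF X g(1,2) polynomial_closed(5)[OF r(1) f] _ x])
    fix x assume x: "x \<in> X" "g x \<noteq> 0"
    have "\<phi> t x \<in> orbit Gm \<phi> x" using t by (auto simp: orbit_def Gm_def)
    then have "\<phi> t x \<in> orbit Ga \<psi> x" using g(3) x by blast
    then obtain u where "\<phi> t x = \<psi> u x" by (auto simp: orbit_def)
    then show "r x - f x = 0" using r(2)[rule_format, OF x(1)] inv[OF x(1), of u] by simp
  qed
  then show "f (\<phi> t x) = f x" using r(2) x by simp
qed

text \<open>If \<open>f\<close> and \<open>g\<close> had weights of opposite signs, a product of powers of them would have weight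
  zero and so be constant on general \<open>\<psi>\<close>-orbits. Then \<open>f\<close> would have no zero on such an orbit, an
  affine line, hence be constant on it, although it is not constant on the torus orbit inside.\<close>

lemma weights_one_sided:
  assumes f: "homogeneous i f" "i > 0" "f \<notin> vanishing_ideal X"
    and g: "homogeneous j g" "j < 0" "g \<notin> vanishing_ideal X"
  shows False
proof -
  obtain e where e: "e \<in> polynomial_funs" "\<exists>x\<in>X. e x \<noteq> 0" "\<forall>x\<in>X. e x \<noteq> 0 \<longrightarrow>
      orbit Gm \<phi> x \<subseteq> orbit Ga \<psi> x \<and> (\<forall>y\<in>orbit Ga \<psi> x. \<forall>p\<in>vanishing_ideal (orbit Gm \<phi> x). p y = 0)"
    using generic_orbits by blast
  note fR = homogeneous_polynomial[OF f(1)] and gR = homogeneous_polynomial[OF g(1)]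
  have "e \<notin> vanishing_ideal X" using e(2) vanishing_idealD by blast
  then have "(\<lambda>x. e x * (f x * g x)) \<notin> vanishing_ideal X"
    by (intro not_vanishing_mult e(1) fR gR f(3) g(3) polynomial_closed)
  moreover have "(\<lambda>x. e x * (f x * g x)) \<in> polynomial_funs" by (intro polynomial_closed e(1) fR gR)
  ultimately obtain x where x: "x \<in> X" "e x \<noteq> 0" "f x \<noteq> 0" "g x \<noteq> 0"
    by (auto simp: vanishing_ideal_def)
  let ?h = "\<lambda>x. f x ^ nat (- j) * g x ^ nat i"
  have "homogeneous (int (nat (- j)) * i + int (nat i) * j) ?h"
    by (intro homogeneous_mult homogeneous_power f g)
  then have h: "?h \<in> invariant_funs" using f(2) g(2) by (simp add: invariant_funs_def mult.commute)
  have nz: "f (\<psi> u x) \<noteq> 0" for u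
  proof
    assume "f (\<psi> u x) = 0"
    then have "?h (\<psi> u x) = 0" using g(2) by (simp add: power_0_left)
    then show False using invariant_funs_\<psi>[OF h x(1), of u] x(3,4) by simp
  qed
  obtain c d where c: "\<forall>u. \<forall>x\<in>X. f (\<psi> u x) = (\<Sum>i\<le>d. c i x * u ^ i)" using \<psi>_expansion[OF fR] by blast
  have c0: "c l x = 0" if "0 < l" "l \<le> d" for l
  proof (rule ccontr)
    assume "c l x \<noteq> 0"
    define n where "n = Max {l. l \<le> d \<and> c l x \<noteq> 0}"
    have fin: "finite {l. l \<le> d \<and> c l x \<noteq> 0}" by simp
    have "n \<in> {l. l \<le> d \<and> c l x \<noteq> 0}"
      unfolding n_def by (rule Max_in[OF fin]) (use that \<open>c l x \<noteq> 0\<close> in blast)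
    moreover have "l \<le> n" unfolding n_def by (rule Max_ge[OF fin]) (use that \<open>c l x \<noteq> 0\<close> in blast)
    ultimately have n: "n > 0" "n \<le> d" "c n x \<noteq> 0" using that by auto
    obtain u where "(\<Sum>i\<le>n. c i x * u ^ i) = 0" using alg_closed[of n "\<lambda>i. c i x"] n by blast
    also have "(\<Sum>i\<le>n. c i x * u ^ i) = (\<Sum>i\<le>d. c i x * u ^ i)"
    proof (rule sum.mono_neutral_left)
      show "\<forall>i\<in>{..d} - {..n}. c i x * u ^ i = 0"
        using Max_ge[OF fin] unfolding n_def[symmetric] by (auto simp: not_le)
    qed (use n in auto)
    finally show False using nz[of u] c x(1) by simp
  qed
  have "f (\<psi> u x) = c 0 x" for u
  proof -
    have "(\<Sum>i\<le>d. c i x * u ^ i) = (\<Sum>i\<le>d. if i = 0 then c 0 x else 0)"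
      using c0 by (intro sum.cong) auto
    then show ?thesis using c x(1) by simp
  qed
  then have const: "f (\<psi> u x) = f x" for u using \<psi>_zero[OF x(1)] by metis
  have "\<phi> 2 x \<in> orbit Gm \<phi> x" by (auto simp: orbit_def Gm_def)
  then have "\<phi> 2 x \<in> orbit Ga \<psi> x" using e(3) x by blast
  then obtain u where "\<phi> 2 x = \<psi> u x" by (auto simp: orbit_def)
  then have "2 powi i * f x = f x" using homogeneousD[OF f(1), of 2 x] const[of u] x(1) by simp
  then show False using two_power_int_neq_one[of i, where 'k = 'k] f(2) x(3) by simp
qed

lemma top_coefficients:
  assumes c: "\<forall>i. c i \<in> polynomial_funs"
    and f: "\<forall>u. \<forall>x\<in>X. f (\<psi> u x) = (\<Sum>i\<le>n. c i x * u ^ i)"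
  shows "c n \<in> invariant_funs"
    and "\<And>v x. n > 0 \<Longrightarrow> x \<in> X \<Longrightarrow> c (n - 1) (\<psi> v x) = c (n - 1) x + of_nat n * v * c n x"
proof -
  have eq: "(\<Sum>i\<le>n. c i (\<psi> v x) * u ^ i) = (\<Sum>i\<le>n. c i x * (u + v) ^ i)" if x: "x \<in> X" for u v x
    using f[rule_format, OF \<psi>_in_variety[OF x], of u v] f[rule_format, OF x, of "u + v"] \<psi>_add[OF x] by simp
  show "c n \<in> invariant_funs"
    by (rule invariant_funsI_\<psi>[OF c[rule_format]]) (rule translation_coefficients(1)[OF eq])
  show "c (n - 1) (\<psi> v x) = c (n - 1) x + of_nat n * v * c n x" if "n > 0" "x \<in> X" for v x
    using translation_coefficients(2)[OF eq[OF that(2)] that(1)] .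
qed

text \<open>Take a coordinate that is not invariant and the last two coefficients of its expansion along
  the orbits of \<open>\<psi>\<close>: the last one is invariant and the one before changes by a multiple of it. The factor
  \<open>n\<close> in \<open>n * c n\<close> is invertible in characteristic zero.\<close>

lemma exists_local_slice:
  "\<exists>s c. s \<in> polynomial_funs \<and> c \<in> invariant_funs \<and> c \<notin> vanishing_ideal X \<and>
    (\<forall>v. \<forall>x\<in>X. s (\<psi> v x) = s x + v * c x)"
proof -
  obtain y where y: "y \<in> X" "\<phi> 2 y \<noteq> y" using nontrivial_action[OF faithful] by blast
  then obtain j where j: "\<phi> 2 y j \<noteq> y j" by blast
  let ?f = "\<lambda>x::'n \<Rightarrow> 'k. x j"
  have f_inv: "?f \<notin> invariant_funs"
  proof
    assume "?f \<in> invariant_funs"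
    then have "?f (\<phi> 2 y) = ?f y" using y(1) unfolding invariant_funs_iff by fastforce
    then show False using j by simp
  qed
  obtain c d where c: "\<forall>i. c i \<in> polynomial_funs" "\<forall>u. \<forall>x\<in>X. ?f (\<psi> u x) = (\<Sum>i\<le>d. c i x * u ^ i)"
    using \<psi>_expansion[OF polynomial_coord] by blast
  define n where "n = Max {l. l \<le> d \<and> c l \<notin> vanishing_ideal X}"
  have fin: "finite {l. l \<le> d \<and> c l \<notin> vanishing_ideal X}" by simp
  have "\<exists>l. 0 < l \<and> l \<le> d \<and> c l \<notin> vanishing_ideal X"
  proof (rule ccontr)
    assume "\<not> ?thesis"
    then have 0: "c l x = 0" if "0 < l" "l \<le> d" "x \<in> X" for l x using that vanishing_idealD by blast
    have const: "?f (\<psi> u x) = c 0 x" if x: "x \<in> X" for u x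
    proof -
      have "(\<Sum>i\<le>d. c i x * u ^ i) = (\<Sum>i\<le>d. if i = 0 then c 0 x else 0)"
        using 0 x by (intro sum.cong) auto
      then show ?thesis using c(2) x by simp
    qed
    have "?f \<in> invariant_funs"
      by (rule invariant_funsI_\<psi>[OF polynomial_coord]) (use const \<psi>_zero in metis)
    then show False using f_inv by blast
  qed
  then obtain l where l: "0 < l" "l \<le> d" "c l \<notin> vanishing_ideal X" by blast
  have "n \<in> {l. l \<le> d \<and> c l \<notin> vanishing_ideal X}" unfolding n_def by (rule Max_in[OF fin]) (use l in blast)
  moreover have "l \<le> n" unfolding n_def by (rule Max_ge[OF fin]) (use l in blast)
  ultimately have n: "n > 0" "n \<le> d" "c n \<notin> vanishing_ideal X" using l by auto
  have f: "\<forall>u. \<forall>x\<in>X. ?f (\<psi> u x) = (\<Sum>i\<le>n. c i x * u ^ i)"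
  proof (intro allI ballI)
    fix u x assume x: "x \<in> X"
    have "(\<Sum>i\<le>n. c i x * u ^ i) = (\<Sum>i\<le>d. c i x * u ^ i)"
    proof (rule sum.mono_neutral_left)
      have "c i x = 0" if "i \<le> d" "n < i" for i
      proof -
        have "c i \<in> vanishing_ideal X"
          using Max_ge[OF fin, of i] that unfolding n_def[symmetric] by auto
        then show ?thesis using x by (rule vanishing_idealD)
      qed
      then show "\<forall>i\<in>{..d} - {..n}. c i x * u ^ i = 0" by auto
    qed (use n in auto)
    then show "?f (\<psi> u x) = (\<Sum>i\<le>n. c i x * u ^ i)" using c(2) x by simp
  qed
  note top = top_coefficients[OF c(1) f]
  let ?c = "\<lambda>x. of_nat n * c n x"
  have "?c \<in> invariant_funs" by (intro subalgebra_closed[OF subalgebra_invariant_funs] top(1))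
  moreover have "?c \<notin> vanishing_ideal X"
    using n(1,3) c(1) by (auto simp: vanishing_ideal_def)
  moreover have "\<forall>v. \<forall>x\<in>X. c (n - 1) (\<psi> v x) = c (n - 1) x + v * ?c x"
    using top(2)[OF n(1)] by (simp add: mult_ac)
  ultimately show ?thesis using c(1) by blast
qed

text \<open>The local slice \<open>s\<close> generates all functions over those of weight zero, up to denominators \<open>c ^ K\<close>:
  subtracting a multiple of \<open>s ^ n\<close> lowers the degree in the parameter.\<close>

lemma slice_generates:
  assumes s: "s \<in> polynomial_funs" and c: "c \<in> invariant_funs"
    and slice: "\<forall>v. \<forall>x\<in>X. s (\<psi> v x) = s x + v * c x"
    and g: "g \<in> polynomial_funs"
  shows "\<exists>K e. e \<in> adjoin invariant_funs s \<and> (\<forall>x\<in>X. c x ^ K * g x = e x)"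
proof -
  note aclosed = subalgebra_closed[OF subalgebra_adjoin[OF subalgebra_invariant_funs]]
  have inv: "p \<in> adjoin invariant_funs s" if "p \<in> invariant_funs" for p
    using subset_adjoin[OF subalgebra_invariant_funs] that by blast
  have gen: "s \<in> adjoin invariant_funs s" by (rule adjoin_generator[OF subalgebra_invariant_funs])
  have cR: "c \<in> polynomial_funs" by (rule invariant_funs_polynomial[OF c])
  have "\<exists>K e. e \<in> adjoin invariant_funs s \<and> (\<forall>x\<in>X. c x ^ K * g x = e x)"
    if "g \<in> polynomial_funs" "\<forall>i. a i \<in> polynomial_funs" "\<forall>u. \<forall>x\<in>X. g (\<psi> u x) = (\<Sum>i\<le>n. a i x * u ^ i)"
    for n g a
    using that
  proof (induction n arbitrary: g a)
    case 0
    have "g x = a 0 x" if x: "x \<in> X" for x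
      using "0.prems"(3)[rule_format, OF x, of 0] \<psi>_zero[OF x] by simp
    moreover have "a 0 \<in> invariant_funs"
      by (rule top_coefficients(1)[OF "0.prems"(2,3)])
    ultimately show ?case by (intro exI[of _ 0] exI[of _ "a 0"]) (simp add: inv)
  next
    case (Suc n)
    let ?N = "Suc n"
    have top: "a ?N \<in> invariant_funs"
      by (rule top_coefficients(1)[OF Suc.prems(2,3)])
    let ?g = "\<lambda>x. c x ^ ?N * g x - a ?N x * s x ^ ?N"
    let ?a = "\<lambda>i x. c x ^ ?N * a i x - a ?N x * (of_nat (?N choose i) * c x ^ i * s x ^ (?N - i))"
    have gR: "?g \<in> polynomial_funs" by (intro polynomial_closed cR Suc.prems(1) s Suc.prems(2)[rule_format])
    have aR: "\<forall>i. ?a i \<in> polynomial_funs"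
      by (intro allI polynomial_closed cR s Suc.prems(2)[rule_format])
    have "?g (\<psi> u x) = (\<Sum>i\<le>n. ?a i x * u ^ i)" if x: "x \<in> X" for u x
    proof -
      have "?g (\<psi> u x) = c x ^ ?N * g (\<psi> u x) - a ?N x * (u * c x + s x) ^ ?N"
        using invariant_funs_\<psi>[OF c x] invariant_funs_\<psi>[OF top x] slice[rule_format, OF x, of u] by (simp add: add.commute)
      also have "\<dots> = c x ^ ?N * (\<Sum>i\<le>?N. a i x * u ^ i) -
          a ?N x * (\<Sum>i\<le>?N. of_nat (?N choose i) * (u * c x) ^ i * s x ^ (?N - i))"
        by (simp only: Suc.prems(3)[rule_format, OF x] binomial_ring[of "u * c x" "s x" ?N])
      also have "\<dots> = (\<Sum>i\<le>?N. ?a i x * u ^ i)"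
        unfolding sum_distrib_left sum_subtractf[symmetric]
        by (rule sum.cong[OF refl]) (simp add: algebra_simps power_mult_distrib)
      also have "\<dots> = (\<Sum>i\<le>n. ?a i x * u ^ i) + ?a ?N x * u ^ ?N" by (rule sum.atMost_Suc)
      also have "?a ?N x = 0" by simp
      finally show ?thesis by simp
    qed
    then obtain K e where Ke: "e \<in> adjoin invariant_funs s" "\<forall>x\<in>X. c x ^ K * ?g x = e x"
      using Suc.IH[OF gR aR] by blast
    have "\<forall>x\<in>X. c x ^ (K + ?N) * g x = c x ^ K * (a ?N x * s x ^ ?N) + e x"
      using Ke(2)[rule_format, symmetric] by (simp add: algebra_simps power_add)
    moreover have "(\<lambda>x. c x ^ K * (a ?N x * s x ^ ?N) + e x) \<in> adjoin invariant_funs s"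
      by (intro aclosed inv c top gen Ke)
    ultimately show ?case by blast
  qed
  then show ?thesis using \<psi>_expansion[OF g] g by blast
qed

text \<open>The divisor is the image of \<open>\<pi>\<close>. Functions on it are those of weight zero on \<open>X\<close>, so it inherits
  irreducibility from \<open>X\<close>. For maximality, let \<open>Z\<close> be irreducible with \<open>D \<subseteq> Z \<subset> X\<close> and write a function
  \<open>f\<close> that vanishes on \<open>Z\<close> but not on \<open>X\<close> as \<open>s ^ l * w\<close>, up to a power of \<open>c\<close>, with \<open>l\<close> as large as
  possible. Then \<open>w\<close> does not vanish on \<open>D\<close>, hence \<open>s\<close> vanishes on \<open>Z\<close>.\<close>

theorem exists_fixed_divisor: "\<exists>D. prime_divisor X D \<and> (\<forall>x\<in>D. \<forall>t\<in>carrier Gm. \<phi> t x = x)"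
proof -
  have "\<exists>\<epsilon>::int. (\<epsilon> = 1 \<or> \<epsilon> = - 1) \<and> (\<forall>k f. homogeneous k f \<longrightarrow> \<epsilon> * k < 0 \<longrightarrow> f \<in> vanishing_ideal X)"
  proof (cases "\<forall>k f. homogeneous k f \<longrightarrow> k < 0 \<longrightarrow> f \<in> vanishing_ideal X")
    case True
    then show ?thesis by (intro exI[of _ 1]) simp
  next
    case False
    then show ?thesis using weights_one_sided by (intro exI[of _ "-1"]) force
  qed
  then obtain \<epsilon> :: int where \<epsilon>: "\<epsilon> = 1 \<or> \<epsilon> = - 1"
    "\<forall>k f. homogeneous k f \<longrightarrow> \<epsilon> * k < 0 \<longrightarrow> f \<in> vanishing_ideal X" by blast
  obtain \<pi> where \<pi>: "morphism X X \<pi>" and \<pi>_inv': "\<forall>f\<in>invariant_funs. \<forall>x\<in>X. f (\<pi> x) = f x"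
    and \<pi>_weight': "\<forall>k f. k \<noteq> 0 \<longrightarrow> homogeneous k f \<longrightarrow> (\<forall>x\<in>X. f (\<pi> x) = 0)"
    using exists_retraction[OF \<epsilon>] by blast
  have \<pi>_inv: "f (\<pi> x) = f x" if "f \<in> invariant_funs" "x \<in> X" for f x using \<pi>_inv' that by blast
  have \<pi>_weight: "f (\<pi> x) = 0" if "k \<noteq> 0" "homogeneous k f" "x \<in> X" for k f x
    using \<pi>_weight' that by blast
  have \<pi>_X: "\<pi> x \<in> X" if "x \<in> X" for x using \<pi> that by (auto simp: morphism_def)
  have zero_part: "\<exists>p0\<in>invariant_funs. \<forall>x\<in>X. p (\<pi> x) = p0 x" if p: "p \<in> polynomial_funs" for p
  proof -
    obtain c S where c: "finite S" "\<forall>k. homogeneous k (c k)" "\<forall>k. k \<notin> S \<longrightarrow> c k = (\<lambda>_. 0)"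
      "\<forall>x\<in>X. p x = (\<Sum>k\<in>S. c k x)"
      using homogeneous_decomposition[OF p] by blast
    have c0: "c 0 \<in> invariant_funs" using c(2) by (simp add: invariant_funs_def)
    have "p (\<pi> x) = c 0 x" if x: "x \<in> X" for x
    proof -
      have "p (\<pi> x) = (\<Sum>k\<in>S. c k (\<pi> x))" using c(4) \<pi>_X[OF x] by blast
      also have "\<dots> = (\<Sum>k\<in>S. if k = 0 then c 0 x else 0)"
        using \<pi>_weight c(2) x \<pi>_inv[OF c0 x] by (intro sum.cong) auto
      also have "\<dots> = c 0 x" using c(1,3) by (cases "0 \<in> S") (auto simp: sum.delta)
      finally show ?thesis .
    qed
    then show ?thesis using c0 by blast
  qed
  have \<pi>_\<pi>: "\<pi> (\<pi> x) = \<pi> x" if x: "x \<in> X" for x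
  proof
    fix j
    obtain p where p: "p \<in> invariant_funs" "\<forall>x\<in>X. \<pi> x j = p x"
      using zero_part[OF polynomial_coord[of j]] by blast
    then show "\<pi> (\<pi> x) j = \<pi> x j" using \<pi>_X[OF x] \<pi>_inv[OF p(1) x] x by simp
  qed
  define D where "D = {x \<in> X. \<pi> x = x}"
  have D_image: "\<pi> x \<in> D" if "x \<in> X" for x using \<pi>_\<pi> \<pi>_X that by (simp add: D_def)
  have fixed: "\<phi> t x = x" if x: "x \<in> D" and t: "t \<noteq> 0" for t x
  proof
    fix j
    have xX: "x \<in> X" "\<pi> x = x" using x by (simp_all add: D_def)
    obtain c S where c: "\<forall>k. homogeneous k (c k)" "\<forall>x\<in>X. x j = (\<Sum>k\<in>S. c k x)"
      using homogeneous_decomposition[OF polynomial_coord[of j]] by blast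
    have "c k (\<phi> t x) = c k x" for k
    proof (cases "k = 0")
      case True
      then show ?thesis using homogeneousD[OF c(1)[rule_format], of t x 0] t xX by simp
    next
      case False
      then have "c k x = 0" using \<pi>_weight[of k "c k" x] c(1) xX by simp
      then show ?thesis using homogeneousD[OF c(1)[rule_format], of t x k] t xX by simp
    qed
    moreover have "\<phi> t x j = (\<Sum>k\<in>S. c k (\<phi> t x))" using c(2) in_variety[OF t xX(1)] by blast
    moreover have "x j = (\<Sum>k\<in>S. c k x)" using c(2) xX(1) by blast
    ultimately show "\<phi> t x j = x j" by simp
  qed
  have vanish_D: "f \<in> vanishing_ideal D \<longleftrightarrow> (\<forall>x\<in>X. f (\<pi> x) = 0)" if "f \<in> polynomial_funs" for f
    using that D_image by (auto simp: vanishing_ideal_def D_def)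
  have D: "affine_variety D"
  proof (rule prime_affine_variety)
    obtain r where r: "\<And>j. r j \<in> polynomial_funs" "\<And>j. \<forall>x\<in>X. \<pi> x j = r j x"
      using \<pi> unfolding morphism_def regular_fun_def Bex_def by metis
    have "D = X \<inter> {x. \<forall>p\<in>range (\<lambda>j x. r j x - x j). p x = 0}"
      using r(2) by (auto simp: D_def fun_eq_iff)
    moreover have "closedin zariski {x. \<forall>p\<in>range (\<lambda>j x. r j x - x j). p x = 0}"
      unfolding closedin_zariski
      by (rule exI[of _ "range (\<lambda>j x. r j x - x j)"]) (use r(1) in \<open>auto intro: polynomial_closed polynomial_coord\<close>)
    moreover have "closedin zariski X" using X by (simp add: affine_variety_def)
    ultimately show "closedin zariski D" by (simp add: closedin_Int)
    show "prime_fun_ideal polynomial_funs (vanishing_ideal D)"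
      unfolding prime_fun_ideal_def
    proof (intro conjI ballI impI fun_ideal_vanishing_ideal)
      show "(\<lambda>_. 1) \<notin> vanishing_ideal D"
        using vanish_D[OF polynomial_closed(1)[of 1]] X by (auto simp: affine_variety_def)
      fix f g :: "('n \<Rightarrow> 'k) \<Rightarrow> 'k"
      assume f: "f \<in> polynomial_funs" and g: "g \<in> polynomial_funs" and fg: "(\<lambda>x. f x * g x) \<in> vanishing_ideal D"
      obtain f' where f': "f' \<in> invariant_funs" "\<forall>x\<in>X. f (\<pi> x) = f' x" using zero_part[OF f] by blast
      obtain g' where g': "g' \<in> invariant_funs" "\<forall>x\<in>X. g (\<pi> x) = g' x" using zero_part[OF g] by blast
      note R = invariant_funs_polynomial[OF f'(1)] invariant_funs_polynomial[OF g'(1)]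
      have "(\<lambda>x. f' x * g' x) \<in> vanishing_ideal X"
      proof (rule vanishing_idealI[OF polynomial_closed(3)[OF R]])
        fix x assume x: "x \<in> X"
        show "f' x * g' x = 0" using vanishing_idealD[OF fg D_image[OF x]] f'(2) g'(2) x by simp
      qed
      then have "f' \<in> vanishing_ideal X \<or> g' \<in> vanishing_ideal X" by (rule prime_fun_idealD[OF prime_X _ R])
      then show "f \<in> vanishing_ideal D \<or> g \<in> vanishing_ideal D"
        using f'(2) g'(2) vanish_D[OF f] vanish_D[OF g] vanishing_idealD by metis
    qed
  qed
  obtain s0 c where s0: "s0 \<in> polynomial_funs" and c: "c \<in> invariant_funs" "c \<notin> vanishing_ideal X"
    and slice0: "\<forall>v. \<forall>x\<in>X. s0 (\<psi> v x) = s0 x + v * c x"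
    using exists_local_slice by blast
  obtain s00 where s00: "s00 \<in> invariant_funs" "\<forall>x\<in>X. s0 (\<pi> x) = s00 x" using zero_part[OF s0] by blast
  \<comment> \<open>Subtracting the weight zero part makes the slice vanish on \<open>D\<close>.\<close>
  define s where "s = (\<lambda>x. s0 x - s00 x)"
  have s: "s \<in> polynomial_funs" unfolding s_def by (intro polynomial_closed s0 invariant_funs_polynomial[OF s00(1)])
  have slice: "\<forall>v. \<forall>x\<in>X. s (\<psi> v x) = s x + v * c x"
    using slice0 invariant_funs_\<psi>[OF s00(1)] by (simp add: s_def)
  have s_\<pi>: "s (\<pi> x) = 0" if "x \<in> X" for x
    using s00(2) \<pi>_inv[OF s00(1) that] that by (simp add: s_def)
  note cR = invariant_funs_polynomial[OF c(1)]
  have expand: "\<exists>K a d. (\<forall>i. a i \<in> invariant_funs) \<and> (\<forall>x\<in>X. c x ^ K * g x = (\<Sum>i\<le>d. a i x * s x ^ i))"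
    if g: "g \<in> polynomial_funs" for g
  proof -
    obtain K e where e: "e \<in> adjoin invariant_funs s" "\<forall>x\<in>X. c x ^ K * g x = e x"
      using slice_generates[OF s c(1) slice g] by blast
    obtain a d where "\<forall>i. a i \<in> invariant_funs" "\<forall>x. e x = (\<Sum>i\<le>d. a i x * s x ^ i)"
      using adjoinD[OF e(1)] by blast
    then show ?thesis using e(2) by (intro exI[of _ K] exI[of _ a] exI[of _ d]) simp
  qed
  \<comment> \<open>At \<open>\<pi> x\<close> all terms with a positive power of \<open>s\<close> disappear.\<close>
  have constant_term: "a 0 x = 0"
    if a: "\<forall>i. a i \<in> invariant_funs" and eq: "\<forall>x\<in>X. c x ^ K * g x = (\<Sum>i\<le>d. a i x * s x ^ i)"
      and g: "\<forall>x\<in>X. g (\<pi> x) = 0" and x: "x \<in> X" for a K g x and d :: nat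
  proof -
    have "(\<Sum>i\<le>d. a i (\<pi> x) * s (\<pi> x) ^ i) = c (\<pi> x) ^ K * g (\<pi> x)" using eq \<pi>_X[OF x] by simp
    also have "\<dots> = 0" using g x by simp
    finally have "(\<Sum>i\<le>d. a i (\<pi> x) * s (\<pi> x) ^ i) = 0" .
    moreover have "(\<Sum>i\<le>d. a i (\<pi> x) * s (\<pi> x) ^ i) = (\<Sum>i\<le>d. if i = 0 then a 0 x else 0)"
      using \<pi>_inv[OF a[rule_format] x] s_\<pi>[OF x] by (intro sum.cong) auto
    ultimately show ?thesis by simp
  qed
  have maximal: "Z = D" if Z: "affine_variety Z" "D \<subseteq> Z" "Z \<subset> X" for Z
  proof -
    have Zprime: "prime_fun_ideal polynomial_funs (vanishing_ideal Z)" by (rule affine_variety_prime[OF Z(1)])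
    have D_in: "g (\<pi> x) = 0" if "g \<in> vanishing_ideal Z" "x \<in> X" for g x
      using vanishing_idealD[OF that(1)] D_image[OF that(2)] Z(2) by blast
    obtain y where y: "y \<in> X" "y \<notin> Z" using Z(3) by blast
    then obtain f where f: "f \<in> vanishing_ideal Z" "f y \<noteq> 0"
      using Z(1) closedin_zariski_vanishing[of Z y] unfolding affine_variety_def by blast
    note fR = vanishing_ideal_polynomial[OF f(1)]
    obtain K a d where a: "\<forall>i. a i \<in> invariant_funs" "\<forall>x\<in>X. c x ^ K * f x = (\<Sum>i\<le>d. a i x * s x ^ i)"
      using expand[OF fR] by blast
    have aR: "a i \<in> polynomial_funs" for i using a(1) invariant_funs_polynomial by blast
    have "\<exists>l\<le>d. a l \<notin> vanishing_ideal X"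
    proof (rule ccontr)
      assume "\<not> ?thesis"
      then have "\<forall>l\<le>d. \<forall>x\<in>X. a l x = 0" using vanishing_idealD by blast
      then have "\<forall>x\<in>X. c x ^ K * f x = 0" using a(2) by simp
      then have "(\<lambda>x. c x ^ K * f x) \<in> vanishing_ideal X"
        using polynomial_closed(3)[OF polynomial_closed(7)[OF cR] fR] by (simp add: vanishing_ideal_def)
      moreover have "f \<notin> vanishing_ideal X" using f(2) y(1) vanishing_idealD by blast
      ultimately show False
        using not_vanishing_mult[OF polynomial_closed(7)[OF cR]
            prime_fun_ideal_power[OF subalgebra_polynomial_funs prime_X cR c(2)] fR] by blast
    qed
    define l where "l = (LEAST l. a l \<notin> vanishing_ideal X)"
    obtain l' where l': "l' \<le> d" "a l' \<notin> vanishing_ideal X" using \<open>\<exists>l\<le>d. a l \<notin> vanishing_ideal X\<close> by blast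
    have l: "a l \<notin> vanishing_ideal X" unfolding l_def by (rule LeastI[of _ l']) (rule l'(2))
    have "l \<le> l'" unfolding l_def by (rule Least_le) (rule l'(2))
    then have ld: "l \<le> d" using l'(1) by simp
    have below: "a i x = 0" if "i < l" "x \<in> X" for i x
      using not_less_Least[of i "\<lambda>l. a l \<notin> vanishing_ideal X"] that vanishing_idealD unfolding l_def by blast
    define w where "w = (\<lambda>x. \<Sum>i\<le>d - l. a (i + l) x * s x ^ i)"
    have wR: "w \<in> polynomial_funs" unfolding w_def by (intro polynomial_closed aR s)
    have factor: "c x ^ K * f x = s x ^ l * w x" if x: "x \<in> X" for x
    proof -
      have "(\<Sum>i\<le>d. a i x * s x ^ i) = (\<Sum>i\<in>{l..d}. a i x * s x ^ i)"
        using below x by (intro sum.mono_neutral_right) auto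
      also have "\<dots> = (\<Sum>i\<le>d - l. a (i + l) x * s x ^ (i + l))"
        by (rule sum.reindex_bij_witness[of _ "\<lambda>i. i + l" "\<lambda>i. i - l"]) (use ld in auto)
      finally show ?thesis using a(2) x by (simp add: w_def sum_distrib_left power_add mult_ac)
    qed
    have "s \<in> vanishing_ideal Z"
    proof (rule ccontr)
      assume sZ: "s \<notin> vanishing_ideal Z"
      have "(\<lambda>x. s x ^ l * w x) \<in> vanishing_ideal Z"
      proof (rule vanishing_idealI)
        show "(\<lambda>x. s x ^ l * w x) \<in> polynomial_funs" by (intro polynomial_closed s wR)
        fix z assume z: "z \<in> Z"
        then have "z \<in> X" using Z(3) by blast
        then show "s z ^ l * w z = 0" using factor[of z] vanishing_idealD[OF f(1) z] by simp
      qed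
      then have "w \<in> vanishing_ideal Z"
        using prime_fun_idealD[OF Zprime _ polynomial_closed(7)[OF s] wR]
          prime_fun_ideal_power[OF subalgebra_polynomial_funs Zprime s sZ] by blast
      then have w0: "w (\<pi> x) = 0" if "x \<in> X" for x using D_in that by blast
      have "a l x = 0" if x: "x \<in> X" for x
      proof -
        have "w (\<pi> x) = (\<Sum>i\<le>d - l. if i = 0 then a l x else 0)"
          unfolding w_def using \<pi>_inv[OF a(1)[rule_format] x] s_\<pi>[OF x] by (intro sum.cong) auto
        then show ?thesis using w0[OF x] by simp
      qed
      then show False using l vanishing_idealI[OF aR] by blast
    qed
    moreover have "c \<notin> vanishing_ideal Z"
    proof
      assume "c \<in> vanishing_ideal Z"
      then have "c x = 0" if "x \<in> X" for x using D_in[of c x] \<pi>_inv[OF c(1)] that by simp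
      then show False using c(2) vanishing_idealI[OF cR] by blast
    qed
    ultimately have *: "g z = 0" if g: "g \<in> polynomial_funs" "\<forall>x\<in>X. g (\<pi> x) = 0" and z: "z \<in> Z" for g z
    proof -
      obtain K a d where a: "\<forall>i. a i \<in> invariant_funs" "\<forall>x\<in>X. c x ^ K * g x = (\<Sum>i\<le>d. a i x * s x ^ i)"
        using expand[OF g(1)] by blast
      have "(\<lambda>x. c x ^ K * g x) \<in> vanishing_ideal Z"
      proof (rule vanishing_idealI)
        show "(\<lambda>x. c x ^ K * g x) \<in> polynomial_funs" by (intro polynomial_closed cR g)
        fix z assume z: "z \<in> Z"
        then have zX: "z \<in> X" using Z(3) by blast
        have "a i z * s z ^ i = 0" for i
          using constant_term[OF a g(2) zX] vanishing_idealD[OF \<open>s \<in> vanishing_ideal Z\<close> z]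
          by (cases "i = 0") (auto simp: power_0_left)
        then have "(\<Sum>i\<le>d. a i z * s z ^ i) = 0" by (intro sum.neutral ballI)
        then show "c z ^ K * g z = 0" using a(2) zX by simp
      qed
      then have "g \<in> vanishing_ideal Z"
        using prime_fun_idealD[OF Zprime _ polynomial_closed(7)[OF cR] g(1)]
          prime_fun_ideal_power[OF subalgebra_polynomial_funs Zprime cR \<open>c \<notin> vanishing_ideal Z\<close>] by blast
      then show ?thesis using vanishing_idealD z by blast
    qed
    have "z \<in> D" if z: "z \<in> Z" for z
    proof -
      have zX: "z \<in> X" using z Z(3) by blast
      have "\<pi> z j = z j" for j
      proof -
        obtain p where p: "p \<in> invariant_funs" "\<forall>x\<in>X. \<pi> x j = p x"
          using zero_part[OF polynomial_coord[of j]] by blast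
        have "p z - z j = 0"
          by (rule *[OF _ _ z]) (use p \<pi>_inv[OF p(1)] in
              \<open>auto intro: polynomial_closed polynomial_coord invariant_funs_polynomial\<close>)
        then show ?thesis using p(2) zX by simp
      qed
      then show ?thesis using zX by (auto simp: D_def)
    qed
    then show "Z = D" using Z(2) by blast
  qed
  have "D \<subseteq> X" by (auto simp: D_def)
  moreover have "D \<noteq> X" using nontrivial_action[OF faithful] fixed[of _ 2] by auto
  ultimately have "prime_divisor X D"
    unfolding prime_divisor_iff[OF X] using D maximal by blast
  then show ?thesis using fixed by (intro exI[of _ D]) (simp add: Gm_def)
qed

end

theorem theorem1:
  fixes X :: "('n::finite \<Rightarrow> 'k::{alg_closed_field, field_char_0}) set"
    and \<phi> :: "'k \<Rightarrow> ('n \<Rightarrow> 'k) \<Rightarrow> ('n \<Rightarrow> 'k)"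
  assumes "normal_affine_variety X"
    and "regular_Gm_action X \<phi>"
    and "faithful_action Gm X \<phi>"
  shows "(\<exists>\<psi>. compatible_action X \<phi> \<psi>) \<longleftrightarrow>
    (\<exists>D. prime_divisor X D \<and> (\<forall>x\<in>D. \<forall>t\<in>carrier Gm. \<phi> t x = x))"
proof -
  interpret Gm_variety X \<phi>
    using assms(1,2) by unfold_locales (simp_all add: normal_affine_variety_def)
  show ?thesis
  proof
    assume "\<exists>\<psi>. compatible_action X \<phi> \<psi>"
    then obtain \<psi> where \<psi>: "compatible_action X \<phi> \<psi>" ..
    interpret compatible_Gm_variety X \<phi> \<psi>
      by (intro compatible_Gm_variety.intro Gm_variety_axioms compatible_Gm_variety_axioms.intro
          assms(3) \<psi>)
    show "\<exists>D. prime_divisor X D \<and> (\<forall>x\<in>D. \<forall>t\<in>carrier Gm. \<phi> t x = x)"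
      by (rule exists_fixed_divisor)
  next
    assume "\<exists>D. prime_divisor X D \<and> (\<forall>x\<in>D. \<forall>t\<in>carrier Gm. \<phi> t x = x)"
    then show "\<exists>\<psi>. compatible_action X \<phi> \<psi>"
      using fixed_divisor_imp_compatible_action[OF assms(1,3)] by blast
  qed
qed

end
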